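(* Let $R$ be a local Noetherian super-ring containing a field, with maximal superideal $\mathfrak{M}=\mathfrak{m}\oplus R_1$ and $d=\mathrm{Ksdim}_0(R)$. Let $\mathfrak{N}$ be a special $\mathfrak{M}$-primary superideal of $R$, let $B=\mathsf{bgr}_{\mathfrak{N}}(R)=\bigoplus_{k,l\ge0}B(k,l)$, and for each $l\ge0$ let $g_{B(l)}$ be the polynomial such that $g_{B(l)}(n)=\sum_{0\le k\le n}\dim B(k,l)$ for all sufficiently large $n$. Then $$\mathrm{Ksdim}_1(R)=\max\{l \mid g_{B(l)}\ \text{has degree}\ d\}.$$
   Context: A super-ring is a unital associative $\mathbb{Z}_2$-graded ring $R=R_0\oplus R_1$; all super-rings are super-commutative ($ab=(-1)^{|a||b|}ba$ for homogeneous $a,b$, and $a^2=0$ for odd $a$). Superideals are $\mathbb{Z}_2$-graded ideals $I=I_0\oplus I_1$. Noetherian means the ascending chain condition on superideals. $R$ is local if $R_0$ is local with maximal ideal $\mathfrak{m}$; then $\mathfrak{M}=\mathfrak{m}\oplus R_1$ is its maximal superideal. A superideal $\mathfrak{N}$ is $\mathfrak{M}$-primary if $\mathfrak{n}:=\mathfrak{N}_0$ is an $\mathfrak{m}$-primary ideal of $R_0$. An $\mathfrak{M}$-primary superideal $\mathfrak{N}$ is special if $\mathfrak{N}_1=R_1$ and there are $x_1,\dots,x_d\in R_0$ whose residue classes form a system of parameters of the local ring $\overline{R}=R_0/R_1^2$ and generate the ideal $(\mathfrak{n}+R_1^2)/R_1^2$ of $\overline{R}$. $\mathrm{Ksdim}_0(R)=\mathrm{Kdim}(R_0)$.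 Odd elements $y_1,\dots,y_s\in R_1$ ($s\ge1$) form a system of odd parameters of $R$ if $\mathrm{Kdim}(R_0/\mathrm{Ann}_{R_0}(y_1\cdots y_s))=\mathrm{Kdim}(R_0)$; $\mathrm{Ksdim}_1(R)$ is the supremum of their lengths ($0$ if there are none). With $\mathfrak{N}_{k,l}=\mathfrak{n}^k\mathfrak{N}_1^lR$ ($\mathfrak{N}_{0,0}=R$), $\mathsf{bgr}_{\mathfrak{N}}(R)=\bigoplus_{k,l\ge0}B(k,l)$ where $B(k,l)=\mathfrak{N}_{k,l}/(\mathfrak{N}_{k+1,l}+\mathfrak{N}_{k,l+1})$. Since $R_0/\mathfrak{n}=B(0,0)_0$ is an Artinian local ring containing a field, it contains a coefficient field $K\simeq R_0/\mathfrak{m}$; each $B(k,l)$ is a finite-dimensional $K$-vector space and $\dim$ denotes dimension over $K$ (equivalently, the length as an $R_0$-module). For each $l$ the function $n\mapsto\sum_{0\le k\le n}\dim B(k,l)$ agrees for large $n$ with a polynomial of degree at most $d$. The zero polynomial has degree $-\infty$. *)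

theory Defs
  imports
    "HOL-Algebra.Subrings"
    "HOL-Algebra.QuotRing"
    "HOL-Algebra.Ideal_Product"
    "HOL-Library.Extended_Real"
    "HOL-Computational_Algebra.Polynomial"
    "Jordan_Normal_Form.Missing_VectorSpace"
begin

section \<open>Commutative algebra\<close>

text \<open>The supremum is taken in \<^typ>\<open>ereal\<close>, so that the zero ring, which has no prime ideals,
  has dimension \<open>-\<infinity>\<close>. This matters for quotients \<open>R\<^sub>0 / Ann(y)\<close> with \<open>y = 0\<close>, which must not be
  confused with rings of dimension \<open>0\<close>.\<close>

definition Kdim :: "('a, 'b) ring_scheme \<Rightarrow> ereal" where
  "Kdim A = (SUP n \<in> {n. \<exists>p. (\<forall>i\<le>n. primeideal (p i) A) \<and> (\<forall>i<n. p i \<subset> p (Suc i))}.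
     ereal (real n))"

definition local_cring :: "('a, 'b) ring_scheme \<Rightarrow> 'a set \<Rightarrow> bool" where
  "local_cring A m \<longleftrightarrow> cring A \<and> maximalideal m A \<and> (\<forall>m'. maximalideal m' A \<longrightarrow> m' = m)"

definition radical_of :: "('a, 'b) ring_scheme \<Rightarrow> 'a set \<Rightarrow> 'a set" where
  "radical_of A Q = {a \<in> carrier A. \<exists>k::nat. a [^]\<^bsub>A\<^esub> k \<in> Q}"

definition primary_ideal :: "('a, 'b) ring_scheme \<Rightarrow> 'a set \<Rightarrow> 'a set \<Rightarrow> bool" where
  "primary_ideal A p Q \<longleftrightarrow> ideal Q A \<and> Q \<noteq> carrier A \<and>
     (\<forall>a \<in> carrier A. \<forall>b \<in> carrier A. a \<otimes>\<^bsub>A\<^esub> b \<in> Q \<longrightarrow> a \<in> Q \<or> b \<in> radical_of A Q) \<and>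
     radical_of A Q = p"

definition system_of_parameters :: "('a, 'b) ring_scheme \<Rightarrow> 'a list \<Rightarrow> bool" where
  "system_of_parameters A xs \<longleftrightarrow> set xs \<subseteq> carrier A \<and> ereal (real (length xs)) = Kdim A \<and>
     (\<exists>m. local_cring A m \<and> primary_ideal A m (Idl\<^bsub>A\<^esub> (set xs)))"

definition coefficient_field :: "('a, 'b) ring_scheme \<Rightarrow> 'a set \<Rightarrow> bool" where
  "coefficient_field A K \<longleftrightarrow> subfield K A \<and>
     (\<exists>m. local_cring A m \<and> bij_betw (\<lambda>a. m +>\<^bsub>A\<^esub> a) K (carrier (A Quot m)))"

definition poly_degree :: "rat poly \<Rightarrow> ereal" where
  "poly_degree p = (if p = 0 then - \<infinity> else ereal (real (degree p)))"

section \<open>Super-rings\<close>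

locale super_ring = ring R for R (structure) +
  fixes R0 R1
  assumes even_subring: "subring R0 R"
    and odd_subgroup: "additive_subgroup R1 R"
    and grading_sum: "R0 <+> R1 = carrier R"
    and grading_direct: "R0 \<inter> R1 = {\<zero>}"
    and even_odd_closed: "\<lbrakk>a \<in> R0; b \<in> R1\<rbrakk> \<Longrightarrow> a \<otimes> b \<in> R1"
    and odd_even_closed: "\<lbrakk>a \<in> R1; b \<in> R0\<rbrakk> \<Longrightarrow> a \<otimes> b \<in> R1"
    and odd_odd_closed: "\<lbrakk>a \<in> R1; b \<in> R1\<rbrakk> \<Longrightarrow> a \<otimes> b \<in> R0"
    and even_even_commute: "\<lbrakk>a \<in> R0; b \<in> R0\<rbrakk> \<Longrightarrow> a \<otimes> b = b \<otimes> a"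
    and even_odd_commute: "\<lbrakk>a \<in> R0; b \<in> R1\<rbrakk> \<Longrightarrow> a \<otimes> b = b \<otimes> a"
    and odd_odd_anticommute: "\<lbrakk>a \<in> R1; b \<in> R1\<rbrakk> \<Longrightarrow> a \<otimes> b = \<ominus> (b \<otimes> a)"
    and odd_square_zero: "a \<in> R1 \<Longrightarrow> a \<otimes> a = \<zero>"

abbreviation even_ring :: "('a, 'b) ring_scheme \<Rightarrow> 'a set \<Rightarrow> ('a, 'b) ring_scheme" where
  "even_ring R R0 \<equiv> R\<lparr>carrier := R0\<rparr>"

definition superideal :: "('a, 'b) ring_scheme \<Rightarrow> 'a set \<Rightarrow> 'a set \<Rightarrow> 'a set \<Rightarrow> bool" where
  "superideal R R0 R1 I \<longleftrightarrow> ideal I R \<and> (I \<inter> R0) <+>\<^bsub>R\<^esub> (I \<inter> R1) = I"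

definition noetherian_super_ring :: "('a, 'b) ring_scheme \<Rightarrow> 'a set \<Rightarrow> 'a set \<Rightarrow> bool" where
  "noetherian_super_ring R R0 R1 \<longleftrightarrow>
     (\<forall>I :: nat \<Rightarrow> 'a set. (\<forall>i. superideal R R0 R1 (I i)) \<and> (\<forall>i. I i \<subseteq> I (Suc i)) \<longrightarrow>
        (\<exists>n. \<forall>i\<ge>n. I i = I n))"

definition primary_superideal ::
    "('a, 'b) ring_scheme \<Rightarrow> 'a set \<Rightarrow> 'a set \<Rightarrow> 'a set \<Rightarrow> 'a set \<Rightarrow> bool" where
  "primary_superideal R R0 R1 M N \<longleftrightarrow>
     superideal R R0 R1 N \<and> primary_ideal (even_ring R R0) (M \<inter> R0) (N \<inter> R0)"

text \<open>\<open>R1 \<cdot> R1\<close> is the set of all finite sums of products of two odd elements, an ideal of the even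
  part. A system of parameters of the quotient has length \<open>Kdim (R\<^sub>0 / R\<^sub>1\<^sup>2) = Kdim R\<^sub>0\<close>, because
  \<open>R\<^sub>1\<^sup>2\<close> consists of nilpotent elements.\<close>

definition special_superideal ::
    "('a, 'b) ring_scheme \<Rightarrow> 'a set \<Rightarrow> 'a set \<Rightarrow> 'a set \<Rightarrow> bool" where
  "special_superideal R R0 R1 N \<longleftrightarrow> N \<inter> R1 = R1 \<and>
     (let J = R1 \<cdot>\<^bsub>R\<^esub> R1; A = even_ring R R0 Quot J in
      \<exists>xs. set xs \<subseteq> R0 \<and> system_of_parameters A (map (\<lambda>x. J +>\<^bsub>R\<^esub> x) xs) \<and>
        Idl\<^bsub>A\<^esub> (set (map (\<lambda>x. J +>\<^bsub>R\<^esub> x) xs)) = (\<lambda>a. J +>\<^bsub>R\<^esub> a) ` ((N \<inter> R0) <+>\<^bsub>R\<^esub> J))"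

section \<open>Super-dimension\<close>

definition Ksdim0 :: "('a, 'b) ring_scheme \<Rightarrow> 'a set \<Rightarrow> ereal" where
  "Ksdim0 R R0 = Kdim (even_ring R R0)"

definition even_annihilator :: "('a, 'b) ring_scheme \<Rightarrow> 'a set \<Rightarrow> 'a \<Rightarrow> 'a set" where
  "even_annihilator R R0 y = {a \<in> R0. a \<otimes>\<^bsub>R\<^esub> y = \<zero>\<^bsub>R\<^esub>}"

definition odd_parameters :: "('a, 'b) ring_scheme \<Rightarrow> 'a set \<Rightarrow> 'a set \<Rightarrow> 'a list \<Rightarrow> bool" where
  "odd_parameters R R0 R1 ys \<longleftrightarrow> ys \<noteq> [] \<and> set ys \<subseteq> R1 \<and>
     Kdim (even_ring R R0 Quot even_annihilator R R0 (foldr (\<otimes>\<^bsub>R\<^esub>) ys \<one>\<^bsub>R\<^esub>)) =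
       Kdim (even_ring R R0)"

definition Ksdim1 :: "('a, 'b) ring_scheme \<Rightarrow> 'a set \<Rightarrow> 'a set \<Rightarrow> enat" where
  "Ksdim1 R R0 R1 = (SUP ys \<in> {ys. odd_parameters R R0 R1 ys}. enat (length ys))"

section \<open>The bigraded ring of a superideal\<close>

text \<open>\<open>N\<^sub>k\<^sub>,\<^sub>l = n\<^sup>k N\<^sub>1\<^sup>l R\<close>, with the product evaluated from the right so that the empty product is \<open>R\<close>.\<close>

definition bifiltration ::
    "('a, 'b) ring_scheme \<Rightarrow> 'a set \<Rightarrow> 'a set \<Rightarrow> 'a set \<Rightarrow> nat \<Rightarrow> nat \<Rightarrow> 'a set" where
  "bifiltration R R0 R1 N k l =
     ((\<lambda>J. (N \<inter> R0) \<cdot>\<^bsub>R\<^esub> J) ^^ k) (((\<lambda>J. (N \<inter> R1) \<cdot>\<^bsub>R\<^esub> J) ^^ l) (carrier R))"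

text \<open>\<open>X / Y\<close> with cosets (of an ideal of scalars multiplying \<open>X\<close> into \<open>Y\<close>) as scalars: for cosets
  \<open>c = a + n\<close> and \<open>v = x + Y\<close>, the set \<^term>\<open>rcoset_mult R Y c v\<close> is the coset \<open>a x + Y\<close>. The fields
  \<open>mult\<close> and \<open>one\<close> are part of the record of modules but play no role for them.\<close>

definition quotient_module ::
    "('a, 'b) ring_scheme \<Rightarrow> 'a set \<Rightarrow> 'a set \<Rightarrow> ('a set, 'a set) module" where
  "quotient_module R X Y =
     \<lparr>carrier = (\<lambda>x. Y +>\<^bsub>R\<^esub> x) ` X, monoid.mult = rcoset_mult R Y, one = Y +>\<^bsub>R\<^esub> \<one>\<^bsub>R\<^esub>,
      zero = Y, add = set_add R, module.smult = rcoset_mult R Y\<rparr>"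

definition bgr_component ::
    "('a, 'b) ring_scheme \<Rightarrow> 'a set \<Rightarrow> 'a set \<Rightarrow> 'a set \<Rightarrow> nat \<Rightarrow> nat \<Rightarrow> ('a set, 'a set) module" where
  "bgr_component R R0 R1 N k l =
     quotient_module R (bifiltration R R0 R1 N k l)
       (bifiltration R R0 R1 N (Suc k) l <+>\<^bsub>R\<^esub> bifiltration R R0 R1 N k (Suc l))"

text \<open>\<open>K\<close> is a subfield of \<open>R\<^sub>0 / n\<close>.\<close>

definition bgr_dim ::
    "('a, 'b) ring_scheme \<Rightarrow> 'a set \<Rightarrow> 'a set \<Rightarrow> 'a set \<Rightarrow> 'a set set \<Rightarrow> nat \<Rightarrow> nat \<Rightarrow> nat" where
  "bgr_dim R R0 R1 N K k l =
     vectorspace.dim ((even_ring R R0 Quot (N \<inter> R0))\<lparr>carrier := K\<rparr>) (bgr_component R R0 R1 N k l)"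

end

theory Submission
  imports Defs "HOL-Library.List_Lexorder"
begin

text \<open>Write \<open>n = N\<^sub>0\<close> and \<open>M\<^sub>l = R\<^sub>1\<^sup>l\<close>, an \<open>R\<^sub>0\<close>-module. Since \<open>N\<^sub>1 = R\<^sub>1\<close> forces \<open>R\<^sub>1\<^sup>2 \<subseteq> n\<close>, the component
  \<open>B(k,l)\<close> has the length of \<open>n\<^sup>k M\<^sub>l / n\<^bsup>k+1\<^esup> M\<^sub>l\<close>, so the polynomial of \<open>B(l)\<close> is the Hilbert--Samuel
  polynomial of \<open>M\<^sub>l\<close> with respect to \<open>n\<close>. Its degree is always at most \<open>d\<close>, and it equals \<open>d\<close> iff some
  \<open>u \<in> M\<^sub>l\<close> has \<open>dim R\<^sub>0 / Ann(u) = d\<close>. As \<open>M\<^sub>l\<close> is generated by finitely many products of \<open>l\<close> odd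
  elements, \<open>u\<close> can be taken to be such a product, that is, to come from odd parameters.

  The growth of \<open>R\<^sub>0 / (I + n\<^sup>k)\<close> is compared with chains of primes above \<open>I\<close> directly, without systems of
  parameters: the upper bound is an induction on the length of the chains after reduction to prime \<open>I\<close>,
  the lower bound follows from the Artin--Rees lemma.\<close>

no_notation Sum_Type.Plus (infixr \<open><+>\<close> 65)

section \<open>Exponent lists, growth of polynomials, suprema\<close>

text \<open>All modules involved are subsets of R stable under R_0, so quotient modules can be
  replaced by intervals of submodules, and cyclic modules by colon ideals in R_0. Only growth is
  compared: the polynomials are given, and growth bounds for their values pin down their degrees.
  The upper bound is subadditive over generators. This is why products of odd generators suffice: if
  no chain of length d lies above the annihilator of any generating product, the whole of M_l grows
  with exponent less than d. The lower bound cannot be read off from the cyclic module of u alone,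
  because the intersection of n^k M_l with R_0 u may be larger than n^k u. Artin--Rees bounds the
  discrepancy by a fixed shift of k, which does not affect the degree. The maximum exists because
  R_1 is finitely generated and odd elements square to zero, so that M_l vanishes for large l, while
  l = 0 is always attained through the empty product.\<close>

lemma nondecreasing_subseq:
  fixes f :: "nat \<Rightarrow> nat"
  shows "\<exists>g :: nat \<Rightarrow> nat. strict_mono g \<and> (\<forall>i j. i \<le> j \<longrightarrow> f (g i) \<le> f (g j))"
proof -
  obtain g :: "nat \<Rightarrow> nat" where g: "strict_mono g" "monoseq (\<lambda>n. f (g n))"
    using seq_monosub[of f] by blast
  \<comment> \<open>A nonincreasing sequence of naturals is constant from an index of its least
    value on, so in either monotone case the sequence started at \<open>m\<close> is
    nondecreasing.\<close>
  obtain m where m: "\<And>i. f (g m) \<le> f (g i)"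
    using ex_has_least_nat[of "\<lambda>_. True" 0 "\<lambda>i. f (g i)"] by blast
  show ?thesis
  proof (intro exI conjI allI impI)
    show "strict_mono (\<lambda>i. g (m + i))" using g(1) by (simp add: strict_mono_def)
    fix i j :: nat assume ij: "i \<le> j"
    show "f (g (m + i)) \<le> f (g (m + j))"
      using g(2) unfolding monoseq_def
    proof
      assume "\<forall>k. \<forall>n\<ge>k. f (g k) \<le> f (g n)"
      then show ?thesis using ij by simp
    next
      assume "\<forall>k. \<forall>n\<ge>k. f (g n) \<le> f (g k)"
      then have "f (g (m + i)) \<le> f (g m)" by simp
      also have "\<dots> \<le> f (g (m + j))" by (rule m)
      finally show ?thesis .
    qed
  qed
qed

text \<open>Dickson's lemma in sequence form: thin out for the first coordinate, then for the tails;
  a further subsequence keeps the first coordinate nondecreasing.\<close>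

lemma dickson:
  fixes f :: "nat \<Rightarrow> nat list"
  assumes "\<And>i. length (f i) = r"
  shows "\<exists>g :: nat \<Rightarrow> nat. strict_mono g \<and> (\<forall>i j. i \<le> j \<longrightarrow> list_all2 (\<le>) (f (g i)) (f (g j)))"
  using assms
proof (induction r arbitrary: f)
  case 0
  then show ?case by (intro exI[of _ id]) (simp add: strict_mono_def)
next
  case (Suc r)
  from nondecreasing_subseq[of "\<lambda>i. hd (f i)"] obtain g :: "nat \<Rightarrow> nat"
    where g: "strict_mono g" "\<And>i j. i \<le> j \<Longrightarrow> hd (f (g i)) \<le> hd (f (g j))"
    by (elim exE conjE) simp
  have "\<And>i. length (tl (f (g i))) = r" using Suc.prems by simp
  from Suc.IH[of "\<lambda>i. tl (f (g i))", OF this] obtain h :: "nat \<Rightarrow> nat"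
    where h: "strict_mono h" "\<And>i j. i \<le> j \<Longrightarrow> list_all2 (\<le>) (tl (f (g (h i)))) (tl (f (g (h j))))"
    by (elim exE conjE) simp
  have ne: "f i = hd (f i) # tl (f i)" for i
    using Suc.prems[of i] by (cases "f i") auto
  show ?case
  proof (intro exI conjI allI impI)
    show "strict_mono (g \<circ> h)" using g(1) h(1) by (rule strict_mono_o)
    fix i j :: nat assume ij: "i \<le> j"
    have "hd (f (g (h i))) \<le> hd (f (g (h j)))"
      using g(2) h(1) ij by (simp add: strict_mono_less_eq)
    then show "list_all2 (\<le>) (f ((g \<circ> h) i)) (f ((g \<circ> h) j))"
      using h(2)[OF ij] ne[of "g (h i)"] ne[of "g (h j)"] by (metis comp_apply list_all2_Cons)
  qed
qed

lemma sum_list_le: "list_all2 (\<le>) xs ys \<Longrightarrow> sum_list xs \<le> (sum_list ys :: nat)"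
  by (induction rule: list_all2_induct) auto

lemma sum_list_less: "list_all2 (\<le>) xs ys \<Longrightarrow> xs \<noteq> ys \<Longrightarrow> sum_list xs < (sum_list ys :: nat)"
proof (induction rule: list_all2_induct)
  case (Cons x xs y ys)
  then show ?case using sum_list_le[of xs ys] by (cases "x = y") auto
qed auto

lemma list_all2_le_diff:
  "list_all2 (\<le>) xs (ys :: nat list) \<Longrightarrow> \<exists>zs. length zs = length xs \<and> ys = map2 (+) xs zs"
proof (induction rule: list_all2_induct)
  case (Cons x xs y ys)
  then obtain zs where "length zs = length xs" "ys = map2 (+) xs zs" by blast
  then show ?case using Cons by (intro exI[of _ "(y - x) # zs"]) auto
qed simp

lemma sum_list_map2_add:
  "length xs = length ys \<Longrightarrow> sum_list (map2 (+) xs ys) = sum_list xs + (sum_list ys :: nat)"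
  by (induction rule: list_induct2) auto

text \<open>\<open><\<close> on lists is lexicographic. Translation invariance lets multiplication
  by a monomial shift a leading exponent without disturbing which exponents lie below it.\<close>

lemma lex_map2_add:
  fixes xs ys zs :: "nat list"
  assumes "length xs = length ys" "length ys = length zs" "xs < ys"
  shows "map2 (+) xs zs < map2 (+) ys zs"
  using assms by (induction xs ys zs rule: list_induct3) auto

lemma finite_exponents: "finite {\<beta> :: nat list. length \<beta> = r \<and> sum_list \<beta> = k}"
proof (rule finite_subset)
  show "{\<beta>. length \<beta> = r \<and> sum_list \<beta> = k} \<subseteq> {\<beta>. set \<beta> \<subseteq> {..k} \<and> length \<beta> = r}"
    using member_le_sum_list by fastforce
  show "finite {\<beta>. set \<beta> \<subseteq> {..k} \<and> length \<beta> = r}" by (rule finite_lists_length_eq) simp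
qed

text \<open>A negative leading coefficient would drive \<open>q\<close> below zero, and a positive
  one in degree above \<open>e\<close> would carry \<open>q\<close> past the bound. The shift by 2
  accommodates \<open>h l k = H l (k + 1)\<close> together with bounds for \<open>H\<close> in
  powers of \<open>k + 1\<close>.\<close>

lemma degree_le_of_growth:
  fixes q :: "real poly"
  assumes "\<forall>\<^sub>F n in sequentially. poly q (real n) = real (h n)"
    and "\<And>n. real (h n) \<le> C * (real n + 2) ^ e"
  shows "degree q \<le> e"
proof (rule ccontr)
  assume "\<not> degree q \<le> e"
  then have d: "degree q > e" by simp
  have q0: "lead_coeff q \<noteq> 0" using d by auto
  obtain n0 where n0: "\<And>n. n \<ge> n0 \<Longrightarrow> poly q (real n) = real (h n)"
    using assms(1) by (auto simp: eventually_sequentially)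
  consider "lead_coeff q < 0" | "lead_coeff q > 0" using q0 by linarith
  then show False
  proof cases
    case 1
    then obtain x0 where x0: "\<And>x. x \<ge> x0 \<Longrightarrow> lead_coeff (- q) \<le> poly (- q) x"
      using poly_pinfty_gt_lc[of "- q"] by auto
    obtain n where n: "real n \<ge> x0" "n \<ge> n0" by (metis le_cases of_nat_mono order_trans real_arch_simple)
    show False using x0[OF n(1)] n0[OF n(2)] 1 by simp
  next
    case 2
    let ?r = "smult C ([:2, 1:] ^ e)"
    have "degree ?r \<le> e"
      using degree_smult_le[of C "[:2, 1:] ^ e"] degree_power_le[of "[:2, 1 :: real:]" e] by simp
    then have "degree (- ?r) < degree q" using d by (simp del: degree_smult_eq)
    then have lc: "lead_coeff (q + - ?r) = lead_coeff q"
      using degree_add_eq_left[OF \<open>degree (- ?r) < degree q\<close>] coeff_eq_0[of "- ?r" "degree q"]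
      by (simp only: coeff_add)
    then obtain x0 where x0: "\<And>x. x \<ge> x0 \<Longrightarrow> lead_coeff q \<le> poly (q + - ?r) x"
      using poly_pinfty_gt_lc[of "q + - ?r"] 2 by auto
    obtain n where n: "real n \<ge> x0" "n \<ge> n0" by (metis le_cases of_nat_mono order_trans real_arch_simple)
    show False using x0[OF n(1)] n0[OF n(2)] 2 assms(2)[of n] by (simp add: add.commute)
  qed
qed

text \<open>Evaluating \<open>q\<close> at \<open>c * (j + 1) - 1\<close> amounts to composing it
  with a linear polynomial of slope \<open>c\<close>, which keeps the degree. As
  \<open>j choose d\<close> is at least \<open>(j / d) ^ d\<close>, a polynomial of smaller degree
  falls behind. The argument is one less than \<open>c * (j + 1)\<close> because the sums defining
  \<open>h\<close> include their last index.\<close>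

lemma degree_ge_of_growth:
  fixes q :: "real poly"
  assumes "\<forall>\<^sub>F n in sequentially. poly q (real n) = real (h n)"
    and c: "c \<ge> 1" and "\<And>j. j choose d \<le> h (c * (j + 1) - 1)"
  shows "q \<noteq> 0 \<and> d \<le> degree q"
proof (rule ccontr)
  assume neg: "\<not> (q \<noteq> 0 \<and> d \<le> degree q)"
  obtain n0 where n0: "\<And>n. n \<ge> n0 \<Longrightarrow> poly q (real n) = real (h n)"
    using assms(1) by (auto simp: eventually_sequentially)
  define s where "s = pcompose q [:real c - 1, real c:]"
  define t where "t = monom (1 / real d ^ d) d"
  have "s = 0 \<or> degree s < d"
    using neg c by (auto simp: s_def degree_pcompose)
  then have lc: "lead_coeff (t + - s) = 1 / real d ^ d"
  proof
    assume "s = 0"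
    moreover have "degree t = d" by (cases "d = 0") (auto simp: t_def degree_monom_eq)
    ultimately show ?thesis by (simp add: t_def)
  next
    assume *: "degree s < d"
    have dt: "degree t = d" using * by (simp add: t_def degree_monom_eq)
    then have "degree (- s) < degree t" using * by simp
    then have "degree (t + - s) = d" using dt by (simp only: degree_add_eq_left)
    then show ?thesis using * by (simp add: t_def coeff_eq_0)
  qed
  have pos: "1 / real d ^ d > 0" by (cases "d = 0") auto
  obtain x0 where x0: "\<And>x. x \<ge> x0 \<Longrightarrow> 1 / real d ^ d \<le> poly (t + - s) x"
    using poly_pinfty_gt_lc[of "t + - s"] pos unfolding lc by blast
  obtain j0 where j0: "real j0 \<ge> x0" using real_arch_simple by blast
  define j where "j = max j0 (max n0 d)"
  have j: "real j \<ge> x0" "j \<ge> n0" "j \<ge> d" using j0 by (auto simp: j_def)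
  have cj: "c * (j + 1) - 1 \<ge> j" using c by (cases c) auto
  have "poly t (real j) = (real j / real d) ^ d" by (simp add: t_def poly_monom power_divide)
  also have "\<dots> \<le> real (j choose d)" using j(3) by (rule binomial_ge_n_over_k_pow_k)
  also have "\<dots> \<le> real (h (c * (j + 1) - 1))" using assms(3) by (simp only: of_nat_le_iff)
  also have "\<dots> = poly q (real (c * (j + 1) - 1))" using n0 cj j(2) by simp
  also have "real (c * (j + 1) - 1) = real c - 1 + real c * real j"
    using c by (subst of_nat_diff) (auto simp: algebra_simps)
  also have "poly q \<dots> = poly s (real j)" by (simp add: s_def poly_pcompose mult.commute)
  finally show False using x0[OF j(1)] pos by simp
qed

text \<open>A finite supremum of naturals is attained. This turns \<open>Kdim = d\<close> into a
  chain of length \<open>d\<close> and a bound on all others; the empty set drops out because its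
  supremum is \<open>-\<infinity>\<close>.\<close>

lemma SUP_ereal_nat_eq_iff:
  "(SUP n\<in>S. ereal (real n)) = ereal (real d) \<longleftrightarrow> d \<in> S \<and> (\<forall>n\<in>S. n \<le> d)"
proof
  assume eq: "(SUP n\<in>S. ereal (real n)) = ereal (real d)"
  have le: "n \<le> d" if "n \<in> S" for n
  proof -
    have "ereal (real n) \<le> ereal (real d)" unfolding eq[symmetric] using that by (rule SUP_upper)
    then show ?thesis by simp
  qed
  have fin: "finite S" using le by (meson finite_nat_set_iff_bounded_le)
  have ne: "S \<noteq> {}" using eq by (auto simp: bot_ereal_def)
  have "(SUP n\<in>S. ereal (real n)) \<le> ereal (real (Max S))" using fin by (intro SUP_least) auto
  then have "d \<le> Max S" unfolding eq by simp
  then have "d = Max S" using le[of "Max S"] Max_in[OF fin ne] by simp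
  then show "d \<in> S \<and> (\<forall>n\<in>S. n \<le> d)" using le Max_in[OF fin ne] by simp
next
  assume d: "d \<in> S \<and> (\<forall>n\<in>S. n \<le> d)"
  show "(SUP n\<in>S. ereal (real n)) = ereal (real d)"
    by (rule antisym) (use d in \<open>auto intro!: SUP_least SUP_upper\<close>)
qed

section \<open>Modules over a commutative subring\<close>

text \<open>The ambient ring is not commutative, only the scalars \<open>A\<close> (later
  \<open>R0\<close>) are. Ideals of \<open>A\<close>, powers of the odd part and their products with
  powers of \<open>n\<close> are all additive subsets of \<open>R\<close> stable under left
  multiplication by \<open>A\<close>, so one notion of submodule covers them.\<close>

locale commutative_subring = ring R for R (structure) +
  fixes A
  assumes subring: "subring A R"
    and commute: "\<lbrakk>a \<in> A; b \<in> A\<rbrakk> \<Longrightarrow> a \<otimes> b = b \<otimes> a"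
begin

lemma A_carr: "a \<in> A \<Longrightarrow> a \<in> carrier R"
  using subring subringE(1) by blast

lemma A_sub: "A \<subseteq> carrier R"
  using A_carr by blast

lemma A_closed [simp]: "\<zero> \<in> A" "\<one> \<in> A" "a \<in> A \<Longrightarrow> b \<in> A \<Longrightarrow> a \<oplus> b \<in> A"
  "a \<in> A \<Longrightarrow> b \<in> A \<Longrightarrow> a \<otimes> b \<in> A" "a \<in> A \<Longrightarrow> \<ominus> a \<in> A"
  using subringE[OF subring] by auto

lemma A_minus [simp]: "a \<in> A \<Longrightarrow> b \<in> A \<Longrightarrow> a \<ominus> b \<in> A"
  by (simp add: a_minus_def)

lemma A_pow [simp]: "a \<in> A \<Longrightarrow> a [^] (k::nat) \<in> A"
  by (induction k) auto

subsection \<open>Submodules\<close>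

definition submod :: "'a set \<Rightarrow> bool" where
  "submod S \<longleftrightarrow> S \<subseteq> carrier R \<and> \<zero> \<in> S \<and> (\<forall>x\<in>S. \<forall>y\<in>S. x \<oplus> y \<in> S) \<and> (\<forall>a\<in>A. \<forall>x\<in>S. a \<otimes> x \<in> S)"

lemma submodI:
  assumes "S \<subseteq> carrier R" "\<zero> \<in> S" "\<And>x y. x \<in> S \<Longrightarrow> y \<in> S \<Longrightarrow> x \<oplus> y \<in> S"
    "\<And>a x. a \<in> A \<Longrightarrow> x \<in> S \<Longrightarrow> a \<otimes> x \<in> S"
  shows "submod S"
  using assms unfolding submod_def by blast

lemma submod_carr: "submod S \<Longrightarrow> x \<in> S \<Longrightarrow> x \<in> carrier R"
  unfolding submod_def by blast

lemma submod_sub: "submod S \<Longrightarrow> S \<subseteq> carrier R"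
  unfolding submod_def by blast

lemma submod_zero: "submod S \<Longrightarrow> \<zero> \<in> S"
  unfolding submod_def by blast

lemma submod_add: "submod S \<Longrightarrow> x \<in> S \<Longrightarrow> y \<in> S \<Longrightarrow> x \<oplus> y \<in> S"
  unfolding submod_def by blast

lemma submod_smult: "submod S \<Longrightarrow> a \<in> A \<Longrightarrow> x \<in> S \<Longrightarrow> a \<otimes> x \<in> S"
  unfolding submod_def by blast

lemma submod_neg: "submod S \<Longrightarrow> x \<in> S \<Longrightarrow> \<ominus> x \<in> S"
  using submod_smult[of S "\<ominus> \<one>" x] submod_carr[of S x] by (simp add: l_minus)

lemma submod_minus: "submod S \<Longrightarrow> x \<in> S \<Longrightarrow> y \<in> S \<Longrightarrow> x \<ominus> y \<in> S"
  by (simp add: a_minus_def submod_add submod_neg)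

lemma submod_add_cancel:
  assumes "submod S" "x \<in> S" "y \<in> carrier R" "x \<oplus> y \<in> S"
  shows "y \<in> S"
proof -
  have "y = \<ominus> x \<oplus> (x \<oplus> y)"
    using assms submod_carr[of S x] by (simp add: r_neg2 r_neg1)
  then show ?thesis
    using submod_add[OF assms(1) submod_neg[OF assms(1,2)] assms(4)] by simp
qed

lemma submod_A: "submod A"
  by (rule submodI) (use A_sub in auto)

lemma submod_zero_set: "submod {\<zero>}"
  by (rule submodI) (auto simp: A_carr)

lemma submod_Int: "submod S \<Longrightarrow> submod T \<Longrightarrow> submod (S \<inter> T)"
  unfolding submod_def by blast

lemma mem_set_add: "z \<in> X <+> Y \<longleftrightarrow> (\<exists>x\<in>X. \<exists>y\<in>Y. z = x \<oplus> y)"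
  by (auto simp: set_add_def')

lemma set_addI: "x \<in> X \<Longrightarrow> y \<in> Y \<Longrightarrow> x \<oplus> y \<in> X <+> Y"
  by (auto simp: mem_set_add)

lemma submod_set_add:
  assumes "submod X" "submod Y"
  shows "submod (X <+> Y)"
proof (rule submodI)
  show "X <+> Y \<subseteq> carrier R"
    using assms submod_carr by (auto simp: mem_set_add)
  have "\<zero> \<oplus> \<zero> \<in> X <+> Y"
    using assms submod_zero by (intro set_addI)
  then show "\<zero> \<in> X <+> Y" by simp
next
  fix s t assume "s \<in> X <+> Y" "t \<in> X <+> Y"
  then obtain x y x' y' where *: "x \<in> X" "y \<in> Y" "s = x \<oplus> y" "x' \<in> X" "y' \<in> Y" "t = x' \<oplus> y'"
    by (auto simp: mem_set_add)
  have "s \<oplus> t = (x \<oplus> x') \<oplus> (y \<oplus> y')"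
    using * assms submod_carr by (simp add: a_ac)
  then show "s \<oplus> t \<in> X <+> Y"
    using * assms submod_add by (auto intro!: set_addI)
next
  fix a s assume "a \<in> A" "s \<in> X <+> Y"
  then obtain x y where *: "x \<in> X" "y \<in> Y" "s = x \<oplus> y"
    by (auto simp: mem_set_add)
  have "a \<otimes> s = a \<otimes> x \<oplus> a \<otimes> y"
    using * assms submod_carr \<open>a \<in> A\<close> A_carr by (simp add: r_distr)
  then show "a \<otimes> s \<in> X <+> Y"
    using * assms submod_smult \<open>a \<in> A\<close> by (auto intro!: set_addI)
qed

lemma set_add_left: "submod X \<Longrightarrow> submod Y \<Longrightarrow> X \<subseteq> X <+> Y"
  using set_addI[of _ X \<zero> Y] submod_zero submod_carr by (metis r_zero subsetI)

lemma set_add_right: "submod X \<Longrightarrow> submod Y \<Longrightarrow> Y \<subseteq> X <+> Y"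
  using set_addI[of \<zero> X _ Y] submod_zero submod_carr by (metis l_zero subsetI)

lemma set_add_least: "submod Z \<Longrightarrow> X \<subseteq> Z \<Longrightarrow> Y \<subseteq> Z \<Longrightarrow> X <+> Y \<subseteq> Z"
  using submod_add by (fastforce simp: mem_set_add)

lemma set_add_subset_mono: "X \<subseteq> X' \<Longrightarrow> Y \<subseteq> Y' \<Longrightarrow> X <+> Y \<subseteq> X' <+> Y'"
  by (fastforce simp: mem_set_add)

lemma set_add_absorb: "submod X \<Longrightarrow> submod Y \<Longrightarrow> Y \<subseteq> X \<Longrightarrow> X <+> Y = X"
  using set_add_left set_add_least by (metis order_refl subset_antisym)

section \<open>Cyclic submodules and colon ideals\<close>

definition cyc :: "'a \<Rightarrow> 'a set" where
  "cyc u = (\<lambda>a. a \<otimes> u) ` A"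

lemma submod_cyc: "u \<in> carrier R \<Longrightarrow> submod (cyc u)"
proof (rule submodI)
  assume u: "u \<in> carrier R"
  show "cyc u \<subseteq> carrier R" using u A_carr by (auto simp: cyc_def)
  have "\<zero> = \<zero> \<otimes> u" using u by simp
  then show "\<zero> \<in> cyc u" by (auto simp: cyc_def)
  show "x \<oplus> y \<in> cyc u" if "x \<in> cyc u" "y \<in> cyc u" for x y
    using that u A_carr by (auto simp: cyc_def l_distr[symmetric])
  show "a \<otimes> x \<in> cyc u" if "a \<in> A" "x \<in> cyc u" for a x
    using that u A_carr by (auto simp: cyc_def m_assoc[symmetric])
qed

lemma cyc_self: "u \<in> carrier R \<Longrightarrow> u \<in> cyc u"
  unfolding cyc_def by (rule image_eqI[of _ _ \<one>]) auto

lemma cyc_least: "submod Y \<Longrightarrow> u \<in> Y \<Longrightarrow> cyc u \<subseteq> Y"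
  by (auto simp: cyc_def submod_smult)

lemma cyc_one: "cyc \<one> = A"
  using A_carr by (force simp: cyc_def)

lemma cyc_A: "a \<in> A \<Longrightarrow> cyc a \<subseteq> A"
  by (auto simp: cyc_def)

text \<open>The annihilator of the class of \<open>u\<close> modulo \<open>Y\<close>; for
  \<open>Y = {\<zero>}\<close> it is Ann(u).\<close>

definition colon :: "'a set \<Rightarrow> 'a \<Rightarrow> 'a set" where
  "colon Y u = {b \<in> A. b \<otimes> u \<in> Y}"

lemma colon_sub: "colon Y u \<subseteq> A"
  by (auto simp: colon_def)

lemma submod_colon:
  assumes "submod Y" "u \<in> carrier R"
  shows "submod (colon Y u)"
  by (rule submodI)
    (use assms A_carr submod_zero[OF assms(1)] submod_add[OF assms(1)] submod_smult[OF assms(1)]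
      in \<open>auto simp: colon_def l_distr m_assoc\<close>)

lemma colon_mono: "Y \<subseteq> Z \<Longrightarrow> colon Y u \<subseteq> colon Z u"
  by (auto simp: colon_def)

lemma colon_supset:
  assumes "submod Y" "Y \<subseteq> A" "a \<in> A"
  shows "Y \<subseteq> colon Y a"
proof
  fix t assume "t \<in> Y"
  then have "t \<in> A" "a \<otimes> t \<in> Y" using assms submod_smult by blast+
  then show "t \<in> colon Y a" using commute[OF assms(3), of t] by (simp add: colon_def)
qed

lemma submod_image_mult:
  assumes S: "submod S" "S \<subseteq> A" and u: "u \<in> carrier R"
  shows "submod ((\<lambda>b. b \<otimes> u) ` S)"
proof (rule submodI)
  show "(\<lambda>b. b \<otimes> u) ` S \<subseteq> carrier R" using S A_carr u by auto
  show "\<zero> \<in> (\<lambda>b. b \<otimes> u) ` S" using submod_zero[OF S(1)] u by (intro image_eqI[of _ _ \<zero>]) auto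
  show "x \<oplus> y \<in> (\<lambda>b. b \<otimes> u) ` S" if *: "x \<in> (\<lambda>b. b \<otimes> u) ` S" "y \<in> (\<lambda>b. b \<otimes> u) ` S" for x y
  proof -
    obtain b c where "b \<in> S" "c \<in> S" "x = b \<otimes> u" "y = c \<otimes> u" using * by blast
    then show ?thesis using submod_add[OF \<open>submod S\<close>] submod_carr[OF \<open>submod S\<close>] u
      by (intro image_eqI[of _ _ "b \<oplus> c"]) (auto simp: l_distr)
  qed
  show "a \<otimes> x \<in> (\<lambda>b. b \<otimes> u) ` S" if *: "a \<in> A" "x \<in> (\<lambda>b. b \<otimes> u) ` S" for a x
  proof -
    obtain b where "b \<in> S" "x = b \<otimes> u" using * by blast
    then show ?thesis using submod_smult[OF \<open>submod S\<close>] submod_carr[OF \<open>submod S\<close>] u A_carr *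
      by (intro image_eqI[of _ _ "a \<otimes> b"]) (auto simp: m_assoc)
  qed
qed

subsection \<open>Length of an interval of submodules\<close>

definition submod_chain :: "nat \<Rightarrow> (nat \<Rightarrow> 'a set) \<Rightarrow> bool" where
  "submod_chain n f \<longleftrightarrow> (\<forall>i\<le>n. submod (f i)) \<and> (\<forall>i<n. f i \<subset> f (Suc i))"

text \<open>The length of X/Y without the quotient. Infinite length is allowed and the value is 0
  unless \<open>Y \<subseteq> X\<close>, so monotonicity holds with no side conditions.\<close>

definition len :: "'a set \<Rightarrow> 'a set \<Rightarrow> enat" where
  "len Y X = (SUP n \<in> {n. \<exists>f. submod_chain n f \<and> Y \<subseteq> f 0 \<and> f n \<subseteq> X}. enat n)"

lemma submod_chain_mono: "submod_chain n f \<Longrightarrow> i \<le> j \<Longrightarrow> j \<le> n \<Longrightarrow> f i \<subseteq> f j"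
proof (induction j)
  case (Suc j)
  then show ?case
    by (cases "i = Suc j") (auto simp: submod_chain_def le_Suc_eq Suc_le_eq subset_iff psubset_eq)
qed auto

lemma submod_chain_le: "submod_chain n f \<Longrightarrow> m \<le> n \<Longrightarrow> submod_chain m f"
  by (auto simp: submod_chain_def)

lemma len_geI: "submod_chain n f \<Longrightarrow> Y \<subseteq> f 0 \<Longrightarrow> f n \<subseteq> X \<Longrightarrow> enat n \<le> len Y X"
  unfolding len_def by (rule SUP_upper) auto

lemma len_leI: "(\<And>n f. submod_chain n f \<Longrightarrow> Y \<subseteq> f 0 \<Longrightarrow> f n \<subseteq> X \<Longrightarrow> enat n \<le> c) \<Longrightarrow> len Y X \<le> c"
  unfolding len_def by (rule SUP_least) auto

lemma len_geD:
  assumes "enat n \<le> len Y X" "submod Y" "Y \<subseteq> X"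
  shows "\<exists>f. submod_chain n f \<and> Y \<subseteq> f 0 \<and> f n \<subseteq> X"
proof (cases n)
  case 0
  then show ?thesis using assms by (intro exI[of _ "\<lambda>_. Y"]) (auto simp: submod_chain_def)
next
  case (Suc k)
  have "enat k < len Y X"
    using assms(1) Suc by (metis enat_ord_simps(2) lessI less_le_trans)
  then obtain m f where m: "submod_chain m f" "Y \<subseteq> f 0" "f m \<subseteq> X" "enat k < enat m"
    unfolding len_def by (auto simp: less_SUP_iff)
  have "n \<le> m" using m(4) Suc by simp
  then show ?thesis
    using m submod_chain_le[OF m(1)] submod_chain_mono[OF m(1), of n m] by blast
qed

lemma len_mono: "Y' \<subseteq> Y \<Longrightarrow> X \<subseteq> X' \<Longrightarrow> len Y X \<le> len Y' X'"
  by (rule len_leI, rule len_geI, assumption) auto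

lemma len_transfer:
  assumes "\<And>S. submod S \<Longrightarrow> Y \<subseteq> S \<Longrightarrow> S \<subseteq> X \<Longrightarrow> submod (F S) \<and> Y' \<subseteq> F S \<and> F S \<subseteq> X'"
    and "\<And>S T. submod S \<Longrightarrow> submod T \<Longrightarrow> Y \<subseteq> S \<Longrightarrow> S \<subset> T \<Longrightarrow> T \<subseteq> X \<Longrightarrow> F S \<subset> F T"
  shows "len Y X \<le> len Y' X'"
proof (rule len_leI)
  fix n f assume f: "submod_chain n f" "Y \<subseteq> f 0" "f n \<subseteq> X"
  have *: "Y \<subseteq> f i \<and> f i \<subseteq> X \<and> submod (f i)" if "i \<le> n" for i
    using submod_chain_mono[OF f(1), of 0 i] submod_chain_mono[OF f(1), of i n] that f
    by (auto simp: submod_chain_def)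
  show "enat n \<le> len Y' X'"
  proof (rule len_geI)
    show "submod_chain n (\<lambda>i. F (f i))"
      unfolding submod_chain_def
    proof (intro conjI allI impI)
      fix i assume "i \<le> n" then show "submod (F (f i))" using *[of i] assms(1) by blast
    next
      fix i assume "i < n"
      then show "F (f i) \<subset> F (f (Suc i))"
        using *[of i] *[of "Suc i"] f(1) by (intro assms(2)) (auto simp: submod_chain_def)
    qed
    show "Y' \<subseteq> F (f 0)" "F (f n) \<subseteq> X'" using *[of 0] *[of n] assms(1) by blast+
  qed
qed

lemma len_eq_0: "X \<subseteq> Y \<Longrightarrow> len Y X = 0"
proof -
  assume XY: "X \<subseteq> Y"
  have "len Y X \<le> 0"
  proof (rule len_leI)
    fix n f assume f: "submod_chain n f" "Y \<subseteq> f 0" "f n \<subseteq> X"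
    have "n = 0"
    proof (rule ccontr)
      assume "n \<noteq> 0"
      then have "f 0 \<subset> f 1" "f 1 \<subseteq> f n"
        using f submod_chain_mono[OF f(1), of 1 n] by (auto simp: submod_chain_def)
      then show False using f XY by blast
    qed
    then show "enat n \<le> 0" by (simp add: zero_enat_def)
  qed
  then show ?thesis by simp
qed

lemma len_ge_1: "submod Y \<Longrightarrow> submod X \<Longrightarrow> Y \<subset> X \<Longrightarrow> 1 \<le> len Y X"
  using len_geI[of 1 "\<lambda>i. if i = 0 then Y else X" Y X]
  by (auto simp: submod_chain_def one_enat_def)

text \<open>The modular law. Its use is contrapositive: every strict inclusion is visible in the
  intersection with \<open>Y\<close> or in the sum with \<open>Y\<close>.\<close>

lemma modular_law_eq:
  assumes "submod S" "submod T" "submod Y" "S \<subseteq> T" "S \<inter> Y = T \<inter> Y" "S <+> Y = T <+> Y"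
  shows "S = T"
proof
  show "T \<subseteq> S"
  proof
    fix t assume t: "t \<in> T"
    then have "t \<in> S <+> Y" using set_add_left[OF assms(2,3)] assms(6) by blast
    then obtain s y where sy: "s \<in> S" "y \<in> Y" "t = s \<oplus> y" by (auto simp: mem_set_add)
    then have "y \<in> T"
      using t assms submod_add_cancel[of T s y] submod_carr by blast
    then show "t \<in> S" using sy assms submod_add by blast
  qed
qed (use assms in blast)

lemma enat_infinityI: "(\<And>n. enat n \<le> z) \<Longrightarrow> z = \<infinity>"
proof (rule ccontr)
  assume *: "\<And>n. enat n \<le> z" "z \<noteq> \<infinity>"
  then obtain k where "z = enat k" by auto
  then show False using *(1)[of "Suc k"] by simp
qed

lemma enat_add_leI:
  fixes x y z :: enat
  assumes "\<And>a b. enat a \<le> x \<Longrightarrow> enat b \<le> y \<Longrightarrow> enat (a + b) \<le> z"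
  shows "x + y \<le> z"
proof (cases x)
  case (enat a)
  show ?thesis
  proof (cases y)
    case (enat b)
    then show ?thesis using assms[of a b] \<open>x = enat a\<close> by simp
  next
    case infinity
    have "enat b \<le> z" for b
      using assms[of 0 b] infinity by (simp add: zero_enat_def[symmetric])
    then have "z = \<infinity>" by (rule enat_infinityI)
    then show ?thesis by simp
  qed
next
  case infinity
  have "enat b \<le> z" for b
    using assms[of b 0] infinity by (simp add: zero_enat_def[symmetric])
  then have "z = \<infinity>" by (rule enat_infinityI)
  then show ?thesis by simp
qed

lemma len_add:
  assumes sub: "submod Z" "submod Y" "submod X" and "Z \<subseteq> Y" "Y \<subseteq> X"
  shows "len Z X = len Z Y + len Y X"
proof (rule antisym)
  show "len Z Y + len Y X \<le> len Z X"
  proof (rule enat_add_leI)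
    fix a b assume "enat a \<le> len Z Y" "enat b \<le> len Y X"
    then obtain f g where f: "submod_chain a f" "Z \<subseteq> f 0" "f a \<subseteq> Y"
      and g: "submod_chain b g" "Y \<subseteq> g 0" "g b \<subseteq> X"
      using len_geD assms by meson
    define h where "h i = (if i < a then f i else if i = a then Y else g (i - a))" for i
    \<comment> \<open>At the seam only \<open>g 0\<close> is kept: it may equal \<open>f a\<close>,
      while \<open>f (a - 1) \<subset> f a \<subseteq> Y \<subseteq> g 0\<close> stays strict. This
      leaves exactly \<open>a + b\<close> inclusions.\<close>
    define h' where "h' i = (if i < a then f i else g (i - a))" for i
    have "submod_chain (a + b) h'"
      unfolding submod_chain_def
    proof (intro conjI allI impI)
      fix i assume "i \<le> a + b" then show "submod (h' i)"
        using f(1) g(1) by (auto simp: h'_def submod_chain_def)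
    next
      fix i assume i: "i < a + b"
      consider "Suc i < a" | "Suc i = a" | "i \<ge> a" by linarith
      then show "h' i \<subset> h' (Suc i)"
      proof cases
        case 1 then show ?thesis using f(1) by (auto simp: h'_def submod_chain_def)
      next
        case 2
        then have "f i \<subset> f a" using f(1) unfolding submod_chain_def by blast
        then show ?thesis using 2 f(3) g(2) by (auto simp: h'_def)
      next
        case 3
        then have "g (i - a) \<subset> g (Suc (i - a))" using g(1) i unfolding submod_chain_def by auto
        then show ?thesis using 3 by (simp add: h'_def Suc_diff_le)
      qed
    qed
    moreover have "Z \<subseteq> h' 0" using f g assms by (auto simp: h'_def)
    moreover have "h' (a + b) \<subseteq> X" using g by (simp add: h'_def)
    ultimately show "enat (a + b) \<le> len Z X" by (rule len_geI)
  qed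
next
  show "len Z X \<le> len Z Y + len Y X"
  proof (rule len_leI)
    fix n f assume f: "submod_chain n f" "Z \<subseteq> f 0" "f n \<subseteq> X"
    \<comment> \<open>By the modular law each strict step of \<open>f\<close> raises at least one of
      the two lengths, and it lowers neither.\<close>
    have "m \<le> n \<Longrightarrow> enat m \<le> len Z (f m \<inter> Y) + len Y (f m <+> Y)" for m
    proof (induction m)
      case 0
      then show ?case by (simp add: zero_enat_def[symmetric])
    next
      case (Suc m)
      have s: "submod (f m)" "submod (f (Suc m))" "f m \<subset> f (Suc m)" "Z \<subseteq> f m"
        using f Suc.prems submod_chain_mono[OF f(1), of 0 m] by (auto simp: submod_chain_def)
      have le1: "len Z (f m \<inter> Y) \<le> len Z (f (Suc m) \<inter> Y)"
        using s by (intro len_mono) auto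
      have le2: "len Y (f m <+> Y) \<le> len Y (f (Suc m) <+> Y)"
        using s by (intro len_mono set_add_subset_mono) auto
      have step: "len P Q + 1 \<le> len P Q'" if PQ: "P \<subseteq> Q" "Q \<subset> Q'" "submod P" "submod Q" "submod Q'" for P Q Q'
      proof (rule enat_add_leI)
        fix a b assume ab: "enat a \<le> len P Q" "enat b \<le> 1"
        then obtain h where h: "submod_chain a h" "P \<subseteq> h 0" "h a \<subseteq> Q" using len_geD[of a P Q] PQ by blast
        have "enat (Suc a) \<le> len P Q'"
        proof (rule len_geI)
          show "submod_chain (Suc a) (\<lambda>i. if i \<le> a then h i else Q')"
            using h that by (auto simp: submod_chain_def le_Suc_eq less_Suc_eq)
        qed (use h in auto)
        moreover have "a + b \<le> Suc a" using ab(2) by (simp add: one_enat_def)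
        ultimately show "enat (a + b) \<le> len P Q'" by (meson enat_ord_simps(1) order_trans)
      qed
      consider "f m \<inter> Y \<subset> f (Suc m) \<inter> Y" | "f m <+> Y \<subset> f (Suc m) <+> Y"
        using modular_law_eq[OF s(1,2) sub(2)] s(3) set_add_subset_mono[of "f m" "f (Suc m)" Y Y] by blast
      then have "len Z (f m \<inter> Y) + len Y (f m <+> Y) + 1 \<le> len Z (f (Suc m) \<inter> Y) + len Y (f (Suc m) <+> Y)"
      proof cases
        case 1
        then have "len Z (f m \<inter> Y) + 1 \<le> len Z (f (Suc m) \<inter> Y)"
          using s assms by (intro step submod_Int) auto
        then show ?thesis using le2 add_mono by (metis add.assoc add.commute)
      next
        case 2
        then have "len Y (f m <+> Y) + 1 \<le> len Y (f (Suc m) <+> Y)"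
          using s assms set_add_right[of "f m" Y] by (intro step submod_set_add) auto
        then show ?thesis using le1 add_mono by (metis add.assoc)
      qed
      moreover have "enat (Suc m) = enat m + 1" by (simp add: one_enat_def)
      moreover have "enat m + 1 \<le> len Z (f m \<inter> Y) + len Y (f m <+> Y) + 1"
        using Suc by (intro add_mono) auto
      ultimately show ?case by (metis order_trans)
    qed
    from this[of n] have "enat n \<le> len Z (f n \<inter> Y) + len Y (f n <+> Y)" by simp
    also have "\<dots> \<le> len Z Y + len Y X"
      using assms f by (intro add_mono len_mono set_add_least) auto
    finally show "enat n \<le> len Z Y + len Y X" .
  qed
qed

text \<open>The second isomorphism theorem for lengths: intersecting with \<open>X\<close> and
  adding \<open>Y\<close> are strictly monotone maps between the two intervals.\<close>

lemma len_diamond: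
  assumes X: "submod X" and Y: "submod Y"
  shows "len Y (X <+> Y) = len (X \<inter> Y) X"
proof (rule antisym)
  show "len Y (X <+> Y) \<le> len (X \<inter> Y) X"
  proof (rule len_transfer[where F = "\<lambda>S. S \<inter> X"])
    fix S T assume *: "submod S" "submod T" "Y \<subseteq> S" "S \<subset> T" "T \<subseteq> X <+> Y"
    then obtain t where t: "t \<in> T" "t \<notin> S" by blast
    then have "t \<in> X <+> Y" using * by blast
    then obtain x y where xy: "x \<in> X" "y \<in> Y" "t = x \<oplus> y" by (auto simp: mem_set_add)
    have "y \<oplus> x \<in> T" "x \<in> carrier R"
      using t xy X Y submod_carr by (auto simp: a_comm)
    then have "x \<in> T" using submod_add_cancel[of T y x] * xy by blast
    moreover have "x \<notin> S" using t xy * submod_add by blast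
    ultimately show "S \<inter> X \<subset> T \<inter> X" using * xy by blast
  qed (use X submod_Int in blast)
  show "len (X \<inter> Y) X \<le> len Y (X <+> Y)"
  proof (rule len_transfer[where F = "\<lambda>S. S <+> Y"])
    fix S T assume *: "submod S" "submod T" "X \<inter> Y \<subseteq> S" "S \<subset> T" "T \<subseteq> X"
    have "S \<inter> Y = T \<inter> Y" using * by blast
    then have "S <+> Y \<noteq> T <+> Y" using modular_law_eq[of S T Y] * Y by blast
    then show "S <+> Y \<subset> T <+> Y" using set_add_subset_mono[of S T Y Y] * by blast
  qed (use X Y submod_set_add set_add_right set_add_subset_mono in auto)
qed

text \<open>Multiplication onto \<open>u\<close> identifies A/(Y : u) with (Y + A u)/Y. Taking colon
  ideals and taking images give strictly monotone maps of submodules in the two directions.\<close>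

lemma len_colon:
  assumes Y: "submod Y" and u: "u \<in> carrier R"
  shows "len Y (Y <+> cyc u) = len (colon Y u) A"
proof (rule antisym)
  show "len Y (Y <+> cyc u) \<le> len (colon Y u) A"
  proof (rule len_transfer[where F = "\<lambda>S. colon S u"])
    fix S T assume *: "submod S" "submod T" "Y \<subseteq> S" "S \<subset> T" "T \<subseteq> Y <+> cyc u"
    then obtain t where t: "t \<in> T" "t \<notin> S" by blast
    then have "t \<in> Y <+> cyc u" using * by blast
    then obtain y b where yb: "y \<in> Y" "b \<in> A" "t = y \<oplus> b \<otimes> u" by (auto simp: mem_set_add cyc_def)
    have "b \<otimes> u \<in> T"
      using t yb * u A_carr submod_add_cancel[of T y "b \<otimes> u"] by auto
    moreover have "b \<otimes> u \<notin> S" using t yb * submod_add by blast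
    ultimately show "colon S u \<subset> colon T u" using * yb by (auto simp: colon_def)
  qed (use u submod_colon colon_mono colon_sub in auto)
  show "len (colon Y u) A \<le> len Y (Y <+> cyc u)"
  proof (rule len_transfer[where F = "\<lambda>S. Y <+> (\<lambda>b. b \<otimes> u) ` S"])
    note sm = submod_image_mult[OF _ _ u]
    {
      fix S assume "submod S" "colon Y u \<subseteq> S" "S \<subseteq> A"
      then show "submod (Y <+> (\<lambda>b. b \<otimes> u) ` S) \<and> Y \<subseteq> Y <+> (\<lambda>b. b \<otimes> u) ` S \<and> Y <+> (\<lambda>b. b \<otimes> u) ` S \<subseteq> Y <+> cyc u"
        using sm Y submod_set_add set_add_left set_add_subset_mono[of Y Y "(\<lambda>b. b \<otimes> u) ` S" "cyc u"]
        by (auto simp: cyc_def image_mono)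
    }
    fix S T assume *: "submod S" "submod T" "colon Y u \<subseteq> S" "S \<subset> T" "T \<subseteq> A"
    then obtain t where t: "t \<in> T" "t \<notin> S" by blast
    have tu: "t \<otimes> u \<in> carrier R" using t * A_carr u by auto
    have "t \<otimes> u \<in> Y <+> (\<lambda>b. b \<otimes> u) ` T"
      using set_add_right[OF Y sm, of T] * t by blast
    moreover have "t \<otimes> u \<notin> Y <+> (\<lambda>b. b \<otimes> u) ` S"
    proof
      assume "t \<otimes> u \<in> Y <+> (\<lambda>b. b \<otimes> u) ` S"
      then obtain y s where ys: "y \<in> Y" "s \<in> S" "t \<otimes> u = y \<oplus> s \<otimes> u" by (auto simp: mem_set_add)
      have c: "s \<in> carrier R" "t \<in> carrier R" "y \<in> carrier R" "s \<in> A" "t \<in> A"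
        using ys t * Y A_carr submod_carr by auto
      have "(t \<ominus> s) \<otimes> u = t \<otimes> u \<ominus> s \<otimes> u"
        using c u by (simp add: a_minus_def l_distr l_minus)
      also have "\<dots> = y" using ys(3) c u by (simp add: a_minus_def a_assoc r_neg)
      finally have "t \<ominus> s \<in> colon Y u" using ys(1) c by (simp add: colon_def)
      then have "t \<ominus> s \<in> S" using * by blast
      moreover have "t = (t \<ominus> s) \<oplus> s" using c by (simp add: a_minus_def a_assoc l_neg)
      ultimately show False using t ys * submod_add by metis
    qed
    ultimately show "Y <+> (\<lambda>b. b \<otimes> u) ` S \<subset> Y <+> (\<lambda>b. b \<otimes> u) ` T"
      using * set_add_subset_mono[of Y Y "(\<lambda>b. b \<otimes> u) ` S" "(\<lambda>b. b \<otimes> u) ` T"] by blast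
  qed
qed

subsection \<open>Products and powers\<close>

lemma prod_least:
  assumes "submod Z" "\<And>i j. i \<in> n \<Longrightarrow> j \<in> X \<Longrightarrow> i \<otimes> j \<in> Z"
  shows "n \<cdot> X \<subseteq> Z"
proof
  fix s assume "s \<in> n \<cdot> X"
  then show "s \<in> Z"
    by (induction rule: ideal_prod.induct) (use assms submod_add in auto)
qed

lemma submod_prod:
  assumes n: "submod n" and X: "submod X"
  shows "submod (n \<cdot> X)"
proof (rule submodI)
  show sub: "n \<cdot> X \<subseteq> carrier R"
  proof
    fix s assume "s \<in> n \<cdot> X"
    then show "s \<in> carrier R"
      by (induction rule: ideal_prod.induct) (use submod_carr[OF n] submod_carr[OF X] in auto)
  qed
  show "\<zero> \<in> n \<cdot> X"
    using ideal_prod.prod[OF submod_zero[OF n] submod_zero[OF X], of R] by simp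
  show "x \<oplus> y \<in> n \<cdot> X" if "x \<in> n \<cdot> X" "y \<in> n \<cdot> X" for x y
    using that by (rule ideal_prod.sum)
  show "a \<otimes> x \<in> n \<cdot> X" if a: "a \<in> A" and "x \<in> n \<cdot> X" for a x
    using \<open>x \<in> n \<cdot> X\<close>
  proof (induction rule: ideal_prod.induct)
    case (prod i j)
    then show ?case
      using ideal_prod.prod[OF submod_smult[OF n a prod(1)] prod(2), of R]
        submod_carr[OF n] submod_carr[OF X] A_carr[OF a] by (simp add: m_assoc)
  next
    case (sum s t)
    then show ?case
      using ideal_prod.sum[OF sum.IH] sub A_carr[OF a] by (auto simp: r_distr subset_iff)
  qed
qed

lemma prod_mono: "n \<subseteq> n' \<Longrightarrow> X \<subseteq> X' \<Longrightarrow> n \<cdot> X \<subseteq> n' \<cdot> X'"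
proof
  fix s assume *: "n \<subseteq> n'" "X \<subseteq> X'" "s \<in> n \<cdot> X"
  from *(3) show "s \<in> n' \<cdot> X'"
  proof (induction rule: ideal_prod.induct)
    case (prod i j)
    then show ?case using * by (intro ideal_prod.prod) auto
  next
    case (sum s t)
    then show ?case by (intro ideal_prod.sum)
  qed
qed

lemma prod_sub: "submod X \<Longrightarrow> n \<subseteq> A \<Longrightarrow> n \<cdot> X \<subseteq> X"
  by (rule prod_least) (use submod_smult in auto)

lemma prod_set_add:
  assumes n: "submod n" and X: "submod X" and Y: "submod Y"
  shows "n \<cdot> (X <+> Y) = (n \<cdot> X) <+> (n \<cdot> Y)"
proof
  show "n \<cdot> (X <+> Y) \<subseteq> (n \<cdot> X) <+> (n \<cdot> Y)"
  proof (rule prod_least)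
    fix i j assume i: "i \<in> n" and "j \<in> X <+> Y"
    then obtain x y where "x \<in> X" "y \<in> Y" "j = x \<oplus> y" by (auto simp: mem_set_add)
    then show "i \<otimes> j \<in> (n \<cdot> X) <+> (n \<cdot> Y)"
      using i submod_carr[OF n] submod_carr[OF X] submod_carr[OF Y]
      by (auto simp: r_distr intro!: set_addI ideal_prod.prod)
  qed (use assms submod_prod submod_set_add in blast)
  show "(n \<cdot> X) <+> (n \<cdot> Y) \<subseteq> n \<cdot> (X <+> Y)"
    using assms by (intro set_add_least submod_prod submod_set_add prod_mono set_add_left set_add_right order_refl)
qed

text \<open>\<open>pow_prod n k A\<close> is the ideal power n^k, with n^0 = A. Iteration from the
  left is the shape of \<open>bifiltration\<close>, and \<open>n\<close> is allowed to lie outside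
  \<open>A\<close>, so that \<open>n = R1\<close> yields the powers of the odd part.\<close>

definition pow_prod :: "'a set \<Rightarrow> nat \<Rightarrow> 'a set \<Rightarrow> 'a set" where
  "pow_prod n k X = ((\<lambda>J. n \<cdot> J) ^^ k) X"

lemma pow_prod_0 [simp]: "pow_prod n 0 X = X"
  by (simp add: pow_prod_def)

lemma pow_prod_Suc: "pow_prod n (Suc k) X = n \<cdot> pow_prod n k X"
  by (simp add: pow_prod_def)

lemma pow_prod_add: "pow_prod n (j + k) X = pow_prod n j (pow_prod n k X)"
  by (simp add: pow_prod_def funpow_add)

lemma pow_prod_Suc2: "pow_prod n (Suc k) X = pow_prod n k (n \<cdot> X)"
  by (simp add: pow_prod_def funpow_swap1)

lemma submod_pow_prod: "submod n \<Longrightarrow> submod X \<Longrightarrow> submod (pow_prod n k X)"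
  by (induction k) (auto simp: pow_prod_Suc submod_prod)

lemma pow_prod_mono: "X \<subseteq> Y \<Longrightarrow> pow_prod n k X \<subseteq> pow_prod n k Y"
proof (induction k)
  case (Suc k)
  then show ?case unfolding pow_prod_Suc by (intro prod_mono) auto
qed auto

lemma pow_prod_sub: "submod n \<Longrightarrow> n \<subseteq> A \<Longrightarrow> submod X \<Longrightarrow> pow_prod n k X \<subseteq> X"
proof (induction k)
  case (Suc k)
  then show ?case using prod_sub[of "pow_prod n k X" n] submod_pow_prod[of n X k] by (auto simp: pow_prod_Suc)
qed auto

lemma pow_prod_antimono:
  assumes "submod n" "n \<subseteq> A" "submod X" "j \<le> k"
  shows "pow_prod n k X \<subseteq> pow_prod n j X"
proof -
  have "pow_prod n k X = pow_prod n (j + (k - j)) X" using assms by simp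
  also have "\<dots> \<subseteq> pow_prod n j X" unfolding pow_prod_add by (intro pow_prod_mono pow_prod_sub assms)
  finally show ?thesis .
qed

lemma pow_prod_set_add:
  "submod n \<Longrightarrow> submod X \<Longrightarrow> submod Y \<Longrightarrow> pow_prod n k (X <+> Y) = pow_prod n k X <+> pow_prod n k Y"
  by (induction k) (auto simp: pow_prod_Suc prod_set_add submod_pow_prod)

lemma pow_prod_mult:
  assumes n: "submod n" and X: "submod X" "x \<in> X" and "b \<in> pow_prod n k A"
  shows "b \<otimes> x \<in> pow_prod n k X"
  using assms(4)
proof (induction k arbitrary: b)
  case 0
  then show ?case using X submod_smult by auto
next
  case (Suc k)
  have x: "x \<in> carrier R" using X submod_carr by blast
  have sm: "submod (pow_prod n (Suc k) X)" by (intro submod_pow_prod n X)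
  have "b \<in> n \<cdot> pow_prod n k A" using Suc.prems by (simp add: pow_prod_Suc)
  then show ?case
  proof (induction rule: ideal_prod.induct)
    case (prod i j)
    then have "i \<otimes> (j \<otimes> x) \<in> pow_prod n (Suc k) X"
      using Suc.IH unfolding pow_prod_Suc by (intro ideal_prod.prod)
    then show ?case
      using prod submod_carr[OF n] submod_carr[OF submod_pow_prod[OF n submod_A]] x by (simp add: m_assoc)
  next
    case (sum s t)
    then have "s \<in> carrier R" "t \<in> carrier R"
      using submod_carr[OF submod_prod[OF n submod_pow_prod[OF n submod_A]]] by blast+
    then show ?case using submod_add[OF sm sum.IH] x by (simp add: l_distr)
  qed
qed

text \<open>Translates membership in n^k (A u) into a statement on coefficients of \<open>u\<close>,
  the form in which Artin--Rees is applied to cyclic submodules.\<close>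

lemma pow_prod_cyc:
  assumes n: "submod n" "n \<subseteq> A" and u: "u \<in> carrier R"
  shows "pow_prod n k (cyc u) = (\<lambda>b. b \<otimes> u) ` pow_prod n k A"
proof
  show "(\<lambda>b. b \<otimes> u) ` pow_prod n k A \<subseteq> pow_prod n k (cyc u)"
    using pow_prod_mult[OF n(1) submod_cyc cyc_self] u by blast
  show "pow_prod n k (cyc u) \<subseteq> (\<lambda>b. b \<otimes> u) ` pow_prod n k A"
  proof (induction k)
    case 0
    then show ?case by (simp add: cyc_def)
  next
    case (Suc k)
    have "n \<cdot> pow_prod n k (cyc u) \<subseteq> (\<lambda>b. b \<otimes> u) ` (n \<cdot> pow_prod n k A)"
    proof (rule prod_least)
      show "submod ((\<lambda>b. b \<otimes> u) ` (n \<cdot> pow_prod n k A))"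
        using pow_prod_sub[OF n submod_A, of "Suc k"]
        by (intro submod_image_mult submod_prod submod_pow_prod n submod_A u) (simp add: pow_prod_Suc)
      fix i j assume ij: "i \<in> n" "j \<in> pow_prod n k (cyc u)"
      then obtain b where b: "b \<in> pow_prod n k A" "j = b \<otimes> u" using Suc by blast
      have "i \<otimes> j = (i \<otimes> b) \<otimes> u"
        using b ij u submod_carr[OF n(1)] submod_carr[OF submod_pow_prod[OF n(1) submod_A]] by (simp add: m_assoc)
      moreover have "i \<otimes> b \<in> n \<cdot> pow_prod n k A" using ij b by (intro ideal_prod.prod)
      ultimately show "i \<otimes> j \<in> (\<lambda>b. b \<otimes> u) ` (n \<cdot> pow_prod n k A)" by blast
    qed
    then show ?case by (simp add: pow_prod_Suc)
  qed
qed

subsection \<open>The ascending chain condition\<close>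

definition acc :: "'a set \<Rightarrow> bool" where
  "acc M \<longleftrightarrow> (\<forall>f :: nat \<Rightarrow> 'a set. (\<forall>i. submod (f i) \<and> f i \<subseteq> M \<and> f i \<subseteq> f (Suc i)) \<longrightarrow>
     (\<exists>n. \<forall>i\<ge>n. f i = f n))"

lemma acc_induct [consumes 3, case_names less]:
  assumes "acc M" "submod I" "I \<subseteq> M"
    and step: "\<And>I. submod I \<Longrightarrow> I \<subseteq> M \<Longrightarrow>
      (\<And>J. submod J \<Longrightarrow> J \<subseteq> M \<Longrightarrow> I \<subset> J \<Longrightarrow> P J) \<Longrightarrow> P I"
  shows "P I"
proof -
  let ?r = "{(J, I). submod J \<and> submod I \<and> J \<subseteq> M \<and> I \<subseteq> M \<and> I \<subset> J}"
  have "wf ?r"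
    unfolding wf_iff_no_infinite_down_chain
  proof
    assume "\<exists>f. \<forall>i. (f (Suc i), f i) \<in> ?r"
    then obtain f where f: "\<And>i. (f (Suc i), f i) \<in> ?r" by blast
    have "\<forall>i. submod (f i) \<and> f i \<subseteq> M \<and> f i \<subseteq> f (Suc i)"
    proof
      show "submod (f i) \<and> f i \<subseteq> M \<and> f i \<subseteq> f (Suc i)" for i using f[of i] by auto
    qed
    then obtain n where n: "\<forall>i\<ge>n. f i = f n" using assms(1) unfolding acc_def by blast
    have "f (Suc n) = f n" using n[rule_format, of "Suc n"] by simp
    then show False using f[of n] by simp
  qed
  then have "submod I \<longrightarrow> I \<subseteq> M \<longrightarrow> P I"
  proof (induction I rule: wf_induct_rule)
    case (less I)
    show ?case
    proof (intro impI)
      assume I: "submod I" "I \<subseteq> M"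
      show "P I"
      proof (rule step[OF I])
        fix J assume "submod J" "J \<subseteq> M" "I \<subset> J"
        then show "P J" using less.IH[of J] I by blast
      qed
    qed
  qed
  then show ?thesis using assms by blast
qed

section \<open>Spans and finite generation\<close>

definition span :: "'a set \<Rightarrow> 'a set" where
  "span S = \<Inter>{X. submod X \<and> S \<subseteq> X}"

lemma submod_carrier: "submod (carrier R)"
  by (rule submodI) (auto simp: A_carr)

lemma submod_span: "S \<subseteq> carrier R \<Longrightarrow> submod (span S)"
  using submod_carrier
  by (intro submodI) (auto simp: span_def submod_zero submod_add submod_smult)

lemma span_sub: "S \<subseteq> span S"
  by (auto simp: span_def)

lemma span_least: "submod X \<Longrightarrow> S \<subseteq> X \<Longrightarrow> span S \<subseteq> X"
  by (auto simp: span_def)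

lemma span_mono: "S \<subseteq> T \<Longrightarrow> span S \<subseteq> span T"
  by (auto simp: span_def)

lemma span_insert:
  assumes "S \<subseteq> carrier R" "u \<in> carrier R"
  shows "span (insert u S) = span S <+> cyc u"
proof
  show "span (insert u S) \<subseteq> span S <+> cyc u"
    using assms cyc_self[of u] set_add_left[of "span S" "cyc u"] set_add_right[of "span S" "cyc u"]
      submod_span[of S] submod_cyc[of u] span_sub[of S]
    by (intro span_least submod_set_add) auto
  show "span S <+> cyc u \<subseteq> span (insert u S)"
    using assms span_sub[of "insert u S"]
    by (intro set_add_least submod_span span_mono cyc_least) auto
qed

lemma span_empty: "span {} = {\<zero>}"
  using submod_zero_set submod_zero by (auto simp: span_def)

lemma finitely_generated:
  assumes "acc M" "submod X" "X \<subseteq> M"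
  shows "\<exists>S. finite S \<and> S \<subseteq> X \<and> span S = X"
proof -
  \<comment> \<open>The implication is what Noetherian induction can carry: a finitely spanned
    \<open>I\<close> other than \<open>X\<close> grows by one element of \<open>X\<close>, and the
    claim holds for the larger span. It is started at the zero submodule.\<close>
  have "(\<exists>S. finite S \<and> S \<subseteq> X \<and> span S = I) \<longrightarrow> (\<exists>S. finite S \<and> S \<subseteq> X \<and> span S = X)"
    if "submod I" "I \<subseteq> M" for I
    using assms(1) that
  proof (induction I rule: acc_induct)
    case (less I)
    show ?case
    proof
      assume "\<exists>S. finite S \<and> S \<subseteq> X \<and> span S = I"
      then obtain S where S: "finite S" "S \<subseteq> X" "span S = I" by blast
      show "\<exists>S. finite S \<and> S \<subseteq> X \<and> span S = X"
      proof (cases "I = X")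
        case False
        moreover have "I \<subseteq> X" using S span_least[OF assms(2)] by blast
        ultimately obtain x where x: "x \<in> X" "x \<notin> I" by blast
        let ?J = "span (insert x S)"
        have "?J \<subseteq> X" using x S by (intro span_least assms(2)) auto
        moreover have "submod ?J"
          using x S submod_sub[OF assms(2)] by (intro submod_span) auto
        moreover have "I \<subset> ?J"
          using x span_sub[of "insert x S"] S(3) span_mono[of S "insert x S"] by blast
        ultimately have "(\<exists>S. finite S \<and> S \<subseteq> X \<and> span S = ?J) \<longrightarrow> ?thesis"
          using assms(3) by (intro less.IH) auto
        moreover have "finite (insert x S)" "insert x S \<subseteq> X" using S x by auto
        ultimately show ?thesis by blast
      qed (use S in blast)
    qed
  qed
  from this[of "{\<zero>}"] show ?thesis
    using submod_zero_set assms submod_zero[OF assms(2)] span_empty by blast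
qed

subsection \<open>Prime ideals and the upper bound\<close>

definition prime_ideal :: "'a set \<Rightarrow> bool" where
  "prime_ideal p \<longleftrightarrow> submod p \<and> p \<subseteq> A \<and> \<one> \<notin> p \<and> (\<forall>a\<in>A. \<forall>b\<in>A. a \<otimes> b \<in> p \<longrightarrow> a \<in> p \<or> b \<in> p)"

text \<open>Says that dim A/I is at least \<open>e\<close> without forming A/I. Since
  \<open>prime_chain 0 I\<close> is the existence of a prime above \<open>I\<close>, its failure
  encodes dimension \<open>-\<infinity>\<close> and not 0.\<close>

definition prime_chain :: "nat \<Rightarrow> 'a set \<Rightarrow> bool" where
  "prime_chain e I \<longleftrightarrow> (\<exists>p. (\<forall>i\<le>e. prime_ideal (p i) \<and> I \<subseteq> p i) \<and> (\<forall>i<e. p i \<subset> p (Suc i)))"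

lemma prime_chain_antimono: "prime_chain e J \<Longrightarrow> I \<subseteq> J \<Longrightarrow> prime_chain e I"
  unfolding prime_chain_def by blast

lemma prime_chain_cons:
  assumes "prime_chain e I" "prime_ideal p" "p \<subset> I"
  shows "prime_chain (Suc e) p"
proof -
  obtain q where q: "\<And>i. i \<le> e \<Longrightarrow> prime_ideal (q i) \<and> I \<subseteq> q i" "\<And>i. i < e \<Longrightarrow> q i \<subset> q (Suc i)"
    using assms(1) unfolding prime_chain_def by blast
  then have pq: "p \<subseteq> q i" if "i \<le> e" for i using assms(3) that by blast
  let ?r = "\<lambda>i. case i of 0 \<Rightarrow> p | Suc j \<Rightarrow> q j"
  have "prime_ideal (?r i) \<and> p \<subseteq> ?r i" if "i \<le> Suc e" for i
    using that q(1) pq assms(2) by (cases i) auto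
  moreover have "?r i \<subset> ?r (Suc i)" if "i < Suc e" for i
  proof (cases i)
    case 0
    then show ?thesis using assms(3) q(1)[of 0] by auto
  next
    case (Suc j)
    then show ?thesis using that q(2)[of j] by simp
  qed
  ultimately show ?thesis unfolding prime_chain_def by blast
qed

lemma one_imp_A: "submod I \<Longrightarrow> I \<subseteq> A \<Longrightarrow> \<one> \<in> I \<Longrightarrow> I = A"
  using submod_smult[of I _ \<one>] A_carr by fastforce

text \<open>If \<open>I\<close> is proper and not prime, choose \<open>a\<close>, \<open>b\<close>
  outside \<open>I\<close> with product in \<open>I\<close>. Then \<open>I <+> cyc a\<close>
  contains \<open>a\<close> and \<open>colon I a\<close> contains \<open>b\<close>, so both are
  strictly larger and Noetherian induction applies. This takes the place of prime filtrations of
  A/I.\<close>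

lemma prime_devissage:
  assumes "acc A" "submod I" "I \<subseteq> A" "P A" "\<And>p. prime_ideal p \<Longrightarrow> P p"
    and step: "\<And>I a. submod I \<Longrightarrow> I \<subseteq> A \<Longrightarrow> a \<in> A \<Longrightarrow> P (I <+> cyc a) \<Longrightarrow> P (colon I a) \<Longrightarrow> P I"
  shows "P I"
  using assms(1-3)
proof (induction I rule: acc_induct)
  case (less I)
  consider "\<one> \<in> I" | "prime_ideal I" | a b where "a \<in> A" "b \<in> A" "a \<otimes> b \<in> I" "a \<notin> I" "b \<notin> I"
    using less.hyps unfolding prime_ideal_def by blast
  then show ?case
  proof cases
    case 1
    then show ?thesis using one_imp_A[of I] less.hyps assms(4) by blast
  next
    case 2
    then show ?thesis by (rule assms(5))
  next
    case 3
    have a: "a \<in> carrier R" using 3 A_carr by blast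
    have "P (I <+> cyc a)"
      using less.hyps 3 a cyc_self[OF a] submod_cyc[OF a] set_add_left[of I "cyc a"]
        set_add_right[of I "cyc a"] set_add_least[OF submod_A, of I "cyc a"] cyc_A[of a]
      by (intro less.IH submod_set_add) auto
    moreover have "P (colon I a)"
    proof (rule less.IH)
      have "b \<in> colon I a" using 3 commute[of a b] by (simp add: colon_def)
      then show "I \<subset> colon I a" using colon_supset less.hyps 3 by blast
    qed (use submod_colon less.hyps a colon_sub in auto)
    ultimately show ?thesis using step less.hyps 3 by blast
  qed
qed

text \<open>In the devissage step \<open>\<one> \<in> colon I a\<close> means
  \<open>a \<in> I\<close>, so \<open>I <+> cyc a\<close> is \<open>I\<close> itself and its unit
  lies in \<open>I\<close>.\<close>

lemma exists_prime:
  assumes "acc A" "submod I" "I \<subseteq> A" "\<not> prime_chain 0 I"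
  shows "I = A"
proof -
  have "\<not> prime_chain 0 I \<longrightarrow> \<one> \<in> I"
  proof (rule prime_devissage[OF assms(1-3), where P = "\<lambda>I. \<not> prime_chain 0 I \<longrightarrow> \<one> \<in> I"])
    show "\<not> prime_chain 0 p \<longrightarrow> \<one> \<in> p" if "prime_ideal p" for p
      using that unfolding prime_chain_def by auto
    fix I a assume *: "submod I" "I \<subseteq> A" "a \<in> A" "\<not> prime_chain 0 (I <+> cyc a) \<longrightarrow> \<one> \<in> I <+> cyc a"
      "\<not> prime_chain 0 (colon I a) \<longrightarrow> \<one> \<in> colon I a"
    show "\<not> prime_chain 0 I \<longrightarrow> \<one> \<in> I"
    proof
      assume "\<not> prime_chain 0 I"
      then have 1: "\<one> \<in> I <+> cyc a" and "\<one> \<in> colon I a"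
        using * prime_chain_antimono[of 0 "I <+> cyc a" I] prime_chain_antimono[of 0 "colon I a" I]
          set_add_left[of I "cyc a"] submod_cyc[of a] A_carr[of a] colon_supset[of I a] by blast+
      then have "a \<in> I" using * A_carr by (simp add: colon_def)
      then show "\<one> \<in> I" using 1 set_add_least[of I I "cyc a"] cyc_least[of I a] * by blast
    qed
  qed simp
  then show ?thesis using one_imp_A assms by blast
qed

text \<open>Length in the exact sequence 0 -> A/(Y : a) -> A/Y -> A/(Y + (a)) -> 0, the basis of the
  estimates for Hilbert functions of ideals.\<close>

lemma len_split:
  assumes Y: "submod Y" "Y \<subseteq> A" and a: "a \<in> A"
  shows "len Y A = len (colon Y a) A + len (Y <+> cyc a) A"
proof -
  have c: "a \<in> carrier R" using a A_carr by blast
  have "len Y A = len Y (Y <+> cyc a) + len (Y <+> cyc a) A"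
    using assms c cyc_A[OF a] by (intro len_add submod_set_add submod_A submod_cyc set_add_left set_add_least)
  then show ?thesis using len_colon[OF Y(1) c] by simp
qed

lemma set_add_swap_subset: "submod X \<Longrightarrow> submod Y \<Longrightarrow> submod Z \<Longrightarrow> (X <+> Y) <+> Z \<subseteq> (X <+> Z) <+> Y"
  by (meson order_trans set_add_least set_add_left set_add_subset_mono set_add_right submod_set_add order_refl)

lemma colon_step:
  assumes n: "submod n" "n \<subseteq> A" and I: "submod I" "I \<subseteq> A" and a: "a \<in> A"
  shows "colon I a <+> pow_prod n k A \<subseteq> colon (I <+> pow_prod n k A) a"
proof (rule set_add_least)
  have c: "a \<in> carrier R" using a A_carr by blast
  have smn: "submod (pow_prod n k A)" "pow_prod n k A \<subseteq> A" by (rule submod_pow_prod[OF n(1) submod_A], rule pow_prod_sub[OF n submod_A])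
  show "submod (colon (I <+> pow_prod n k A) a)"
    using c by (intro submod_colon submod_set_add I smn)
  show "colon I a \<subseteq> colon (I <+> pow_prod n k A) a"
    by (intro colon_mono set_add_left I smn)
  have "pow_prod n k A \<subseteq> I <+> pow_prod n k A" by (intro set_add_right I smn)
  then show "pow_prod n k A \<subseteq> colon (I <+> pow_prod n k A) a"
    using colon_supset[OF smn a] colon_mono by blast
qed

text \<open>With \<open>H\<^sub>I(k)\<close> the length of \<open>A / (I + n\<^sup>k)\<close>, the passage to primes is subadditivity along
  \<open>I \<subseteq> I + (a)\<close>, and for a prime \<open>p\<close> and \<open>a \<in> n - p\<close> multiplication by \<open>a\<close> gives
  \<open>H\<^sub>p(k + 1) \<le> H\<^sub>p(k) + H\<^sub>q(k + 1)\<close> with \<open>q = p + (a)\<close>, above which chains are shorter.\<close>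

lemma hilbert_upper:
  assumes A: "acc A" and n: "submod n" "n \<subseteq> A" "len n A \<noteq> \<infinity>"
    and "submod I" "I \<subseteq> A" "\<not> prime_chain e I"
  shows "\<exists>C. \<forall>k. len (I <+> pow_prod n k A) A \<le> enat (C * (if e = 0 then 0 else (k + 1) ^ (e - 1)))"
  using assms(5-)
proof (induction e arbitrary: I)
  \<comment> \<open>With no prime above it \<open>I\<close> is all of \<open>A\<close> and the
    length is 0. Hence the separate value for \<open>e = 0\<close>: the exponent
    \<open>e - 1\<close> would truncate to 0 and allow a nonzero constant.\<close>
  case 0
  then have "I = A" using exists_prime A by blast
  then have "len (I <+> pow_prod n k A) A = 0" for k
    using set_add_left[OF submod_A submod_pow_prod[OF n(1) submod_A]] by (intro len_eq_0) auto
  then show ?case by (simp add: zero_enat_def)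
next
  case (Suc e)
  have smn: "submod (pow_prod n k A)" "pow_prod n k A \<subseteq> A" for k
    by (rule submod_pow_prod[OF n(1) submod_A], rule pow_prod_sub[OF n(1,2) submod_A])
  let ?P = "\<lambda>I. \<not> prime_chain (Suc e) I \<longrightarrow> (\<exists>C. \<forall>k. len (I <+> pow_prod n k A) A \<le> enat (C * (k + 1) ^ e))"
  have "?P I"
  proof (rule prime_devissage[OF A Suc.prems(1,2), where P = ?P])
    have "len (A <+> pow_prod n k A) A = 0" for k
      using set_add_left[OF submod_A smn(1)] by (intro len_eq_0) auto
    then show "?P A" by auto
  next
    fix I a assume I: "submod I" "I \<subseteq> A" and a: "a \<in> A"
      and IH: "?P (I <+> cyc a)" "?P (colon I a)"
    have c: "a \<in> carrier R" using a A_carr by blast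
    show "?P I"
    proof
      assume np: "\<not> prime_chain (Suc e) I"
      obtain C where C: "\<And>k. len ((I <+> cyc a) <+> pow_prod n k A) A \<le> enat (C * (k + 1) ^ e)"
        using IH(1) np prime_chain_antimono set_add_left[OF I(1) submod_cyc[OF c]] by blast
      obtain D where D: "\<And>k. len (colon I a <+> pow_prod n k A) A \<le> enat (D * (k + 1) ^ e)"
        using IH(2) np prime_chain_antimono colon_supset[OF I a] by blast
      have "len (I <+> pow_prod n k A) A \<le> enat ((D + C) * (k + 1) ^ e)" for k
      proof -
        have "len (I <+> pow_prod n k A) A
          = len (colon (I <+> pow_prod n k A) a) A + len ((I <+> pow_prod n k A) <+> cyc a) A"
          using smn I a by (intro len_split submod_set_add set_add_least submod_A)
        also have "\<dots> \<le> len (colon I a <+> pow_prod n k A) A + len ((I <+> cyc a) <+> pow_prod n k A) A"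
          using colon_step[OF n(1,2) I a] set_add_swap_subset[OF I(1) submod_cyc[OF c] smn(1)]
          by (intro add_mono len_mono) auto
        also have "\<dots> \<le> enat (D * (k + 1) ^ e) + enat (C * (k + 1) ^ e)"
          using C D by (intro add_mono)
        finally show ?thesis by (simp add: algebra_simps)
      qed
      then show "\<exists>C. \<forall>k. len (I <+> pow_prod n k A) A \<le> enat (C * (k + 1) ^ e)" by blast
    qed
  next
    fix p assume p: "prime_ideal p"
    then have sp: "submod p" "p \<subseteq> A" by (auto simp: prime_ideal_def)
    show "?P p"
    proof
      assume np: "\<not> prime_chain (Suc e) p"
      show "\<exists>C. \<forall>k. len (p <+> pow_prod n k A) A \<le> enat (C * (k + 1) ^ e)"
      proof (cases "n \<subseteq> p")
        case True
        \<comment> \<open>Here A/(p + n^k) is a quotient of A/n, which has finite length, so the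
          bound is constant in \<open>k\<close>.\<close>
        obtain c where c: "len n A = enat c" using n(3) by auto
        have "len (p <+> pow_prod n k A) A \<le> enat (c * (k + 1) ^ e)" for k
        proof -
          have "len (p <+> pow_prod n k A) A \<le> len n A"
            using True set_add_left[OF sp(1) smn(1)] by (intro len_mono) auto
          also have "\<dots> \<le> enat (c * (k + 1) ^ e)" using c by simp
          finally show ?thesis .
        qed
        then show ?thesis by blast
      next
        case False
        then obtain a where a: "a \<in> n" "a \<notin> p" by blast
        have aA: "a \<in> A" and c: "a \<in> carrier R" using a n A_carr by auto
        let ?q = "p <+> cyc a"
        have q: "submod ?q" "?q \<subseteq> A"
          by (intro submod_set_add submod_cyc sp c, intro set_add_least submod_A sp cyc_A aA)
        have "p \<subset> ?q"
          using a set_add_left[OF sp(1) submod_cyc[OF c]] set_add_right[OF sp(1) submod_cyc[OF c]]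
            cyc_self[OF c] by blast
        then have "\<not> prime_chain e ?q" using prime_chain_cons[OF _ p] np by blast
        then obtain C where C: "\<And>k. len (?q <+> pow_prod n k A) A \<le> enat (C * (if e = 0 then 0 else (k + 1) ^ (e - 1)))"
          using Suc.IH[OF q] by blast
        let ?b = "\<lambda>k::nat. if e = 0 then 0 else (k + 1) ^ (e - 1)"
        \<comment> \<open>The recursion adds at most \<open>C * ?b k\<close> per step; as
          \<open>?b\<close> is monotone, the last summand bounds them all and the exponent rises by
          one.\<close>
        have "len (p <+> pow_prod n k A) A \<le> enat (k * (C * ?b k))" for k
        proof (induction k)
          case 0
          have "len (p <+> pow_prod n 0 A) A = 0"
            using set_add_right[OF sp(1) submod_A] by (intro len_eq_0) auto
          then show ?case by (simp add: zero_enat_def)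
        next
          case (Suc k)
          have "p <+> pow_prod n k A \<subseteq> colon (p <+> pow_prod n (Suc k) A) a"
          proof (rule set_add_least)
            show "submod (colon (p <+> pow_prod n (Suc k) A) a)"
              by (intro submod_colon submod_set_add sp smn c)
            show "p \<subseteq> colon (p <+> pow_prod n (Suc k) A) a"
              using colon_supset[OF sp aA] colon_mono[OF set_add_left[OF sp(1) smn(1)]] by blast
            show "pow_prod n k A \<subseteq> colon (p <+> pow_prod n (Suc k) A) a"
            proof
              fix b assume b: "b \<in> pow_prod n k A"
              then have bA: "b \<in> A" using smn by blast
              have "a \<otimes> b \<in> pow_prod n (Suc k) A"
                unfolding pow_prod_Suc using a b by (intro ideal_prod.prod)
              then have "b \<otimes> a \<in> p <+> pow_prod n (Suc k) A"
                using commute[OF aA bA] set_add_right[OF sp(1) smn(1)] by auto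
              then show "b \<in> colon (p <+> pow_prod n (Suc k) A) a" using bA by (simp add: colon_def)
            qed
          qed
          then have 1: "len (colon (p <+> pow_prod n (Suc k) A) a) A \<le> len (p <+> pow_prod n k A) A"
            by (intro len_mono) auto
          have 2: "len ((p <+> pow_prod n (Suc k) A) <+> cyc a) A \<le> len (?q <+> pow_prod n (Suc k) A) A"
            using set_add_swap_subset[OF sp(1) submod_cyc[OF c] smn(1)] by (intro len_mono) auto
          have "len (p <+> pow_prod n (Suc k) A) A
            = len (colon (p <+> pow_prod n (Suc k) A) a) A + len ((p <+> pow_prod n (Suc k) A) <+> cyc a) A"
            using smn sp aA by (intro len_split submod_set_add set_add_least submod_A)
          also have "\<dots> \<le> len (p <+> pow_prod n k A) A + len (?q <+> pow_prod n (Suc k) A) A"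
            using 1 2 by (rule add_mono)
          also have "\<dots> \<le> enat (k * (C * ?b k)) + enat (C * ?b (Suc k))"
            using Suc.IH C[of "Suc k"] by (rule add_mono)
          also have "\<dots> \<le> enat (k * (C * ?b (Suc k))) + enat (C * ?b (Suc k))"
            by (intro add_mono) (auto intro!: mult_le_mono power_mono)
          also have "\<dots> = enat (Suc k * (C * ?b (Suc k)))" by (simp add: add.commute)
          finally show ?case .
        qed
        moreover have "k * (C * ?b k) \<le> C * (k + 1) ^ e" for k
        proof (cases e)
          case (Suc e')
          have "k * (C * (k + 1) ^ e') \<le> (k + 1) * (C * (k + 1) ^ e')" by simp
          then show ?thesis using Suc by (simp add: algebra_simps)
        qed simp
        ultimately have "len (p <+> pow_prod n k A) A \<le> enat (C * (k + 1) ^ e)" for k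
          by (meson enat_ord_simps(1) order_trans)
        then show ?thesis by blast
      qed
    qed
  qed
  then show ?case using Suc.prems by simp
qed

subsection \<open>The Artin--Rees lemma\<close>

text \<open>Call an exponent new if the value of \<open>L\<close> there is not taken at any other
  exponent componentwise below it. Infinitely many new exponents would contain, by Dickson's lemma,
  an increasing sequence along which \<open>L\<close> changes at every step, against the chain
  condition. So every exponent lies above one of finitely many new ones with the same
  \<open>L\<close>, and \<open>c\<close> is the sum of their degrees.\<close>

lemma monotone_stabilises:
  fixes L :: "nat list \<Rightarrow> 'a set"
  assumes "acc M" and L: "\<And>\<alpha>. length \<alpha> = r \<Longrightarrow> submod (L \<alpha>) \<and> L \<alpha> \<subseteq> M"
    and mono: "\<And>\<sigma> \<alpha>. length \<alpha> = r \<Longrightarrow> list_all2 (\<le>) \<sigma> \<alpha> \<Longrightarrow> L \<sigma> \<subseteq> L \<alpha>"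
  shows "\<exists>c. \<forall>\<alpha>. length \<alpha> = r \<longrightarrow> (\<exists>\<sigma>. list_all2 (\<le>) \<sigma> \<alpha> \<and> sum_list \<sigma> \<le> c \<and> L \<sigma> = L \<alpha>)"
proof -
  define B where "B = {\<alpha>. length \<alpha> = r \<and> (\<forall>\<sigma>. list_all2 (\<le>) \<sigma> \<alpha> \<longrightarrow> \<sigma> \<noteq> \<alpha> \<longrightarrow> L \<sigma> \<noteq> L \<alpha>)}"
  have "finite B"
  proof (rule ccontr)
    assume "infinite B"
    then obtain f :: "nat \<Rightarrow> nat list" where f: "inj f" "range f \<subseteq> B"
      using infinite_countable_subset by blast
    have fr: "length (f i) = r" for i using f(2) by (auto simp: B_def)
    from dickson[of f r, OF fr] obtain g :: "nat \<Rightarrow> nat"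
      where g: "strict_mono g" "\<And>i j. i \<le> j \<Longrightarrow> list_all2 (\<le>) (f (g i)) (f (g j))"
      by (elim exE conjE) simp
    have "\<forall>i. submod (L (f (g i))) \<and> L (f (g i)) \<subseteq> M \<and> L (f (g i)) \<subseteq> L (f (g (Suc i)))"
      using L fr mono g(2) by simp
    then obtain n where n: "\<And>i. i \<ge> n \<Longrightarrow> L (f (g i)) = L (f (g n))"
      using assms(1)[unfolded acc_def, rule_format, of "\<lambda>i. L (f (g i))"] by blast
    have "f (g n) \<noteq> f (g (Suc n))"
      using f(1) g(1) by (simp add: inj_eq strict_mono_eq)
    moreover have "f (g (Suc n)) \<in> B" using f(2) by blast
    ultimately have "L (f (g n)) \<noteq> L (f (g (Suc n)))" using g(2)[of n "Suc n"] by (simp add: B_def)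
    then show False using n[of "Suc n"] by simp
  qed
  have *: "\<exists>\<sigma>\<in>B. list_all2 (\<le>) \<sigma> \<alpha> \<and> L \<sigma> = L \<alpha>" if "length \<alpha> = r" for \<alpha>
    using that
  proof (induction "sum_list \<alpha>" arbitrary: \<alpha> rule: less_induct)
    case less
    show ?case
    proof (cases "\<alpha> \<in> B")
      case True
      then show ?thesis using list.rel_refl[of "(\<le>)" \<alpha>] by blast
    next
      case False
      then obtain \<sigma> where s: "list_all2 (\<le>) \<sigma> \<alpha>" "\<sigma> \<noteq> \<alpha>" "L \<sigma> = L \<alpha>"
        using less.prems by (auto simp: B_def)
      have "length \<sigma> = r" using list_all2_lengthD[OF s(1)] less.prems by simp
      then obtain \<tau> where "\<tau> \<in> B" "list_all2 (\<le>) \<tau> \<sigma>" "L \<tau> = L \<sigma>"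
        using less.hyps[of \<sigma>] sum_list_less[OF s(1,2)] by blast
      then show ?thesis
        using s list_all2_trans[of "(\<le>)" "(\<le>)" "(\<le>)" \<tau> \<sigma> \<alpha>] by auto
    qed
  qed
  have "sum_list \<sigma> \<le> (\<Sum>\<tau>\<in>B. sum_list \<tau>)" if "\<sigma> \<in> B" for \<sigma>
    using \<open>finite B\<close> that by (intro member_le_sum) auto
  then show ?thesis using * by blast
qed

fun monomial :: "'a list \<Rightarrow> nat list \<Rightarrow> 'a" where
  "monomial (z # zs) (k # \<alpha>) = z [^] k \<otimes> monomial zs \<alpha>"
| "monomial _ _ = \<one>"

lemma monomial_A: "set zs \<subseteq> A \<Longrightarrow> monomial zs \<alpha> \<in> A"
  by (induction zs \<alpha> rule: monomial.induct) auto

lemma monomial_add: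
  assumes "set zs \<subseteq> A" "length \<alpha> = length zs" "length \<gamma> = length zs"
  shows "monomial zs (map2 (+) \<alpha> \<gamma>) = monomial zs \<alpha> \<otimes> monomial zs \<gamma>"
  using assms(2) assms(3)[symmetric] assms(1)
proof (induction \<alpha> zs \<gamma> rule: list_induct3)
  case (Cons a \<alpha> z zs c \<gamma>)
  have A: "z [^] a \<in> A" "z [^] c \<in> A" "monomial zs \<alpha> \<in> A" "monomial zs \<gamma> \<in> A"
    using Cons.prems monomial_A by auto
  note C = A[THEN A_carr]
  have "monomial (z # zs) (map2 (+) (a # \<alpha>) (c # \<gamma>)) = (z [^] a \<otimes> z [^] c) \<otimes> (monomial zs \<alpha> \<otimes> monomial zs \<gamma>)"
    using Cons A_carr by (simp add: nat_pow_mult)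
  also have "\<dots> = z [^] a \<otimes> (z [^] c \<otimes> monomial zs \<alpha>) \<otimes> monomial zs \<gamma>" using C by (simp add: m_assoc)
  also have "\<dots> = z [^] a \<otimes> (monomial zs \<alpha> \<otimes> z [^] c) \<otimes> monomial zs \<gamma>" using commute[OF A(2,3)] by simp
  also have "\<dots> = monomial (z # zs) (a # \<alpha>) \<otimes> monomial (z # zs) (c # \<gamma>)" using C by (simp add: m_assoc)
  finally show ?case .
qed simp

lemma monomial_times_generator:
  assumes "set zs \<subseteq> A" "z \<in> set zs" "length \<beta> = length zs"
  shows "\<exists>\<gamma>. length \<gamma> = length zs \<and> sum_list \<gamma> = Suc (sum_list \<beta>) \<and> monomial zs \<gamma> = z \<otimes> monomial zs \<beta>"
  using assms(3,1,2)
proof (induction \<beta> zs rule: list_induct2)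
  case (Cons b \<beta> y zs)
  have A: "y \<in> A" "z \<in> A" "monomial zs \<beta> \<in> A" "y [^] b \<in> A"
    using Cons.prems monomial_A by auto
  note C = A[THEN A_carr]
  show ?case
  proof (cases "z = y")
    case True
    have "y [^] Suc b = y \<otimes> y [^] b" using commute[OF A(1,4)] by simp
    then show ?thesis using True C Cons.hyps by (intro exI[of _ "Suc b # \<beta>"]) (simp add: m_assoc)
  next
    case False
    then obtain \<gamma> where g: "length \<gamma> = length zs" "sum_list \<gamma> = Suc (sum_list \<beta>)" "monomial zs \<gamma> = z \<otimes> monomial zs \<beta>"
      using Cons by auto
    have "y [^] b \<otimes> (z \<otimes> monomial zs \<beta>) = z \<otimes> (y [^] b \<otimes> monomial zs \<beta>)"
      using C commute[OF A(4,2)] by (simp add: m_assoc[symmetric])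
    then show ?thesis using g by (intro exI[of _ "b # \<gamma>"]) simp
  qed
qed simp

lemma monomial_pow_prod:
  assumes n: "submod n" "n \<subseteq> A" and "set zs \<subseteq> n" "length \<alpha> = length zs"
  shows "monomial zs \<alpha> \<in> pow_prod n (sum_list \<alpha>) A"
  using assms(4,3)
proof (induction \<alpha> zs rule: list_induct2)
  case (Cons a \<alpha> z zs)
  have z: "z \<in> A" using Cons.prems n by auto
  have "z [^] a \<in> pow_prod n a A" for a :: nat
  proof (induction a)
    case (Suc a)
    have "z [^] Suc a = z \<otimes> z [^] a" using commute[OF z A_pow[OF z]] by simp
    then show ?case using Suc Cons.prems ideal_prod.prod[of z n "z [^] a" "pow_prod n a A" R] by (simp add: pow_prod_Suc)
  qed simp
  then have "z [^] a \<otimes> monomial zs \<alpha> \<in> pow_prod n a (pow_prod n (sum_list \<alpha>) A)"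
    using Cons by (intro pow_prod_mult n submod_pow_prod submod_A) auto
  then show ?case by (simp add: pow_prod_add)
qed simp

text \<open>\<open>a\<close> may lie outside \<open>A\<close>: odd elements commute with
  \<open>R0\<close> as well, and the preimage is then still an \<open>R0\<close>-submodule.\<close>

lemma submod_commuting_vimage:
  assumes X: "submod X" and a: "a \<in> carrier R" and comm: "\<And>b. b \<in> A \<Longrightarrow> a \<otimes> b = b \<otimes> a"
  shows "submod {t \<in> carrier R. a \<otimes> t \<in> X}"
proof (rule submodI)
  show "{t \<in> carrier R. a \<otimes> t \<in> X} \<subseteq> carrier R" by blast
  show "\<zero> \<in> {t \<in> carrier R. a \<otimes> t \<in> X}" using a submod_zero[OF X] by simp
  show "x \<oplus> y \<in> {t \<in> carrier R. a \<otimes> t \<in> X}"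
    if "x \<in> {t \<in> carrier R. a \<otimes> t \<in> X}" "y \<in> {t \<in> carrier R. a \<otimes> t \<in> X}" for x y
    using that a submod_add[OF X] by (auto simp: r_distr)
  show "b \<otimes> x \<in> {t \<in> carrier R. a \<otimes> t \<in> X}" if "b \<in> A" "x \<in> {t \<in> carrier R. a \<otimes> t \<in> X}" for b x
  proof -
    have b: "b \<in> carrier R" "x \<in> carrier R" using that A_carr by auto
    have "a \<otimes> (b \<otimes> x) = b \<otimes> (a \<otimes> x)"
      using a b comm[OF that(1)] by (simp add: m_assoc[symmetric])
    then show ?thesis using that b submod_smult[OF X that(1)] by auto
  qed
qed

lemma submod_left_vimage: "submod X \<Longrightarrow> a \<in> A \<Longrightarrow> submod {t \<in> carrier R. a \<otimes> t \<in> X}"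
  by (rule submod_commuting_vimage) (auto simp: A_carr commute)

lemma submod_right_vimage:
  assumes X: "submod X" and u: "u \<in> carrier R"
  shows "submod {t \<in> carrier R. t \<otimes> u \<in> X}"
  by (rule submodI)
    (use u A_carr submod_zero[OF X] submod_add[OF X] submod_smult[OF X] in \<open>auto simp: l_distr m_assoc\<close>)

lemma submod_left_image:
  assumes "submod X" "a \<in> A"
  shows "submod ((\<otimes>) a ` X)"
proof (rule submodI)
  have a: "a \<in> carrier R" using assms A_carr by blast
  show "(\<otimes>) a ` X \<subseteq> carrier R" using a submod_carr[OF assms(1)] by auto
  show "\<zero> \<in> (\<otimes>) a ` X" using a submod_zero[OF assms(1)] by (intro image_eqI[of _ _ \<zero>]) auto
  show "x \<oplus> y \<in> (\<otimes>) a ` X" if xy: "x \<in> (\<otimes>) a ` X" "y \<in> (\<otimes>) a ` X" for x y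
  proof -
    obtain s t where "s \<in> X" "t \<in> X" "x = a \<otimes> s" "y = a \<otimes> t" using xy by blast
    then show ?thesis using a submod_add[OF assms(1)] submod_carr[OF assms(1)]
      by (intro image_eqI[of _ _ "s \<oplus> t"]) (auto simp: r_distr)
  qed
  show "b \<otimes> x \<in> (\<otimes>) a ` X" if bx: "b \<in> A" "x \<in> (\<otimes>) a ` X" for b x
  proof -
    obtain s where s: "s \<in> X" "x = a \<otimes> s" using bx by blast
    have b: "b \<in> carrier R" "s \<in> carrier R" using bx s A_carr submod_carr[OF assms(1)] by auto
    have "b \<otimes> x = a \<otimes> (b \<otimes> s)"
      using s a b commute[OF assms(2) bx(1)] by (simp add: m_assoc[symmetric])
    then show ?thesis using s bx submod_smult[OF assms(1)] by blast
  qed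
qed

text \<open>In the proof, \<open>L \<alpha>\<close> consists of the leading coefficients in \<open>M\<close> of those elements of \<open>N\<close> that are
  combinations of monomials of one degree with lexicographically largest exponent \<open>\<alpha>\<close>. Dickson's lemma
  and the chain condition make \<open>L\<close> depend on finitely many exponents only, which replaces the Hilbert
  basis theorem for the Rees algebra.\<close>

lemma artin_rees:
  assumes acc: "acc M" and M: "submod M" and N: "submod N" "N \<subseteq> M"
    and n: "submod n" "n \<subseteq> A" "finite Z" "span Z = n"
  shows "\<exists>c. \<forall>k\<ge>c. N \<inter> pow_prod n k M \<subseteq> pow_prod n (k - c) N"
proof -
  obtain zs where zs: "set zs = Z" using n(3) finite_list by blast
  have zn: "set zs \<subseteq> n" using zs n(4) span_sub by blast
  have zA: "set zs \<subseteq> A" using zn n(2) by blast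
  define r where "r = length zs"
  have mA: "monomial zs \<alpha> \<in> A" for \<alpha> using monomial_A[OF zA] .
  note mC = mA[THEN A_carr]
  \<comment> \<open>\<open>span (gen D)\<close> is the sum of the submodules z^\<beta> M with
    \<beta> in \<open>D\<close>; taken over all exponents of degree \<open>k\<close> it contains n^k
    M.\<close>
  define gen where "gen D = (\<Union>\<beta>\<in>D. (\<otimes>) (monomial zs \<beta>) ` M)" for D
  have gen_carr: "gen D \<subseteq> carrier R" for D
    unfolding gen_def using mC submod_carr[OF M] by auto
  have smG: "submod (span (gen D))" for D by (rule submod_span[OF gen_carr])
  \<comment> \<open>Only exponents of the same total degree compete, so the cancellation below runs
    over a finite set and stays within one power of \<open>n\<close>.\<close>
  define below where "below \<alpha> = {\<beta>. length \<beta> = r \<and> sum_list \<beta> = sum_list \<alpha> \<and> \<beta> < \<alpha>}" for \<alpha> :: "nat list"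
  have shift: "monomial zs \<gamma> \<otimes> t \<in> span (gen (below (map2 (+) \<sigma> \<gamma>)))"
    if t: "t \<in> span (gen (below \<sigma>))" and len: "length \<sigma> = r" "length \<gamma> = r" for \<sigma> \<gamma> t
  proof -
    let ?X = "span (gen (below (map2 (+) \<sigma> \<gamma>)))"
    have "span (gen (below \<sigma>)) \<subseteq> {t \<in> carrier R. monomial zs \<gamma> \<otimes> t \<in> ?X}"
    proof (rule span_least[OF submod_left_vimage[OF smG mA]], rule subsetI)
      fix y assume y: "y \<in> gen (below \<sigma>)"
      then obtain \<beta> x where b: "\<beta> \<in> below \<sigma>" "x \<in> M" "y = monomial zs \<beta> \<otimes> x" unfolding gen_def by blast
      have lb: "length \<beta> = r" using b(1) by (simp add: below_def)
      have "monomial zs \<gamma> \<otimes> y = monomial zs (map2 (+) \<beta> \<gamma>) \<otimes> x"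
        using b(3) monomial_add[OF zA, of \<beta> \<gamma>] lb len commute[OF mA mA, of \<beta> \<gamma>] mC submod_carr[OF M b(2)]
        by (simp add: m_assoc[symmetric] r_def)
      moreover have "map2 (+) \<beta> \<gamma> \<in> below (map2 (+) \<sigma> \<gamma>)"
        using b(1) len lex_map2_add[of \<beta> \<sigma> \<gamma>] by (simp add: below_def sum_list_map2_add)
      ultimately have "monomial zs \<gamma> \<otimes> y \<in> gen (below (map2 (+) \<sigma> \<gamma>))" using b(2) unfolding gen_def by blast
      then show "y \<in> {t \<in> carrier R. monomial zs \<gamma> \<otimes> t \<in> ?X}"
        using y gen_carr[of "below \<sigma>"] span_sub[of "gen (below (map2 (+) \<sigma> \<gamma>))"] by blast
    qed
    then show ?thesis using t by blast
  qed
  define L where "L \<alpha> = {m \<in> M. \<exists>t\<in>span (gen (below \<alpha>)). monomial zs \<alpha> \<otimes> m \<oplus> t \<in> N}" for \<alpha>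
  have smL: "submod (L \<alpha>) \<and> L \<alpha> \<subseteq> M" for \<alpha>
  proof
    show "L \<alpha> \<subseteq> M" by (auto simp: L_def)
    note sc = submod_carr[OF smG] submod_carr[OF M] mC
    show "submod (L \<alpha>)"
    proof (rule submodI)
      show "L \<alpha> \<subseteq> carrier R" using submod_carr[OF M] by (auto simp: L_def)
      have "monomial zs \<alpha> \<otimes> \<zero> \<oplus> \<zero> \<in> N" using mC submod_zero[OF N(1)] by simp
      then show "\<zero> \<in> L \<alpha>" unfolding L_def using submod_zero[OF M] submod_zero[OF smG] by blast
    next
      fix x y assume "x \<in> L \<alpha>" "y \<in> L \<alpha>"
      then obtain s t where *: "x \<in> M" "y \<in> M" "s \<in> span (gen (below \<alpha>))" "t \<in> span (gen (below \<alpha>))"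
        "monomial zs \<alpha> \<otimes> x \<oplus> s \<in> N" "monomial zs \<alpha> \<otimes> y \<oplus> t \<in> N" by (auto simp: L_def)
      have "monomial zs \<alpha> \<otimes> (x \<oplus> y) \<oplus> (s \<oplus> t) = (monomial zs \<alpha> \<otimes> x \<oplus> s) \<oplus> (monomial zs \<alpha> \<otimes> y \<oplus> t)"
        using * sc by (simp add: r_distr a_ac)
      then have "monomial zs \<alpha> \<otimes> (x \<oplus> y) \<oplus> (s \<oplus> t) \<in> N" using * submod_add[OF N(1)] by simp
      then show "x \<oplus> y \<in> L \<alpha>" unfolding L_def using * submod_add[OF M] submod_add[OF smG] by blast
    next
      fix a x assume a: "a \<in> A" and "x \<in> L \<alpha>"
      then obtain s where *: "x \<in> M" "s \<in> span (gen (below \<alpha>))" "monomial zs \<alpha> \<otimes> x \<oplus> s \<in> N" by (auto simp: L_def)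
      have "monomial zs \<alpha> \<otimes> (a \<otimes> x) = a \<otimes> (monomial zs \<alpha> \<otimes> x)"
        using commute[OF a mA[of \<alpha>]] * sc A_carr[OF a] by (simp add: m_assoc[symmetric])
      then have "monomial zs \<alpha> \<otimes> (a \<otimes> x) \<oplus> a \<otimes> s = a \<otimes> (monomial zs \<alpha> \<otimes> x \<oplus> s)"
        using * sc A_carr[OF a] by (simp add: r_distr)
      then have "monomial zs \<alpha> \<otimes> (a \<otimes> x) \<oplus> a \<otimes> s \<in> N" using * submod_smult[OF N(1) a] by simp
      then show "a \<otimes> x \<in> L \<alpha>" unfolding L_def using * submod_smult[OF M a] submod_smult[OF smG a] by blast
    qed
  qed
  \<comment> \<open>Multiplying by z^\<gamma> moves the leading exponent from \<sigma> to \<sigma> +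
    \<gamma> and leaves the leading coefficient alone. Hence \<open>L\<close> is monotone, and
    elements of \<open>N\<close> can be raised to higher degree.\<close>
  have lift: "\<exists>t'\<in>span (gen (below (map2 (+) \<sigma> \<gamma>))).
      monomial zs \<gamma> \<otimes> (monomial zs \<sigma> \<otimes> m \<oplus> t) = monomial zs (map2 (+) \<sigma> \<gamma>) \<otimes> m \<oplus> t'"
    if "m \<in> M" "t \<in> span (gen (below \<sigma>))" "length \<sigma> = r" "length \<gamma> = r" for m t \<sigma> \<gamma>
  proof (rule bexI[OF _ shift[OF that(2-4)]])
    have c: "m \<in> carrier R" "t \<in> carrier R" using that submod_carr[OF M] submod_carr[OF smG] by blast+
    show "monomial zs \<gamma> \<otimes> (monomial zs \<sigma> \<otimes> m \<oplus> t) = monomial zs (map2 (+) \<sigma> \<gamma>) \<otimes> m \<oplus> monomial zs \<gamma> \<otimes> t"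
      using monomial_add[OF zA, of \<sigma> \<gamma>] that(3,4) commute[OF mA mA, of \<sigma> \<gamma>] mC c
      by (simp add: r_distr m_assoc[symmetric] r_def)
  qed
  have monoL: "L \<sigma> \<subseteq> L \<alpha>" if ll: "length \<alpha> = r" "list_all2 (\<le>) \<sigma> \<alpha>" for \<sigma> \<alpha>
  proof
    obtain \<gamma> where g: "length \<gamma> = length \<sigma>" "\<alpha> = map2 (+) \<sigma> \<gamma>"
      using list_all2_le_diff[OF ll(2)] by blast
    have l: "length \<sigma> = r" "length \<gamma> = r" using g(1) list_all2_lengthD[OF ll(2)] ll(1) by simp_all
    fix m assume "m \<in> L \<sigma>"
    then obtain t where t: "m \<in> M" "t \<in> span (gen (below \<sigma>))" "monomial zs \<sigma> \<otimes> m \<oplus> t \<in> N" by (auto simp: L_def)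
    obtain t' where "t' \<in> span (gen (below \<alpha>))" "monomial zs \<gamma> \<otimes> (monomial zs \<sigma> \<otimes> m \<oplus> t) = monomial zs \<alpha> \<otimes> m \<oplus> t'"
      using lift[OF t(1,2) l] g(2) by blast
    then show "m \<in> L \<alpha>" using submod_smult[OF N(1) mA t(3), of \<gamma>] t(1) by (auto simp: L_def)
  qed
  have "\<exists>c. \<forall>\<alpha>. length \<alpha> = r \<longrightarrow> (\<exists>\<sigma>. list_all2 (\<le>) \<sigma> \<alpha> \<and> sum_list \<sigma> \<le> c \<and> L \<sigma> = L \<alpha>)"
    by (rule monotone_stabilises[OF acc]) (use smL monoL in auto)
  then obtain c where c: "\<And>\<alpha>. length \<alpha> = r \<Longrightarrow> \<exists>\<sigma>. list_all2 (\<le>) \<sigma> \<alpha> \<and> sum_list \<sigma> \<le> c \<and> L \<sigma> = L \<alpha>"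
    by auto
  define E where "E k = {\<beta> :: nat list. length \<beta> = r \<and> sum_list \<beta> = k}" for k
  have pwG: "pow_prod n k M \<subseteq> span (gen (E k))" for k
  proof (induction k)
    case 0
    have m1: "monomial zs (replicate r 0) = \<one>"
    proof -
      have "monomial ys (replicate (length ys) 0) = \<one>" if "set ys \<subseteq> carrier R" for ys
        using that by (induction ys) auto
      then show ?thesis using zA A_sub by (auto simp: r_def)
    qed
    have "x \<in> gen (E 0)" if "x \<in> M" for x
    proof -
      have "x = monomial zs (replicate r 0) \<otimes> x" using m1 submod_carr[OF M that] by simp
      moreover have "replicate r 0 \<in> E 0" by (simp add: E_def sum_list_replicate)
      ultimately show ?thesis using that unfolding gen_def by blast
    qed
    then show ?case using span_sub[of "gen (E 0)"] by auto
  next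
    case (Suc k)
    let ?X = "span (gen (E (Suc k)))"
    have 1: "z \<otimes> j \<in> ?X" if z: "z \<in> set zs" and j: "j \<in> span (gen (E k))" for z j
    proof -
      have zA': "z \<in> A" using z zA by blast
      have "span (gen (E k)) \<subseteq> {t \<in> carrier R. z \<otimes> t \<in> ?X}"
      proof (rule span_least[OF submod_left_vimage[OF smG zA']], rule subsetI)
        fix y assume y: "y \<in> gen (E k)"
        then obtain \<beta> x where b: "\<beta> \<in> E k" "x \<in> M" "y = monomial zs \<beta> \<otimes> x" unfolding gen_def by blast
        obtain \<gamma> where g: "length \<gamma> = length zs" "sum_list \<gamma> = Suc (sum_list \<beta>)" "monomial zs \<gamma> = z \<otimes> monomial zs \<beta>"
          using monomial_times_generator[OF zA z] b(1) by (auto simp: E_def r_def)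
        have "z \<otimes> y = monomial zs \<gamma> \<otimes> x" using g(3) b A_carr[OF zA'] mC submod_carr[OF M] by (simp add: m_assoc)
        moreover have "\<gamma> \<in> E (Suc k)" using g b(1) by (simp add: E_def r_def)
        ultimately have "z \<otimes> y \<in> gen (E (Suc k))" using b(2) unfolding gen_def by blast
        then show "y \<in> {t \<in> carrier R. z \<otimes> t \<in> ?X}"
          using y gen_carr[of "E k"] span_sub[of "gen (E (Suc k))"] by blast
      qed
      then show ?thesis using j by blast
    qed
    have "n \<cdot> pow_prod n k M \<subseteq> ?X"
    proof (rule prod_least[OF smG])
      fix i j assume i: "i \<in> n" and j: "j \<in> pow_prod n k M"
      have j': "j \<in> span (gen (E k))" using j Suc by blast
      then have "span Z \<subseteq> colon ?X j"
        using 1 zs zA submod_carr[OF smG j']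
        by (intro span_least submod_colon smG) (auto simp: colon_def)
      then show "i \<otimes> j \<in> ?X" using i n(4) by (auto simp: colon_def)
    qed
    then show ?case by (simp add: pow_prod_Suc)
  qed
  \<comment> \<open>Cancellation of leading terms. The coefficient of \<open>e\<close> at the
    largest exponent \<alpha> of \<open>D\<close> lies in \<open>L \<alpha> = L \<sigma>\<close>
    with \<sigma> of degree at most \<open>c\<close>. So an element of \<open>N\<close> with leading
    exponent \<sigma>, times z^\<gamma> of degree at least \<open>k - c\<close>, has the same
    leading term as \<open>e\<close>. This product lies in n^(k-c) N, and the difference involves
    only smaller exponents.\<close>
  have main: "e \<in> pow_prod n (k - c) N"
    if "k \<ge> c" "finite D" "D \<subseteq> E k" "\<And>\<alpha> \<beta>. \<alpha> \<in> D \<Longrightarrow> \<beta> \<in> E k \<Longrightarrow> \<beta> < \<alpha> \<Longrightarrow> \<beta> \<in> D"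
      "e \<in> N" "e \<in> span (gen D)" for k D e
    using that(2-)
  proof (induction "card D" arbitrary: D e)
    case 0
    then have "gen D = {}" by (simp add: gen_def)
    then have "e = \<zero>" using 0 span_empty by simp
    then show ?case using submod_zero[OF submod_pow_prod[OF n(1) N(1)]] by simp
  next
    case (Suc w)
    define \<alpha> where "\<alpha> = Max D"
    have "D \<noteq> {}" using Suc.hyps(2) by auto
    then have a: "\<alpha> \<in> D" "\<And>\<beta>. \<beta> \<in> D \<Longrightarrow> \<beta> \<le> \<alpha>" using Suc.prems(1) by (auto simp: \<alpha>_def)
    have aE: "length \<alpha> = r" "sum_list \<alpha> = k" using a(1) Suc.prems(2) by (auto simp: E_def)
    have D': "D - {\<alpha>} = below \<alpha>"
    proof (intro equalityI subsetI)
      fix \<beta> assume b: "\<beta> \<in> D - {\<alpha>}"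
      then have "\<beta> < \<alpha>" using a(2)[of \<beta>] by auto
      then show "\<beta> \<in> below \<alpha>" using b Suc.prems(2) aE by (auto simp: below_def E_def)
    next
      fix \<beta> assume "\<beta> \<in> below \<alpha>"
      then show "\<beta> \<in> D - {\<alpha>}" using Suc.prems(3)[OF a(1), of \<beta>] aE by (auto simp: below_def E_def)
    qed
    have IH: "e' \<in> pow_prod n (k - c) N" if "e' \<in> N" "e' \<in> span (gen (below \<alpha>))" for e'
    proof (rule Suc.hyps(1)[of "below \<alpha>"])
      show "w = card (below \<alpha>)" using D' Suc.hyps(2) Suc.prems(1) a(1) by (metis card_Diff_singleton diff_Suc_1)
      show "finite (below \<alpha>)" "below \<alpha> \<subseteq> E k" using Suc.prems(1,2) unfolding D'[symmetric] by auto
      show "\<beta> \<in> below \<alpha>" if "\<alpha>' \<in> below \<alpha>" "\<beta> \<in> E k" "\<beta> < \<alpha>'" for \<alpha>' \<beta>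
        using that aE by (auto simp: below_def E_def)
    qed (use that in auto)
    have "gen D = gen (below \<alpha>) \<union> (\<otimes>) (monomial zs \<alpha>) ` M" using D' a(1) by (auto simp: gen_def)
    then have "span (gen D) \<subseteq> span (gen (below \<alpha>)) <+> ((\<otimes>) (monomial zs \<alpha>) ` M)"
      using set_add_left[OF smG submod_left_image[OF M mA[of \<alpha>]], of "below \<alpha>"]
        set_add_right[OF smG submod_left_image[OF M mA[of \<alpha>]], of "below \<alpha>"] span_sub[of "gen (below \<alpha>)"]
      by (intro span_least submod_set_add smG submod_left_image M mA) auto
    then have "e \<in> span (gen (below \<alpha>)) <+> ((\<otimes>) (monomial zs \<alpha>) ` M)" using Suc.prems(5) by blast
    then obtain t m where tm: "t \<in> span (gen (below \<alpha>))" "m \<in> M" "e = t \<oplus> monomial zs \<alpha> \<otimes> m"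
      by (auto simp: mem_set_add)
    have cr: "t \<in> carrier R" "m \<in> carrier R" using tm submod_carr[OF M] submod_carr[OF smG] by blast+
    have "monomial zs \<alpha> \<otimes> m \<oplus> t \<in> N" using Suc.prems(4) tm(3) cr mC by (simp add: a_comm)
    then have "m \<in> L \<alpha>" using tm by (auto simp: L_def)
    then obtain \<sigma> where s: "list_all2 (\<le>) \<sigma> \<alpha>" "sum_list \<sigma> \<le> c" "m \<in> L \<sigma>"
      using c[OF aE(1)] by (elim exE conjE) simp
    obtain \<gamma> where g: "length \<gamma> = length \<sigma>" "\<alpha> = map2 (+) \<sigma> \<gamma>"
      using list_all2_le_diff[OF s(1)] by blast
    have l: "length \<sigma> = r" "length \<gamma> = r" using g(1) list_all2_lengthD[OF s(1)] aE(1) by simp_all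
    obtain u where u: "u \<in> span (gen (below \<sigma>))" "monomial zs \<sigma> \<otimes> m \<oplus> u \<in> N" using s(3) by (auto simp: L_def)
    obtain u' where u': "u' \<in> span (gen (below \<alpha>))"
      "monomial zs \<gamma> \<otimes> (monomial zs \<sigma> \<otimes> m \<oplus> u) = monomial zs \<alpha> \<otimes> m \<oplus> u'"
      using lift[OF tm(2) u(1) l] g(2) by blast
    define f where "f = monomial zs \<alpha> \<otimes> m \<oplus> u'"
    have cu: "u' \<in> carrier R" using u' submod_carr[OF smG] by blast
    have fN: "f \<in> N" using submod_smult[OF N(1) mA u(2), of \<gamma>] u' by (simp add: f_def)
    have "k - c \<le> sum_list \<gamma>" using aE(2) g s(2) by (simp add: sum_list_map2_add)
    then have fQ: "f \<in> pow_prod n (k - c) N"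
      using pow_prod_mult[OF n(1) N(1) u(2) monomial_pow_prod[OF n(1,2) zn], of \<gamma>] l u'
        pow_prod_antimono[OF n(1,2) N(1)] by (auto simp: f_def r_def)
    have "e = (t \<ominus> u') \<oplus> f"
      using tm(3) cr cu mC by (simp add: f_def a_minus_def a_ac r_neg1 r_neg2)
    moreover have "t \<ominus> u' \<in> N"
    proof -
      have "f \<oplus> (t \<ominus> u') = e" using calculation cr cu mC by (simp add: f_def a_comm)
      then show ?thesis using submod_add_cancel[OF N(1) fN, of "t \<ominus> u'"] Suc.prems(4) cr cu by simp
    qed
    moreover have "t \<ominus> u' \<in> span (gen (below \<alpha>))" using submod_minus[OF smG tm(1) u'(1)] .
    ultimately show ?case using IH fQ submod_add[OF submod_pow_prod[OF n(1) N(1)]] by simp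
  qed
  have "N \<inter> pow_prod n k M \<subseteq> pow_prod n (k - c) N" if "k \<ge> c" for k
    using main[OF that, of "E k"] pwG[of k] finite_exponents[of r k] by (auto simp: E_def)
  then show ?thesis by blast
qed

subsection \<open>Lower bounds and Hilbert functions of modules\<close>

text \<open>A converse to \<open>colon_step\<close> up to a shift. If b a = q + e with q in p and e
  in n^k, then e lies in N = p + (a), and Artin--Rees gives e = s + b' a with s in p and b' in
  n^(k-c). Since (b - b') a lies in the prime p and a does not, b - b' lies in p.\<close>

lemma prime_colon_artin_rees:
  assumes A: "acc A" and n: "submod n" "n \<subseteq> A" and p: "prime_ideal p" and a: "a \<in> A" "a \<notin> p"
  shows "\<exists>c. \<forall>k\<ge>c. colon (p <+> pow_prod n k A) a \<subseteq> p <+> pow_prod n (k - c) A"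
proof -
  have sp: "submod p" "p \<subseteq> A" and pp: "\<And>x y. x \<in> A \<Longrightarrow> y \<in> A \<Longrightarrow> x \<otimes> y \<in> p \<Longrightarrow> x \<in> p \<or> y \<in> p"
    using p by (auto simp: prime_ideal_def)
  have c: "a \<in> carrier R" using a A_carr by blast
  have smn: "submod (pow_prod n k A)" "pow_prod n k A \<subseteq> A" for k
    by (rule submod_pow_prod[OF n(1) submod_A], rule pow_prod_sub[OF n submod_A])
  obtain Z where Z: "finite Z" "span Z = n" using finitely_generated[OF A n] by blast
  let ?N = "p <+> cyc a"
  have N: "submod ?N" "?N \<subseteq> A"
    by (intro submod_set_add submod_cyc sp c, intro set_add_least submod_A sp cyc_A a)
  obtain c0 where c0: "\<And>k. k \<ge> c0 \<Longrightarrow> ?N \<inter> pow_prod n k A \<subseteq> pow_prod n (k - c0) ?N"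
    using artin_rees[OF A submod_A N n Z] by blast
  have "colon (p <+> pow_prod n k A) a \<subseteq> p <+> pow_prod n (k - c0) A" if k: "k \<ge> c0" for k
  proof
    fix b assume "b \<in> colon (p <+> pow_prod n k A) a"
    then obtain q e where b: "b \<in> A" "q \<in> p" "e \<in> pow_prod n k A" "b \<otimes> a = q \<oplus> e"
      by (auto simp: colon_def mem_set_add)
    have cr: "b \<in> carrier R" "q \<in> carrier R" "e \<in> carrier R"
      using b smn submod_carr sp A_carr by blast+
    have "b \<otimes> a \<in> ?N" "q \<in> ?N"
      using b sp c set_add_left[OF sp(1) submod_cyc[OF c]] set_add_right[OF sp(1) submod_cyc[OF c]]
      by (auto simp: cyc_def)
    then have "e \<in> ?N" using submod_add_cancel[OF N(1), of q e] b cr by simp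
    then have "e \<in> pow_prod n (k - c0) p <+> pow_prod n (k - c0) (cyc a)"
      using c0[OF k] b(3) pow_prod_set_add[OF n(1) sp(1) submod_cyc[OF c]] by blast
    then obtain s t where st: "s \<in> pow_prod n (k - c0) p" "t \<in> pow_prod n (k - c0) (cyc a)" "e = s \<oplus> t"
      by (auto simp: mem_set_add)
    have sp': "s \<in> p" using st(1) pow_prod_sub[OF n sp(1)] by blast
    obtain b' where b': "b' \<in> pow_prod n (k - c0) A" "t = b' \<otimes> a" using st(2) pow_prod_cyc[OF n c] by auto
    have b'A: "b' \<in> A" and cr': "b' \<in> carrier R" "s \<in> carrier R"
      using b' smn sp' sp submod_carr A_carr by blast+
    have e1: "b \<otimes> a = (q \<oplus> s) \<oplus> b' \<otimes> a" using b(4) st(3) b'(2) cr cr' c by (simp add: a_assoc)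
    have "(b \<ominus> b') \<otimes> a = b \<otimes> a \<ominus> b' \<otimes> a" using cr cr' c by (simp add: a_minus_def l_distr l_minus)
    also have "\<dots> = q \<oplus> s" using e1 cr cr' c by (simp add: a_minus_def a_assoc r_neg)
    finally have "(b \<ominus> b') \<otimes> a \<in> p" using submod_add[OF sp(1) b(2) sp'] by simp
    then have "b \<ominus> b' \<in> p" using pp[of "b \<ominus> b'" a] a b(1) b'A by auto
    moreover have "b = (b \<ominus> b') \<oplus> b'" using cr cr' by (simp add: a_minus_def a_assoc l_neg)
    ultimately show "b \<in> p <+> pow_prod n (k - c0) A" using b'(1) set_addI by metis
  qed
  then show ?thesis by blast
qed

text \<open>For \<open>a \<in> p\<^sub>1 - p\<^sub>0\<close>, Artin--Rees yields \<open>H\<^sub>0(k) \<ge> H\<^sub>0(k - c) + H\<^sub>1(k)\<close> for the lengths \<open>H\<^sub>i(k)\<close> of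
  \<open>A / (p\<^sub>i + n\<^sup>k)\<close>, and Pascal's rule does the rest.\<close>

lemma hilbert_lower:
  assumes A: "acc A" and n: "submod n" "n \<subseteq> A" and m: "submod m" "n \<subseteq> m" "\<one> \<notin> m"
    and "\<And>i. i \<le> d \<Longrightarrow> prime_ideal (p i) \<and> p i \<subseteq> m" "\<And>i. i < d \<Longrightarrow> p i \<subset> p (Suc i)"
  shows "\<exists>c\<ge>1. \<forall>j. enat (j choose d) \<le> len (p 0 <+> pow_prod n (c * (j + 1)) A) A"
  using assms(7-)
proof (induction d arbitrary: p)
  case 0
  have sp: "submod (p 0)" "p 0 \<subseteq> A" "p 0 \<subseteq> m" using 0(1)[of 0] by (auto simp: prime_ideal_def)
  \<comment> \<open>As \<open>j choose 0\<close> is 1, it is enough that p_0 + n^(j+1) stays inside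
    the proper \<open>m\<close>. The \<open>+ 1\<close> in \<open>c * (j + 1)\<close> keeps the
    exponent positive.\<close>
  have "1 \<le> len (p 0 <+> pow_prod n (Suc j) A) A" for j
  proof (rule len_ge_1)
    have smn: "submod (pow_prod n (Suc j) A)" "pow_prod n (Suc j) A \<subseteq> A"
      by (rule submod_pow_prod[OF n(1) submod_A], rule pow_prod_sub[OF n submod_A])
    show "submod (p 0 <+> pow_prod n (Suc j) A)" by (intro submod_set_add sp smn)
    have "n \<cdot> pow_prod n j A \<subseteq> m"
    proof (rule prod_least[OF m(1)])
      fix x y assume xy: "x \<in> n" "y \<in> pow_prod n j A"
      then have "y \<in> A" "x \<in> A" "x \<in> m" using pow_prod_sub[OF n submod_A] m n by blast+
      then show "x \<otimes> y \<in> m" using commute[of x y] submod_smult[OF m(1), of y x] by simp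
    qed
    then have "p 0 <+> pow_prod n (Suc j) A \<subseteq> m" using sp by (intro set_add_least m) (simp_all add: pow_prod_Suc)
    then have "\<one> \<notin> p 0 <+> pow_prod n (Suc j) A" using m by blast
    moreover have "p 0 <+> pow_prod n (Suc j) A \<subseteq> A" by (intro set_add_least submod_A sp smn)
    ultimately show "p 0 <+> pow_prod n (Suc j) A \<subset> A" using A_closed(2) by blast
  qed (rule submod_A)
  then show ?case by (intro exI[of _ 1]) (simp add: one_enat_def)
next
  case (Suc d)
  obtain c1 where c1: "c1 \<ge> 1" "\<And>j. enat (j choose d) \<le> len (p 1 <+> pow_prod n (c1 * (j + 1)) A) A"
    using Suc.IH[of "\<lambda>i. p (Suc i)"] Suc.prems by auto
  have p0: "prime_ideal (p 0)" "prime_ideal (p 1)" "p 0 \<subset> p 1" using Suc.prems(1)[of 0] Suc.prems(1)[of 1] Suc.prems(2)[of 0] by auto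
  then have sp: "submod (p 0)" "p 0 \<subseteq> A" "submod (p 1)" "p 1 \<subseteq> A" by (auto simp: prime_ideal_def)
  obtain a where a: "a \<in> p 1" "a \<notin> p 0" using p0 by blast
  have aA: "a \<in> A" and c: "a \<in> carrier R" using a sp A_carr by auto
  obtain c0 where c0: "\<And>k. k \<ge> c0 \<Longrightarrow> colon (p 0 <+> pow_prod n k A) a \<subseteq> p 0 <+> pow_prod n (k - c0) A"
    using prime_colon_artin_rees[OF A n p0(1) aA a(2)] by blast
  have smn: "submod (pow_prod n k A)" "pow_prod n k A \<subseteq> A" for k
    by (rule submod_pow_prod[OF n(1) submod_A], rule pow_prod_sub[OF n submod_A])
  \<comment> \<open>\<open>c0\<close> pays for the Artin--Rees shift when passing from
    \<open>j + 1\<close> to \<open>j\<close>; \<open>c1\<close> is the constant for the chain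
    starting at p_1.\<close>
  let ?c = "c0 + c1"
  have "enat (j choose Suc d) \<le> len (p 0 <+> pow_prod n (?c * (j + 1)) A) A" for j
  proof (induction j)
    case 0
    then show ?case by (simp add: zero_enat_def[symmetric])
  next
    case (Suc j)
    let ?k = "?c * (Suc j + 1)"
    have k: "?k \<ge> c0" "?k - c0 \<ge> ?c * (j + 1)" "?k \<ge> c1 * (Suc j + 1)"
      by (simp_all add: algebra_simps)
    have "enat (j choose Suc d) \<le> len (p 0 <+> pow_prod n (?c * (j + 1)) A) A" by (rule Suc.IH)
    also have "\<dots> \<le> len (colon (p 0 <+> pow_prod n ?k A) a) A"
      using c0[OF k(1)] pow_prod_antimono[OF n submod_A k(2)] set_add_subset_mono[of "p 0" "p 0"]
      by (intro len_mono) (blast, simp)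
    finally have 1: "enat (j choose Suc d) \<le> len (colon (p 0 <+> pow_prod n ?k A) a) A" .
    have "j choose d \<le> Suc j choose d" by (cases d) auto
    then have "enat (j choose d) \<le> enat (Suc j choose d)" by simp
    also have "\<dots> \<le> len (p 1 <+> pow_prod n (c1 * (Suc j + 1)) A) A" by (rule c1)
    also have "\<dots> \<le> len ((p 0 <+> pow_prod n ?k A) <+> cyc a) A"
    proof (rule len_mono)
      have "pow_prod n ?k A \<subseteq> p 1 <+> pow_prod n (c1 * (Suc j + 1)) A"
        using pow_prod_antimono[OF n submod_A k(3)] set_add_right[OF sp(3) smn(1)] by blast
      moreover have "p 0 \<subseteq> p 1 <+> pow_prod n (c1 * (Suc j + 1)) A" "cyc a \<subseteq> p 1 <+> pow_prod n (c1 * (Suc j + 1)) A"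
        using set_add_left[OF sp(3) smn(1)] p0(3) cyc_least[OF sp(3) a(1)] by blast+
      ultimately show "p 0 <+> pow_prod n ?k A <+> cyc a \<subseteq> p 1 <+> pow_prod n (c1 * (Suc j + 1)) A"
        by (intro set_add_least submod_set_add sp smn)
    qed simp
    finally have 2: "enat (j choose d) \<le> len ((p 0 <+> pow_prod n ?k A) <+> cyc a) A" .
    have "enat (Suc j choose Suc d) = enat (j choose Suc d) + enat (j choose d)" by simp
    also have "\<dots> \<le> len (colon (p 0 <+> pow_prod n ?k A) a) A + len ((p 0 <+> pow_prod n ?k A) <+> cyc a) A"
      using 1 2 by (rule add_mono)
    also have "\<dots> = len (p 0 <+> pow_prod n ?k A) A"
      using smn sp aA by (intro len_split[symmetric] submod_set_add set_add_least submod_A)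
    finally show ?case .
  qed
  moreover have "?c \<ge> 1" using c1 by simp
  ultimately show ?case by blast
qed

text \<open>Artin--Rees compares the filtration that n^k M induces on A u with n^(k-c) u. As the
  first prime p_0 of the chain contains Ann(u), \<open>colon (pow_prod n k M) u\<close> lies in p_0
  + n^(k-c), and the image of A u in M/n^k M is already long enough.\<close>

lemma hilbert_module_lower:
  assumes A: "acc A" and n: "submod n" "n \<subseteq> A" and m: "submod m" "n \<subseteq> m" "\<one> \<notin> m"
    and pm: "\<And>p. prime_ideal p \<Longrightarrow> p \<subseteq> m"
    and M: "acc M" "submod M" "u \<in> M" and ch: "prime_chain d (colon {\<zero>} u)"
  shows "\<exists>c\<ge>1. \<forall>j. enat (j choose d) \<le> len (pow_prod n (c * (j + 1)) M) M"
proof -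
  obtain p where p: "\<And>i. i \<le> d \<Longrightarrow> prime_ideal (p i) \<and> colon {\<zero>} u \<subseteq> p i" "\<And>i. i < d \<Longrightarrow> p i \<subset> p (Suc i)"
    using ch unfolding prime_chain_def by blast
  obtain c1 where c1: "c1 \<ge> 1" "\<And>j. enat (j choose d) \<le> len (p 0 <+> pow_prod n (c1 * (j + 1)) A) A"
    using hilbert_lower[OF A n m, of d p] p pm by blast
  have u: "u \<in> carrier R" using M submod_carr by blast
  have p0: "submod (p 0)" "colon {\<zero>} u \<subseteq> p 0" using p(1)[of 0] by (auto simp: prime_ideal_def)
  have smn: "submod (pow_prod n k A)" "pow_prod n k A \<subseteq> A" for k
    by (rule submod_pow_prod[OF n(1) submod_A], rule pow_prod_sub[OF n submod_A])
  obtain Z where Z: "finite Z" "span Z = n" using finitely_generated[OF A n] by blast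
  obtain c0 where c0: "\<And>k. k \<ge> c0 \<Longrightarrow> cyc u \<inter> pow_prod n k M \<subseteq> pow_prod n (k - c0) (cyc u)"
    using artin_rees[OF M(1,2) submod_cyc[OF u] cyc_least[OF M(2,3)] n Z] by blast
  have *: "colon (pow_prod n k M) u \<subseteq> p 0 <+> pow_prod n (k - c0) A" if k: "k \<ge> c0" for k
  proof
    fix b assume b: "b \<in> colon (pow_prod n k M) u"
    then have bA: "b \<in> A" "b \<otimes> u \<in> cyc u \<inter> pow_prod n k M" by (auto simp: colon_def cyc_def)
    then obtain b' where b': "b' \<in> pow_prod n (k - c0) A" "b \<otimes> u = b' \<otimes> u"
      using c0[OF k] pow_prod_cyc[OF n u] by auto
    have b'A: "b' \<in> A" using b' smn by blast
    note cr = bA(1)[THEN A_carr] b'A[THEN A_carr]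
    have "(b \<ominus> b') \<otimes> u = \<zero>" using b'(2) cr u by (simp add: a_minus_def l_distr l_minus r_neg)
    then have "b \<ominus> b' \<in> p 0" using p0(2) bA(1) b'A by (auto simp: colon_def)
    moreover have "b = (b \<ominus> b') \<oplus> b'" using cr by (simp add: a_minus_def a_assoc l_neg)
    ultimately show "b \<in> p 0 <+> pow_prod n (k - c0) A" using b'(1) set_addI by metis
  qed
  have "enat (j choose d) \<le> len (pow_prod n ((c0 + c1) * (j + 1)) M) M" for j
  proof -
    let ?k = "(c0 + c1) * (j + 1)"
    have k: "?k \<ge> c0" "?k - c0 \<ge> c1 * (j + 1)" by (simp_all add: algebra_simps)
    have smM: "submod (pow_prod n ?k M)" by (rule submod_pow_prod[OF n(1) M(2)])
    have "enat (j choose d) \<le> len (p 0 <+> pow_prod n (c1 * (j + 1)) A) A" by (rule c1)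
    also have "\<dots> \<le> len (colon (pow_prod n ?k M) u) A"
      using *[OF k(1)] pow_prod_antimono[OF n submod_A k(2)] set_add_subset_mono[of "p 0" "p 0"]
      by (intro len_mono) (blast, simp)
    also have "\<dots> = len (pow_prod n ?k M) (pow_prod n ?k M <+> cyc u)" by (rule len_colon[OF smM u, symmetric])
    also have "\<dots> \<le> len (pow_prod n ?k M) M"
      by (intro len_mono set_add_least M pow_prod_sub n cyc_least order_refl)
    finally show ?thesis .
  qed
  moreover have "c0 + c1 \<ge> 1" using c1 by simp
  ultimately show ?thesis by blast
qed

text \<open>The generators are added one at a time. Each increment is a cyclic module A/J where J
  contains both Ann(u) and n^k, so \<open>hilbert_upper\<close> for Ann(u) bounds it; the constants
  add up while the exponent stays.\<close>

lemma hilbert_module_upper: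
  assumes A: "acc A" and n: "submod n" "n \<subseteq> A" "len n A \<noteq> \<infinity>"
    and M: "submod M" "finite S" "span S = M" and S: "\<And>u. u \<in> S \<Longrightarrow> \<not> prime_chain e (colon {\<zero>} u)"
  shows "\<exists>C. \<forall>k. len (pow_prod n k M) M \<le> enat (C * (if e = 0 then 0 else (k + 1) ^ (e - 1)))"
proof -
  let ?b = "\<lambda>k::nat. if e = 0 then 0 else (k + 1) ^ (e - 1)"
  have smM: "submod (pow_prod n k M)" for k by (rule submod_pow_prod[OF n(1) M(1)])
  have SM: "S \<subseteq> M" using M(3) span_sub by blast
  have "\<exists>C. \<forall>k. len (pow_prod n k M) (pow_prod n k M <+> span S') \<le> enat (C * ?b k)" if "S' \<subseteq> S" for S'
    using finite_subset[OF that M(2)] that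
  proof (induction S')
    case empty
    have "len (pow_prod n k M) (pow_prod n k M <+> span {}) = 0" for k
      using set_add_absorb[OF smM submod_zero_set] submod_zero[OF smM] span_empty by (intro len_eq_0) auto
    then show ?case by auto
  next
    case (insert u S')
    have S': "S' \<subseteq> carrier R" "u \<in> S" and u: "u \<in> M" "u \<in> carrier R"
      using insert.prems SM submod_sub[OF M(1)] by auto
    have sS: "submod (span S')" by (rule submod_span[OF S'(1)])
    obtain C where C: "\<And>k. len (pow_prod n k M) (pow_prod n k M <+> span S') \<le> enat (C * ?b k)"
      using insert by blast
    have sz: "submod (colon {\<zero>} u)" by (rule submod_colon[OF submod_zero_set u(2)])
    obtain D where D: "\<And>k. len (colon {\<zero>} u <+> pow_prod n k A) A \<le> enat (D * ?b k)"
      using hilbert_upper[OF A n sz colon_sub S[OF S'(2)]] by blast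
    have "len (pow_prod n k M) (pow_prod n k M <+> span (insert u S')) \<le> enat ((C + D) * ?b k)" for k
    proof -
      let ?Y = "pow_prod n k M <+> span S'"
      have Y: "submod ?Y" by (intro submod_set_add smM sS)
      have Yu: "submod (?Y <+> cyc u)" by (intro submod_set_add Y submod_cyc u)
      have "pow_prod n k M <+> span (insert u S') \<subseteq> ?Y <+> cyc u"
        unfolding span_insert[OF S'(1) u(2)]
      proof (intro set_add_least Yu)
        show "pow_prod n k M \<subseteq> ?Y <+> cyc u" "span S' \<subseteq> ?Y <+> cyc u" "cyc u \<subseteq> ?Y <+> cyc u"
          using set_add_left[OF smM sS] set_add_right[OF smM sS] set_add_left[OF Y submod_cyc[OF u(2)]]
            set_add_right[OF Y submod_cyc[OF u(2)]] by blast+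
      qed
      then have "len (pow_prod n k M) (pow_prod n k M <+> span (insert u S')) \<le> len (pow_prod n k M) (?Y <+> cyc u)"
        by (intro len_mono) auto
      also have "\<dots> = len (pow_prod n k M) ?Y + len ?Y (?Y <+> cyc u)"
        by (intro len_add Yu Y smM sS set_add_left submod_cyc u)
      also have "len ?Y (?Y <+> cyc u) = len (colon ?Y u) A" by (rule len_colon[OF Y u(2)])
      also have "len (colon ?Y u) A \<le> len (colon {\<zero>} u <+> pow_prod n k A) A"
      proof (intro len_mono set_add_least submod_colon Y u)
        show "colon {\<zero>} u \<subseteq> colon ?Y u" using submod_zero[OF Y] by (intro colon_mono) auto
        show "pow_prod n k A \<subseteq> colon ?Y u"
          using pow_prod_mult[OF n(1) M(1) u(1)] set_add_left[OF smM sS] pow_prod_sub[OF n(1,2) submod_A]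
          unfolding colon_def by blast
      qed simp
      finally have "len (pow_prod n k M) (pow_prod n k M <+> span (insert u S'))
          \<le> len (pow_prod n k M) ?Y + len (colon {\<zero>} u <+> pow_prod n k A) A" by (simp add: add_left_mono)
      also have "\<dots> \<le> enat (C * ?b k) + enat (D * ?b k)" using C D by (rule add_mono)
      finally show ?thesis by (simp add: algebra_simps)
    qed
    then show ?case by blast
  qed
  then obtain C where C: "\<And>k. len (pow_prod n k M) (pow_prod n k M <+> span S) \<le> enat (C * ?b k)" by blast
  have "len (pow_prod n k M) M \<le> enat (C * ?b k)" for k
  proof -
    have "len (pow_prod n k M) M \<le> len (pow_prod n k M) (pow_prod n k M <+> span S)"
      unfolding M(3) by (intro len_mono set_add_right smM M(1) order_refl)
    then show ?thesis using C order_trans by blast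
  qed
  then show ?thesis by blast
qed

text \<open>By devissage only primes above \<open>n\<close> matter. The only candidate is
  \<open>m\<close>, and A/m has length at most 1.\<close>

lemma finite_length_primary:
  assumes A: "acc A" and n: "submod n" "n \<subseteq> A"
    and pm: "\<And>p. prime_ideal p \<Longrightarrow> n \<subseteq> p \<Longrightarrow> p = m"
    and max: "\<And>X. submod X \<Longrightarrow> m \<subseteq> X \<Longrightarrow> X \<subseteq> A \<Longrightarrow> X = m \<or> X = A"
  shows "len n A \<noteq> \<infinity>"
proof -
  have "n \<subseteq> n \<longrightarrow> len n A \<noteq> \<infinity>"
  proof (rule prime_devissage[OF A n, where P = "\<lambda>J. n \<subseteq> J \<longrightarrow> len J A \<noteq> \<infinity>"])
    show "n \<subseteq> A \<longrightarrow> len A A \<noteq> \<infinity>" using len_eq_0[of A A] by simp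
  next
    fix p assume p: "prime_ideal p"
    show "n \<subseteq> p \<longrightarrow> len p A \<noteq> \<infinity>"
    proof
      assume "n \<subseteq> p"
      then have pm': "p = m" using pm p by blast
      have "len m A \<le> enat 1"
      proof (rule len_leI)
        fix k f assume f: "submod_chain k f" "m \<subseteq> f 0" "f k \<subseteq> A"
        have "\<not> k \<ge> 2"
        proof
          assume k: "k \<ge> 2"
          then have "f 0 \<subset> f 1" "f 1 \<subset> f (Suc 1)" "submod (f 1)" using f(1) unfolding submod_chain_def by auto
          moreover have "f (Suc 1) \<subseteq> f k" using submod_chain_mono[OF f(1), of "Suc 1" k] k by simp
          ultimately show False using max[of "f 1"] f by blast
        qed
        then show "enat k \<le> enat 1" by simp
      qed
      then show "len p A \<noteq> \<infinity>" using pm' by (cases "len m A") auto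
    qed
  next
    fix I a assume I: "submod I" "I \<subseteq> A" and a: "a \<in> A"
      and IH: "n \<subseteq> I <+> cyc a \<longrightarrow> len (I <+> cyc a) A \<noteq> \<infinity>" "n \<subseteq> colon I a \<longrightarrow> len (colon I a) A \<noteq> \<infinity>"
    show "n \<subseteq> I \<longrightarrow> len I A \<noteq> \<infinity>"
      using len_split[OF I a] IH set_add_left[OF I(1) submod_cyc[OF A_carr[OF a]]] colon_supset[OF I a]
      by auto
  qed
  then show ?thesis by simp
qed

subsection \<open>Ideals and quotients of the subring\<close>

abbreviation RA :: "('a, 'b) ring_scheme" where "RA \<equiv> R\<lparr>carrier := A\<rparr>"

lemma cring_RA: "cring RA"
proof -
  have "subcring A R" using subring commute by (intro subcring.intro subcring_axioms.intro)
  then show ?thesis using subcring_iff[OF A_sub] by blast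
qed

lemma RA_minus: "x \<in> A \<Longrightarrow> \<ominus>\<^bsub>RA\<^esub> x = \<ominus> x"
proof -
  assume x: "x \<in> A"
  interpret RA: cring RA by (rule cring_RA)
  show ?thesis by (rule RA.minus_equality) (use x A_carr[OF x] in \<open>simp_all add: l_neg\<close>)
qed

lemma ideal_iff: "ideal I RA \<longleftrightarrow> submod I \<and> I \<subseteq> A"
proof
  assume "ideal I RA"
  then interpret I: ideal I RA .
  have sub: "I \<subseteq> A" using I.a_subset by simp
  moreover have "submod I"
    by (rule submodI)
      (use sub A_sub I.I_l_closed additive_subgroup.a_closed[OF I.is_additive_subgroup]
          additive_subgroup.zero_closed[OF I.is_additive_subgroup] in auto)
  ultimately show "submod I \<and> I \<subseteq> A" by blast
next
  assume I: "submod I \<and> I \<subseteq> A"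
  interpret RA: cring RA by (rule cring_RA)
  show "ideal I RA"
  proof (rule idealI)
    show "ring RA" by (rule RA.ring_axioms)
    show "subgroup I (add_monoid RA)"
    proof (rule subgroup.intro)
      show "inv\<^bsub>add_monoid RA\<^esub> x \<in> I" if "x \<in> I" for x
        using that I RA_minus[of x] submod_neg[of I x] by (auto simp: a_inv_def)
    qed (use I submod_add submod_zero in auto)
    show "x \<otimes>\<^bsub>RA\<^esub> a \<in> I" if "a \<in> I" "x \<in> carrier RA" for a x
      using that I submod_smult by simp
    show "a \<otimes>\<^bsub>RA\<^esub> x \<in> I" if "a \<in> I" "x \<in> carrier RA" for a x
      using that I submod_smult[of I x a] commute[of a x] by auto
  qed
qed

section \<open>Cosets and the primes of a quotient ring\<close>

lemma RA_coset: "a_r_coset RA = a_r_coset R"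
  by (intro ext) (simp add: a_r_coset_def')

lemma mem_coset: "z \<in> Y +> x \<longleftrightarrow> (\<exists>h\<in>Y. z = h \<oplus> x)"
  by (auto simp: a_r_coset_def')

lemma coset_self: "submod Y \<Longrightarrow> x \<in> carrier R \<Longrightarrow> x \<in> Y +> x"
  using submod_zero[of Y] by (force simp: mem_coset)

lemma abelian_subgroup_submod: "submod Y \<Longrightarrow> abelian_subgroup Y R"
proof (rule abelian_subgroupI3)
  assume Y: "submod Y"
  show "additive_subgroup Y R"
  proof (rule additive_subgroup.intro, rule subgroup.intro)
    show "inv\<^bsub>add_monoid R\<^esub> x \<in> Y" if "x \<in> Y" for x
      using that Y submod_neg[of Y x] by (simp add: a_inv_def)
  qed (use Y submod_add submod_zero submod_sub in auto)
qed (rule abelian_group_axioms)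

lemma coset_eq_iff:
  assumes Y: "submod Y" and x: "x \<in> carrier R" and y: "y \<in> carrier R"
  shows "Y +> x = Y +> y \<longleftrightarrow> x \<ominus> y \<in> Y"
proof -
  interpret Y: abelian_subgroup Y R using Y by (rule abelian_subgroup_submod)
  have "Y +> x = Y +> y \<longleftrightarrow> x \<in> Y +> y"
    using Y.a_repr_independence'[of x y] coset_self[OF Y x] x y by auto
  also have "\<dots> \<longleftrightarrow> x \<ominus> y \<in> Y"
  proof
    assume "x \<in> Y +> y"
    then obtain h where "h \<in> Y" "x = h \<oplus> y" by (auto simp: mem_coset)
    then show "x \<ominus> y \<in> Y" using submod_carr[OF Y] y by (simp add: a_minus_def a_assoc r_neg)
  next
    assume "x \<ominus> y \<in> Y"
    moreover have "x = (x \<ominus> y) \<oplus> y" using x y by (simp add: a_minus_def a_assoc l_neg)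
    ultimately show "x \<in> Y +> y" by (auto simp: mem_coset)
  qed
  finally show ?thesis .
qed

lemma coset_mem_image_iff:
  assumes Y: "submod Y" and S: "submod S" "Y \<subseteq> S" and x: "x \<in> carrier R"
  shows "Y +> x \<in> (\<lambda>s. Y +> s) ` S \<longleftrightarrow> x \<in> S"
proof
  assume "Y +> x \<in> (\<lambda>s. Y +> s) ` S"
  then obtain s where s: "s \<in> S" "x \<ominus> s \<in> Y" using coset_eq_iff[OF Y x] submod_carr[OF S(1)] by auto
  have "x = (x \<ominus> s) \<oplus> s" using x submod_carr[OF S(1) s(1)] by (simp add: a_minus_def a_assoc l_neg)
  then show "x \<in> S" using s S submod_add by (metis subsetD)
qed blast

lemma coset_add:
  assumes "submod Y" "x \<in> carrier R" "y \<in> carrier R"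
  shows "(Y +> x) <+> (Y +> y) = Y +> (x \<oplus> y)"
proof -
  interpret Y: abelian_subgroup Y R using assms(1) by (rule abelian_subgroup_submod)
  show ?thesis using assms(2,3) by (rule Y.a_rcos_sum)
qed

lemma quot_carrier: "carrier (RA Quot I) = (\<lambda>a. I +> a) ` A"
  by (auto simp: FactRing_def A_RCOSETS_def' RA_coset)

lemma quot_hom:
  assumes "submod I" "I \<subseteq> A"
  shows "ring_hom_ring RA (RA Quot I) (\<lambda>a. I +> a)"
  using ideal.rcos_ring_hom_ring[of I RA] assms by (simp add: ideal_iff RA_coset)

lemma quot_cring:
  assumes "submod I" "I \<subseteq> A"
  shows "cring (RA Quot I)"
  using ideal.quotient_is_cring[of I RA] assms cring_RA by (simp add: ideal_iff)

lemma quot_simps: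
  assumes "submod I" "I \<subseteq> A" "a \<in> A" "b \<in> A"
  shows "(I +> a) \<otimes>\<^bsub>RA Quot I\<^esub> (I +> b) = I +> (a \<otimes> b)"
    "(I +> a) \<oplus>\<^bsub>RA Quot I\<^esub> (I +> b) = I +> (a \<oplus> b)"
    "\<one>\<^bsub>RA Quot I\<^esub> = I +> \<one>" "\<zero>\<^bsub>RA Quot I\<^esub> = I"
proof -
  interpret h: ring_hom_ring RA "RA Quot I" "\<lambda>a. I +> a" using assms quot_hom by blast
  show "(I +> a) \<otimes>\<^bsub>RA Quot I\<^esub> (I +> b) = I +> (a \<otimes> b)" using h.hom_mult[of a b] assms by simp
  show "(I +> a) \<oplus>\<^bsub>RA Quot I\<^esub> (I +> b) = I +> (a \<oplus> b)" using h.hom_add[of a b] assms by simp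
  show "\<one>\<^bsub>RA Quot I\<^esub> = I +> \<one>" using h.hom_one by simp
  show "\<zero>\<^bsub>RA Quot I\<^esub> = I" by (simp add: FactRing_def)
qed

lemma coset_zero: "submod Y \<Longrightarrow> Y +> \<zero> = Y"
  using submod_carr[of Y] by (force simp: a_r_coset_def')

lemma primeideal_iff: "primeideal p RA \<longleftrightarrow> prime_ideal p"
proof
  assume "primeideal p RA"
  then interpret p: primeideal p RA .
  have i: "submod p" "p \<subseteq> A" using p.is_ideal by (auto simp: ideal_iff)
  have "\<one> \<notin> p" using p.I_notcarr one_imp_A[OF i] by auto
  then show "prime_ideal p" using i p.I_prime by (auto simp: prime_ideal_def)
next
  assume p: "prime_ideal p"
  show "primeideal p RA"
    by (rule primeidealI) (use p cring_RA A_closed(2) in \<open>auto simp: prime_ideal_def ideal_iff simp del: A_closed\<close>)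
qed

lemma prime_ideal_preimage:
  assumes I: "submod I" "I \<subseteq> A" and q: "primeideal q (RA Quot I)"
  shows "prime_ideal {a \<in> A. I +> a \<in> q} \<and> I \<subseteq> {a \<in> A. I +> a \<in> q}"
proof -
  interpret q: primeideal q "RA Quot I" by (rule q)
  interpret h: ring_hom_ring RA "RA Quot I" "\<lambda>a. I +> a" by (rule quot_hom[OF I])
  have "ideal {a \<in> carrier RA. I +> a \<in> q} RA" by (rule h.ideal_vimage[OF q.is_ideal])
  then have sm: "submod {a \<in> A. I +> a \<in> q}" by (simp add: ideal_iff)
  have "\<one> \<notin> {a \<in> A. I +> a \<in> q}"
    using q.I_notcarr q.one_imp_carrier quot_simps(3)[OF I A_closed(2) A_closed(2)] by auto
  moreover have "a \<in> {a \<in> A. I +> a \<in> q} \<or> b \<in> {a \<in> A. I +> a \<in> q}"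
    if "a \<in> A" "b \<in> A" "a \<otimes> b \<in> {a \<in> A. I +> a \<in> q}" for a b
    using that q.I_prime[of "I +> a" "I +> b"] quot_simps(1)[OF I] by (auto simp: quot_carrier)
  moreover have "I \<subseteq> {a \<in> A. I +> a \<in> q}"
  proof
    fix a assume a: "a \<in> I"
    have ac: "a \<in> carrier R" using a submod_carr[OF I(1)] by blast
    have "I +> a = I +> \<zero>" using a ac coset_eq_iff[OF I(1) ac, of \<zero>] by (simp add: a_minus_def)
    then have "I +> a = I" using coset_zero[OF I(1)] by simp
    moreover have "I \<in> q" using additive_subgroup.zero_closed[OF q.is_additive_subgroup] quot_simps(4)[OF I A_closed(2) A_closed(2)] by simp
    ultimately show "a \<in> {a \<in> A. I +> a \<in> q}" using a I by auto
  qed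
  ultimately show ?thesis using sm unfolding prime_ideal_def by blast
qed

lemma primeideal_image:
  assumes I: "submod I" "I \<subseteq> A" and p: "prime_ideal p" "I \<subseteq> p"
  shows "primeideal ((\<lambda>a. I +> a) ` p) (RA Quot I)"
proof -
  interpret RA: cring RA by (rule cring_RA)
  have sp: "submod p" "p \<subseteq> A" and pr: "\<And>a b. a \<in> A \<Longrightarrow> b \<in> A \<Longrightarrow> a \<otimes> b \<in> p \<Longrightarrow> a \<in> p \<or> b \<in> p"
    using p by (auto simp: prime_ideal_def)
  note mem = coset_mem_image_iff[OF I(1) sp(1) p(2)]
  show ?thesis
  proof (rule primeidealI)
    show "ideal ((\<lambda>a. I +> a) ` p) (RA Quot I)"
      using RA.ring_ideal_imp_quot_ideal[of I p] I sp by (simp add: ideal_iff RA_coset image_def)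
    show "cring (RA Quot I)" by (rule quot_cring[OF I])
    have "I +> \<one> \<notin> (\<lambda>a. I +> a) ` p" using mem[of \<one>] p by (auto simp: prime_ideal_def)
    moreover have "I +> \<one> \<in> carrier (RA Quot I)" by (auto simp: quot_carrier)
    ultimately show "carrier (RA Quot I) \<noteq> (\<lambda>a. I +> a) ` p" by metis
    fix s t assume st: "s \<in> carrier (RA Quot I)" "t \<in> carrier (RA Quot I)" "s \<otimes>\<^bsub>RA Quot I\<^esub> t \<in> (\<lambda>a. I +> a) ` p"
    then obtain a b where ab: "a \<in> A" "b \<in> A" "s = I +> a" "t = I +> b" by (auto simp: quot_carrier)
    have "a \<otimes> b \<in> p" using st(3) ab quot_simps(1)[OF I ab(1,2)] mem[of "a \<otimes> b"] A_carr by simp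
    then show "s \<in> (\<lambda>a. I +> a) ` p \<or> t \<in> (\<lambda>a. I +> a) ` p" using pr ab by blast
  qed
qed

text \<open>Preimages and images of primes match chains in A/I with chains above \<open>I\<close>,
  strictness included. For \<open>I = A\<close> both sides are the supremum of the empty
  set.\<close>

lemma Kdim_quot:
  assumes I: "submod I" "I \<subseteq> A"
  shows "Kdim (RA Quot I) = (SUP n \<in> {n. prime_chain n I}. ereal (real n))"
proof -
  have "(\<exists>q. (\<forall>i\<le>n. primeideal (q i) (RA Quot I)) \<and> (\<forall>i<n. q i \<subset> q (Suc i))) \<longleftrightarrow> prime_chain n I" for n
  proof
    assume "\<exists>q. (\<forall>i\<le>n. primeideal (q i) (RA Quot I)) \<and> (\<forall>i<n. q i \<subset> q (Suc i))"
    then obtain q where q: "\<And>i. i \<le> n \<Longrightarrow> primeideal (q i) (RA Quot I)" "\<And>i. i < n \<Longrightarrow> q i \<subset> q (Suc i)" by blast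
    let ?p = "\<lambda>i. {a \<in> A. I +> a \<in> q i}"
    have "?p i \<subset> ?p (Suc i)" if i: "i < n" for i
    proof -
      obtain c where c: "c \<in> q (Suc i)" "c \<notin> q i" using q(2)[OF i] by blast
      have "q (Suc i) \<subseteq> carrier (RA Quot I)"
        using additive_subgroup.a_subset[OF ideal.axioms(1)[OF primeideal.axioms(1)[OF q(1)[of "Suc i"]]]] i
        by simp
      then obtain a where "a \<in> A" "c = I +> a" using c(1) by (auto simp: quot_carrier)
      then show ?thesis using c q(2)[OF i] by blast
    qed
    then show "prime_chain n I" unfolding prime_chain_def using prime_ideal_preimage[OF I q(1)]
      by (intro exI[of _ ?p]) simp
  next
    assume "prime_chain n I"
    then obtain p where p: "\<And>i. i \<le> n \<Longrightarrow> prime_ideal (p i) \<and> I \<subseteq> p i" "\<And>i. i < n \<Longrightarrow> p i \<subset> p (Suc i)"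
      unfolding prime_chain_def by blast
    let ?q = "\<lambda>i. (\<lambda>a. I +> a) ` p i"
    have "?q i \<subset> ?q (Suc i)" if i: "i < n" for i
    proof -
      obtain a where a: "a \<in> p (Suc i)" "a \<notin> p i" using p(2)[OF i] by blast
      have "submod (p i)" "I \<subseteq> p i" "a \<in> carrier R"
        using p(1)[of i] p(1)[of "Suc i"] i a submod_carr by (auto simp: prime_ideal_def)
      then have "I +> a \<notin> ?q i" using coset_mem_image_iff[OF I(1), of "p i" a] a by simp
      then show ?thesis using a p(2)[OF i] by blast
    qed
    then show "\<exists>q. (\<forall>i\<le>n. primeideal (q i) (RA Quot I)) \<and> (\<forall>i<n. q i \<subset> q (Suc i))"
      using primeideal_image[OF I] p(1) by (intro exI[of _ ?q]) simp
  qed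
  then show ?thesis unfolding Kdim_def by simp
qed

lemma Kdim_RA: "Kdim RA = (SUP n \<in> {n. prime_chain n {\<zero>}}. ereal (real n))"
proof -
  have zp: "prime_ideal p \<longleftrightarrow> prime_ideal p \<and> {\<zero>} \<subseteq> p" for p
    using submod_zero by (auto simp: prime_ideal_def)
  have "{n. \<exists>p. (\<forall>i\<le>n. primeideal (p i) RA) \<and> (\<forall>i<n. p i \<subset> p (Suc i))} = {n. prime_chain n {\<zero>}}"
    unfolding prime_chain_def primeideal_iff zp[symmetric] ..
  then show ?thesis unfolding Kdim_def by simp
qed

subsection \<open>Dimension over a coefficient field\<close>

text \<open>\<open>rcoset_mult\<close> unites the cosets \<open>Y +> (a' \<otimes> x')\<close> over
  all representatives. With a' = h + a and x' = y + x the difference a'x' - ax is hy + hx + ay,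
  which lies in \<open>Y\<close> because \<open>Y\<close> is a submodule and
  \<open>n \<cdot> X \<subseteq> Y\<close>.\<close>

lemma coset_smult:
  assumes n: "submod n" "n \<subseteq> A" and Y: "submod Y" and X: "submod X" and nX: "n \<cdot> X \<subseteq> Y"
    and a: "a \<in> A" and x: "x \<in> X"
    and YX: "Y \<subseteq> X"
  shows "rcoset_mult R Y (n +> a) (Y +> x) = Y +> (a \<otimes> x)"
proof -
  have c: "a \<in> carrier R" "x \<in> carrier R" using a x A_carr submod_carr[OF X] by auto
  have "Y +> (a' \<otimes> x') = Y +> (a \<otimes> x)" if ax: "a' \<in> n +> a" "x' \<in> Y +> x" for a' x'
  proof -
    obtain h y where hy: "h \<in> n" "a' = h \<oplus> a" "y \<in> Y" "x' = y \<oplus> x" using ax by (auto simp: mem_coset)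
    have cc: "h \<in> carrier R" "y \<in> carrier R" using hy n Y submod_carr by auto
    have "a' \<otimes> x' = h \<otimes> y \<oplus> (h \<otimes> x \<oplus> a \<otimes> y) \<oplus> a \<otimes> x"
      using hy c cc by (simp add: l_distr r_distr a_ac)
    then have "a' \<otimes> x' \<ominus> a \<otimes> x = h \<otimes> y \<oplus> (h \<otimes> x \<oplus> a \<otimes> y)"
      using c cc by (simp add: a_minus_def a_assoc r_neg)
    moreover have "h \<otimes> y \<in> Y" "h \<otimes> x \<in> Y" "a \<otimes> y \<in> Y"
      using hy n a x nX submod_smult[OF Y] ideal_prod.prod[of h n x X R] by auto
    ultimately have "a' \<otimes> x' \<ominus> a \<otimes> x \<in> Y" using submod_add[OF Y] by simp
    then show ?thesis using coset_eq_iff[OF Y] c cc hy by simp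
  qed
  moreover have "a \<in> n +> a" "x \<in> Y +> x" using coset_self n Y c by blast+
  ultimately show ?thesis unfolding rcoset_mult_def by blast
qed

text \<open>A strict chain of maximal length has simple factors. These are killed by \<open>m\<close>, as its elements are
  nilpotent modulo \<open>n\<close>, so each is spanned over \<open>K\<close> by a single vector.\<close>

lemma dim_quotient_module:
  assumes n: "submod n" "n \<subseteq> A" and Y: "submod Y" and X: "submod X" and YX: "Y \<subseteq> X" and nX: "n \<cdot> X \<subseteq> Y"
    and K: "subfield K (RA Quot n)"
    and m: "submod m" "m \<subseteq> A" "\<And>\<mu>. \<mu> \<in> m \<Longrightarrow> \<exists>k::nat. \<mu> [^] k \<in> n"
    and Km: "\<And>a. a \<in> A \<Longrightarrow> \<exists>b\<in>A. n +> b \<in> K \<and> a \<ominus> b \<in> m"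
    and len: "len Y X = enat t"
  shows "vectorspace.dim ((RA Quot n)\<lparr>carrier := K\<rparr>) (quotient_module R X Y) = t"
proof -
  let ?Q = "RA Quot n" and ?F = "(RA Quot n)\<lparr>carrier := K\<rparr>" and ?V = "quotient_module R X Y"
  interpret Q: cring ?Q by (rule quot_cring[OF n])
  interpret F: field ?F using Q.subfield_iff(2)[OF K] .
  have KQ: "\<exists>a\<in>A. c = n +> a" if "c \<in> K" for c
    using that subringE(1)[OF subfieldE(1)[OF K]] quot_carrier by blast
  note sm = coset_smult[OF n Y X nX _ _ YX]
  note cX = submod_carr[OF X]
  have Vs: "carrier ?V = (\<lambda>x. Y +> x) ` X" "\<zero>\<^bsub>?V\<^esub> = Y" "add ?V = set_add R" "module.smult ?V = rcoset_mult R Y"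
    by (simp_all add: quotient_module_def)
  have Vabel: "abelian_group ?V"
  proof (rule abelian_groupI, goal_cases)
    case (1 x y) then show ?case using coset_add[OF Y] cX submod_add[OF X] by (auto simp: Vs)
  next
    case 2 then show ?case using coset_zero[OF Y] submod_zero[OF X] by (auto simp: Vs)
  next
    case (3 x y z) then show ?case using coset_add[OF Y] cX by (auto simp: Vs a_assoc)
  next
    case (4 x y) then show ?case using coset_add[OF Y] cX by (auto simp: Vs a_comm)
  next
    case (5 x)
    then obtain s where "s \<in> X" "x = Y +> s" by (auto simp: Vs)
    then show ?case using coset_add[OF Y, of \<zero> s] cX coset_zero[OF Y] by (simp add: Vs)
  next
    case (6 x)
    then obtain s where s: "s \<in> X" "x = Y +> s" by (auto simp: Vs)
    then have "(Y +> (\<ominus> s)) <+> x = Y"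
      using coset_add[OF Y, of "\<ominus> s" s] cX coset_zero[OF Y] by (simp add: l_neg)
    then show ?case using s submod_neg[OF X] by (auto simp: Vs)
  qed
  have "module ?F ?V"
  proof (rule moduleI[OF F.is_cring Vabel], goal_cases)
    case (1 c v) then show ?case using KQ[of c] sm submod_smult[OF X] by (auto simp: Vs)
  next
    case (2 c d v)
    then obtain a b x where "a \<in> A" "b \<in> A" "x \<in> X" "c = n +> a" "d = n +> b" "v = Y +> x"
      using KQ[of c] KQ[of d] by (auto simp: Vs)
    then show ?case using sm quot_simps(2)[OF n] coset_add[OF Y] cX A_carr by (simp add: Vs l_distr)
  next
    case (3 c v w)
    then obtain a x y where "a \<in> A" "x \<in> X" "y \<in> X" "c = n +> a" "v = Y +> x" "w = Y +> y"
      using KQ[of c] by (auto simp: Vs)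
    then show ?case using sm coset_add[OF Y] cX A_carr submod_add[OF X] by (simp add: Vs r_distr)
  next
    case (4 c d v)
    then obtain a b x where "a \<in> A" "b \<in> A" "x \<in> X" "c = n +> a" "d = n +> b" "v = Y +> x"
      using KQ[of c] KQ[of d] by (auto simp: Vs)
    then show ?case using sm quot_simps(1)[OF n] cX A_carr submod_smult[OF X] by (simp add: Vs m_assoc)
  next
    case (5 v)
    then show ?case using sm[OF A_closed(2)] quot_simps(3)[OF n A_closed(2) A_closed(2)] cX by (auto simp: Vs)
  qed
  then interpret V: vectorspace ?F ?V by (intro vectorspace.intro F.field_axioms)
  have subsp: "submodule ?F ((\<lambda>s. Y +> s) ` S) ?V" if S: "submod S" "S \<subseteq> X" for S
  proof (rule submodule.intro[OF V.module_axioms], goal_cases)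
    case 1 then show ?case using S by (auto simp: Vs)
  next
    case (2 v w) then show ?case using coset_add[OF Y] submod_carr[OF S(1)] submod_add[OF S(1)] by (auto simp: Vs)
  next
    case 3 then show ?case using coset_zero[OF Y] submod_zero[OF S(1)] by (auto simp: Vs)
  next
    case (4 c v)
    then obtain a s where "a \<in> A" "c = n +> a" "s \<in> S" "v = Y +> s" using KQ[of c] by auto
    then show ?case using sm S submod_smult[OF S(1)] by (auto simp: Vs)
  qed
  have main: "\<exists>B. finite B \<and> B \<subseteq> carrier ?V \<and> card B = t \<and> V.lin_indpt B \<and> V.span B = (\<lambda>s. Y +> s) ` Z"
    if "submod Z" "Y \<subseteq> Z" "Z \<subseteq> X" "len Y Z = enat t" for Z t
    using that
  proof (induction t arbitrary: Z)
    case 0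
    have "Z = Y" using 0 len_ge_1[OF Y, of Z] by (cases "Z = Y") (auto simp: zero_enat_def[symmetric])
    then have "(\<lambda>s. Y +> s) ` Z = {Y}"
      using coset_eq_iff[OF Y, of _ \<zero>] coset_zero[OF Y] submod_carr[OF Y] submod_zero[OF Y]
      by (auto simp: a_minus_def image_iff)
    moreover have "V.lin_indpt {}" by (simp add: V.lin_dep_def)
    moreover have "V.span {} = {Y}" by (simp add: V.span_empty Vs)
    ultimately show ?case by (intro exI[of _ "{}"]) auto
  next
    case (Suc t)
    note smZ = Suc.prems(1)
    obtain f where f: "submod_chain (Suc t) f" "Y \<subseteq> f 0" "f (Suc t) \<subseteq> Z"
      using len_geD[of "Suc t" Y Z] Suc.prems Y by auto
    \<comment> \<open>The last but one member of a longest chain: additivity of length leaves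
      \<open>t\<close> below it and 1 above it, so Z modulo \<open>?Z\<close> is simple.\<close>
    let ?Z = "f t"
    have Z': "submod ?Z" "?Z \<subset> Z" "Y \<subseteq> ?Z"
      using f submod_chain_mono[OF f(1), of 0 t] unfolding submod_chain_def by (auto; blast)+
    have "enat t \<le> len Y ?Z" by (rule len_geI[of _ f]) (use f submod_chain_le in auto)
    moreover have "1 \<le> len ?Z Z" by (rule len_ge_1[OF Z'(1) smZ Z'(2)])
    moreover have sum: "len Y Z = len Y ?Z + len ?Z Z" using Z' Y smZ by (intro len_add) auto
    ultimately have l: "len Y ?Z = enat t" "len ?Z Z = enat 1"
      using Suc.prems(4) by (cases "len Y ?Z"; cases "len ?Z Z"; simp add: one_enat_def)+
    have max: "S = Z" if "submod S" "?Z \<subset> S" "S \<subseteq> Z" for S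
    proof (rule ccontr)
      assume "S \<noteq> Z"
      then have "1 \<le> len ?Z S" "1 \<le> len S Z" using that Z' smZ by (auto intro!: len_ge_1)
      then have "1 + 1 \<le> len ?Z S + len S Z" by (rule add_mono)
      also have "\<dots> = len ?Z Z" using that Z' smZ by (intro len_add[symmetric]) auto
      finally show False using l(2) by (simp add: one_enat_def)
    qed
    obtain v where v: "v \<in> Z" "v \<notin> ?Z" using Z' by blast
    have vX: "v \<in> X" and vc: "v \<in> carrier R" using v Suc.prems(3) cX by blast+
    have mv: "\<mu> \<otimes> v \<in> ?Z" if \<mu>: "\<mu> \<in> m" for \<mu>
    proof (rule ccontr)
      assume nz: "\<mu> \<otimes> v \<notin> ?Z"
      have \<mu>A: "\<mu> \<in> A" using \<mu> m by blast
      have mc: "\<mu> \<otimes> v \<in> carrier R" using \<mu>A A_carr vc by blast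
      let ?S = "?Z <+> cyc (\<mu> \<otimes> v)"
      have "?S = Z"
      proof (rule max)
        show "submod ?S" by (intro submod_set_add Z' submod_cyc mc)
        show "?Z \<subset> ?S" using nz set_add_left[OF Z'(1) submod_cyc[OF mc]] set_add_right[OF Z'(1) submod_cyc[OF mc]]
            cyc_self[OF mc] by blast
        show "?S \<subseteq> Z" using Z' smZ v \<mu>A by (intro set_add_least cyc_least submod_smult) auto
      qed
      then obtain w a where wa: "w \<in> ?Z" "a \<in> A" "v = w \<oplus> a \<otimes> (\<mu> \<otimes> v)"
        using v(1) by (auto simp: mem_set_add cyc_def)
      \<comment> \<open>By simplicity v is congruent to \<nu> v modulo \<open>?Z\<close>, hence to
        \<nu>^k v for every k. Once \<nu>^k lies in \<open>n\<close>, this is in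
        \<open>n \<cdot> X \<subseteq> Y\<close>, so v would be in \<open>?Z\<close>.\<close>
      let ?\<nu> = "a \<otimes> \<mu>"
      have \<nu>: "?\<nu> \<in> m" "?\<nu> \<in> A" using wa \<mu> m submod_smult by auto
      note nc = A_carr[OF \<nu>(2)]
      have wc: "w \<in> carrier R" using wa Z' submod_carr by blast
      have w: "v = w \<oplus> ?\<nu> \<otimes> v" using wa A_carr \<mu>A vc by (simp add: m_assoc)
      have "v \<in> ?Z" if "?\<nu> [^] (k::nat) \<otimes> v \<in> ?Z" for k
        using that
      proof (induction k)
        case 0 then show ?case using vc by simp
      next
        case (Suc k)
        have kA: "?\<nu> [^] k \<in> A" using \<nu> by simp
        have "?\<nu> [^] k \<otimes> v = ?\<nu> [^] k \<otimes> w \<oplus> ?\<nu> [^] Suc k \<otimes> v"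
          using arg_cong[OF w, of "\<lambda>z. ?\<nu> [^] k \<otimes> z"] wc vc nc by (simp add: r_distr m_assoc)
        then have "?\<nu> [^] k \<otimes> v \<in> ?Z"
          using Suc.prems submod_add[OF Z'(1) submod_smult[OF Z'(1) kA wa(1)]] by simp
        then show ?case by (rule Suc.IH)
      qed
      moreover obtain k :: nat where "?\<nu> [^] k \<in> n" using m(3)[OF \<nu>(1)] by blast
      then have "?\<nu> [^] k \<otimes> v \<in> ?Z" using ideal_prod.prod[of _ n v X R] vX nX Z'(3) by blast
      ultimately show False using v by blast
    qed
    obtain B where B: "finite B" "B \<subseteq> carrier ?V" "card B = t" "V.lin_indpt B" "V.span B = (\<lambda>s. Y +> s) ` ?Z"
      using Suc.IH[OF Z'(1,3) _ l(1)] Z'(2) Suc.prems(3) by blast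
    let ?v = "Y +> v"
    have vV: "?v \<in> carrier ?V" using vX by (auto simp: Vs)
    have nsp: "?v \<notin> V.span B" unfolding B(5) using coset_mem_image_iff[OF Y Z'(1,3) vc] v by simp
    have vB: "?v \<notin> B" using nsp V.in_own_span[OF B(2)] by blast
    have li: "V.lin_indpt (insert ?v B)"
      using V.lin_dep_iff_in_span[OF B(2,4) vV vB] nsp by simp
    have inC: "insert ?v B \<subseteq> carrier ?V" using B vV by blast
    have own: "V.span B \<subseteq> V.span (insert ?v B)" "?v \<in> V.span (insert ?v B)"
      using V.span_is_monotone[of B "insert ?v B"] V.in_own_span[OF inC] by blast+
    have sps: "submodule ?F (V.span (insert ?v B)) ?V" by (rule V.span_is_submodule[OF inC])
    have "V.span (insert ?v B) = (\<lambda>s. Y +> s) ` Z"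
    proof
      show "V.span (insert ?v B) \<subseteq> (\<lambda>s. Y +> s) ` Z"
      proof (rule V.span_is_subset[OF _ subsp[OF smZ Suc.prems(3)]])
        have "B \<subseteq> (\<lambda>s. Y +> s) ` ?Z" using V.in_own_span[OF B(2)] B(5) by simp
        then show "insert ?v B \<subseteq> (\<lambda>s. Y +> s) ` Z" using v Z'(2) by blast
      qed
      show "(\<lambda>s. Y +> s) ` Z \<subseteq> V.span (insert ?v B)"
      proof
        fix y assume "y \<in> (\<lambda>s. Y +> s) ` Z"
        then obtain z where z: "z \<in> Z" "y = Y +> z" by blast
        have "?Z <+> cyc v = Z"
        proof (rule max)
          show "submod (?Z <+> cyc v)" by (intro submod_set_add Z' submod_cyc vc)
          show "?Z \<subset> ?Z <+> cyc v" using v set_add_left[OF Z'(1) submod_cyc[OF vc]] set_add_right[OF Z'(1) submod_cyc[OF vc]]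
              cyc_self[OF vc] by blast
          show "?Z <+> cyc v \<subseteq> Z" using Z' smZ v by (intro set_add_least cyc_least) auto
        qed
        then obtain w a where wa: "w \<in> ?Z" "a \<in> A" "z = w \<oplus> a \<otimes> v"
          using z(1) by (auto simp: mem_set_add cyc_def)
        \<comment> \<open>The scalar from \<open>A\<close> is traded for a representative of an
          element of \<open>K\<close>; the error \<open>a \<ominus> b\<close> lies in
          \<open>m\<close> and kills \<open>v\<close> modulo \<open>?Z\<close>.\<close>
        obtain b where b: "b \<in> A" "n +> b \<in> K" "a \<ominus> b \<in> m" using Km[OF wa(2)] by blast
        note cc = A_carr[OF wa(2)] A_carr[OF b(1)] submod_carr[OF Z'(1) wa(1)] vc
        let ?w = "w \<oplus> (a \<ominus> b) \<otimes> v"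
        have w': "?w \<in> ?Z" using submod_add[OF Z'(1) wa(1) mv[OF b(3)]] .
        have "a \<otimes> v = (a \<ominus> b) \<otimes> v \<oplus> b \<otimes> v"
          using cc by (simp add: a_minus_def l_distr l_minus a_assoc l_neg)
        then have "z = ?w \<oplus> b \<otimes> v" using wa(3) cc by (simp add: a_assoc)
        then have "y = (Y +> ?w) \<oplus>\<^bsub>?V\<^esub> ((n +> b) \<odot>\<^bsub>?V\<^esub> ?v)"
          using z(2) sm[OF b(1) vX] coset_add[OF Y] cc by (simp add: Vs)
        moreover have "Y +> ?w \<in> V.span (insert ?v B)" using w' B(5) own by blast
        ultimately show "y \<in> V.span (insert ?v B)"
          using submodule.m_closed[OF sps] submodule.smult_closed[OF sps] own(2) b(2) by simp
      qed
    qed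
    then show ?case using B vB li inC by (intro exI[of _ "insert ?v B"]) simp
  qed
  obtain B where "finite B" "B \<subseteq> carrier ?V" "card B = t" "V.lin_indpt B" "V.span B = carrier ?V"
    using main[OF X YX order_refl len] by (auto simp: Vs)
  then show ?thesis using V.dim_basis[of B] by (simp add: V.basis_def)
qed

section \<open>Local rings, radicals and coefficient fields\<close>

lemma acc_subset: "acc M \<Longrightarrow> M' \<subseteq> M \<Longrightarrow> acc M'"
  unfolding acc_def by (meson subset_trans)

lemma maximalidealD:
  assumes "maximalideal m RA"
  shows "submod m" "m \<subseteq> A" "\<one> \<notin> m"
    "\<And>X. submod X \<Longrightarrow> m \<subseteq> X \<Longrightarrow> X \<subseteq> A \<Longrightarrow> X = m \<or> X = A"
proof -
  interpret m: maximalideal m RA by (rule assms)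
  show m: "submod m" "m \<subseteq> A" using m.is_ideal by (auto simp: ideal_iff)
  show "\<one> \<notin> m" using m.I_notcarr one_imp_A[OF m] by auto
  show "X = m \<or> X = A" if "submod X" "m \<subseteq> X" "X \<subseteq> A" for X
    using m.I_maximal[of X] that by (simp add: ideal_iff)
qed

text \<open>By Noetherian induction a proper ideal lies in one that cannot be enlarged, which is
  maximal; locality makes it \<open>m\<close>.\<close>

lemma local_proper_subset:
  assumes A: "acc A" and m: "local_cring RA m" and I: "submod I" "I \<subseteq> A" "\<one> \<notin> I"
  shows "I \<subseteq> m"
proof -
  have "\<one> \<notin> I \<longrightarrow> I \<subseteq> m"
    using A I(1,2)
  proof (induction I rule: acc_induct)
    case (less I)
    show ?case
    proof
      assume I1: "\<one> \<notin> I"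
      show "I \<subseteq> m"
      proof (cases "\<exists>J. submod J \<and> J \<subseteq> A \<and> I \<subset> J \<and> \<one> \<notin> J")
        case True
        then show ?thesis using less.IH by blast
      next
        case False
        have "maximalideal I RA"
        proof (rule maximalidealI)
          show "ideal I RA" using less.hyps by (simp add: ideal_iff)
          show "carrier RA \<noteq> I" using I1 A_closed(2) by auto
          show "J = I \<or> J = carrier RA" if "ideal J RA" "I \<subseteq> J" "J \<subseteq> carrier RA" for J
            using that False one_imp_A[of J] by (auto simp: ideal_iff)
        qed
        then show ?thesis using m by (auto simp: local_cring_def)
      qed
    qed
  qed
  then show ?thesis using I by blast
qed

lemma pow_RA: "a [^]\<^bsub>RA\<^esub> (k::nat) = a [^] k"
  by (induction k) auto

lemma prime_ideal_pow: "prime_ideal p \<Longrightarrow> a \<in> A \<Longrightarrow> a [^] (k::nat) \<in> p \<Longrightarrow> a \<in> p"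
proof (induction k)
  case (Suc k)
  then have "a [^] k \<in> p \<or> a \<in> p" using A_pow[of a k] unfolding prime_ideal_def by auto
  then show ?case using Suc by blast
qed (auto simp: prime_ideal_def)

text \<open>A prime containing a power of an element contains the element, so \<open>p\<close>
  contains the radical of \<open>n\<close>, which is already maximal.\<close>

lemma prime_over_primary:
  assumes m: "maximalideal m RA" and n: "radical_of RA n = m" and p: "prime_ideal p" "n \<subseteq> p"
  shows "p = m"
proof -
  have "m \<subseteq> p"
  proof
    fix a assume "a \<in> m"
    then obtain k :: nat where "a \<in> A" "a [^] k \<in> n" using n by (auto simp: radical_of_def pow_RA)
    then show "a \<in> p" using prime_ideal_pow[OF p(1)] p(2) by blast
  qed
  moreover have "p \<noteq> A" "submod p" "p \<subseteq> A" using p(1) A_closed(2) by (auto simp: prime_ideal_def)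
  ultimately show ?thesis using maximalidealD(4)[OF m] by blast
qed

text \<open>\<open>coefficient_field\<close> refers to the maximal ideal of A/n. Its preimage in
  \<open>A\<close> is a prime above \<open>n\<close>, hence equal to \<open>m\<close>, so
  \<open>K\<close> also represents the residue classes modulo \<open>m\<close>.\<close>

lemma coefficient_representative:
  assumes m: "maximalideal m RA" and n: "radical_of RA n = m" "submod n" "n \<subseteq> A" "n \<subseteq> m"
    and K: "coefficient_field (RA Quot n) K" and a: "a \<in> A"
  shows "\<exists>b\<in>A. n +> b \<in> K \<and> a \<ominus> b \<in> m"
proof -
  let ?Q = "RA Quot n"
  interpret Q: cring ?Q by (rule quot_cring[OF n(2,3)])
  obtain m' where m': "local_cring ?Q m'"
    and bij: "bij_betw (\<lambda>c. m' +>\<^bsub>?Q\<^esub> c) K (carrier (?Q Quot m'))" and Ks: "subfield K ?Q"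
    using K by (auto simp: coefficient_field_def)
  then have "maximalideal m' ?Q" by (simp add: local_cring_def)
  then have pm': "primeideal m' ?Q" by (rule Q.maximalideal_prime)
  then interpret m': ideal m' ?Q by (rule primeideal.axioms(1))
  have pre: "{z \<in> A. n +> z \<in> m'} = m"
    using prime_ideal_preimage[OF n(2,3) pm'] prime_over_primary[OF m n(1)] by blast
  let ?c = "n +> a"
  have c: "?c \<in> carrier ?Q" using a by (auto simp: quot_carrier)
  then have "m' +>\<^bsub>?Q\<^esub> ?c \<in> carrier (?Q Quot m')" by (auto simp: FactRing_def A_RCOSETS_def')
  then obtain \<kappa> where \<kappa>: "\<kappa> \<in> K" "m' +>\<^bsub>?Q\<^esub> ?c = m' +>\<^bsub>?Q\<^esub> \<kappa>"
    using bij by (auto simp: bij_betw_def image_iff)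
  have "\<kappa> \<in> carrier ?Q" using \<kappa>(1) subringE(1)[OF subfieldE(1)[OF Ks]] by blast
  then obtain b where b: "b \<in> A" "\<kappa> = n +> b" by (auto simp: quot_carrier)
  have "?c \<in> m' +>\<^bsub>?Q\<^esub> \<kappa>" unfolding \<kappa>(2)[symmetric] by (rule m'.a_rcos_self[OF c])
  then obtain \<zeta> where \<zeta>: "\<zeta> \<in> m'" "?c = \<zeta> \<oplus>\<^bsub>?Q\<^esub> \<kappa>" by (auto simp: a_r_coset_def')
  have "\<zeta> \<in> carrier ?Q" using \<zeta>(1) m'.a_subset by blast
  then obtain z where z: "z \<in> A" "\<zeta> = n +> z" by (auto simp: quot_carrier)
  have zm: "z \<in> m" using pre z \<zeta>(1) by blast
  have "n +> a = n +> (z \<oplus> b)" using \<zeta>(2) z b quot_simps(2)[OF n(2,3) z(1) b(1)] by simp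
  then have "a \<ominus> (z \<oplus> b) \<in> m" using coset_eq_iff[OF n(2), of a "z \<oplus> b"] A_carr a b z n(4) by auto
  moreover note cr = A_carr[OF a] A_carr[OF b(1)] A_carr[OF z(1)]
  have "\<ominus> (z \<oplus> b) \<oplus> z = \<ominus> b"
    using cr by (simp add: minus_add a_comm[of "\<ominus> z" "\<ominus> b"] a_assoc l_neg)
  then have "a \<ominus> b = (a \<ominus> (z \<oplus> b)) \<oplus> z" using cr by (simp add: a_minus_def a_assoc)
  ultimately have "a \<ominus> b \<in> m" using submod_add[OF maximalidealD(1)[OF m] _ zm] by simp
  then show ?thesis using b \<kappa>(1) by blast
qed

end

section \<open>Super-rings\<close>

context super_ring
begin

sublocale commutative_subring R R0
  by (intro commutative_subring.intro commutative_subring_axioms.intro ring_axioms even_subring even_even_commute)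

lemma odd_even_commute: "r \<in> R1 \<Longrightarrow> b \<in> R0 \<Longrightarrow> r \<otimes> b = b \<otimes> r"
  using even_odd_commute[of b r] by simp

lemma submod_R1: "submod R1"
proof -
  interpret R1: additive_subgroup R1 R by (rule odd_subgroup)
  show ?thesis by (rule submodI) (use R1.a_subset R1.zero_closed R1.a_closed even_odd_closed in auto)
qed

lemma odd_carr: "x \<in> R1 \<Longrightarrow> x \<in> carrier R"
  using submod_carr[OF submod_R1] .

lemma parity_unique: "x \<in> R0 \<Longrightarrow> x \<in> R1 \<Longrightarrow> x = \<zero>"
  using grading_direct by blast

lemma sum_even_part:
  assumes P: "submod P" "P \<subseteq> R0" and Q: "submod Q" "Q \<subseteq> R1"
  shows "(P <+> Q) \<inter> R0 = P" "(P <+> Q) \<inter> R1 = Q"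
proof -
  show "(P <+> Q) \<inter> R0 = P"
  proof
    show "(P <+> Q) \<inter> R0 \<subseteq> P"
    proof
      fix x assume x: "x \<in> (P <+> Q) \<inter> R0"
      then obtain p q where pq: "p \<in> P" "q \<in> Q" "x = p \<oplus> q" by (auto simp: mem_set_add)
      have "q \<in> R0" using submod_add_cancel[OF submod_A, of p q] pq x P Q odd_carr by auto
      then have "q = \<zero>" using parity_unique pq Q by blast
      then show "x \<in> P" using pq submod_carr[OF P(1)] by simp
    qed
    show "P \<subseteq> (P <+> Q) \<inter> R0" using set_add_left[OF P(1) Q(1)] P by blast
  qed
  show "(P <+> Q) \<inter> R1 = Q"
  proof
    show "(P <+> Q) \<inter> R1 \<subseteq> Q"
    proof
      fix x assume x: "x \<in> (P <+> Q) \<inter> R1"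
      then obtain p q where pq: "p \<in> P" "q \<in> Q" "x = q \<oplus> p"
        using submod_carr[OF P(1)] submod_carr[OF Q(1)] a_comm by (auto simp: mem_set_add)
      have "p \<in> R1" using submod_add_cancel[OF submod_R1, of q p] pq x P Q A_carr by auto
      then have "p = \<zero>" using parity_unique pq P by blast
      then show "x \<in> Q" using pq submod_carr[OF Q(1)] by simp
    qed
    show "Q \<subseteq> (P <+> Q) \<inter> R1" using set_add_right[OF P(1) Q(1)] Q by blast
  qed
qed

text \<open>Stability under even scalars is part of \<open>submod\<close>, so only odd multipliers
  have to be checked; super-commutativity turns right multiplication into left multiplication up to
  sign.\<close>

lemma superideal_sum:
  assumes P: "submod P" "P \<subseteq> R0" and Q: "submod Q" "Q \<subseteq> R1"
    and PQ: "\<And>r p. r \<in> R1 \<Longrightarrow> p \<in> P \<Longrightarrow> r \<otimes> p \<in> Q" and QP: "\<And>r q. r \<in> R1 \<Longrightarrow> q \<in> Q \<Longrightarrow> r \<otimes> q \<in> P"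
  shows "superideal R R0 R1 (P <+> Q)"
proof -
  have S: "submod (P <+> Q)" by (rule submod_set_add[OF P(1) Q(1)])
  interpret S: abelian_subgroup "P <+> Q" R by (rule abelian_subgroup_submod[OF S])
  note cP = submod_carr[OF P(1)] and cQ = submod_carr[OF Q(1)]
  have "ideal (P <+> Q) R"
  proof (rule idealI)
    show "ring R" by (rule ring_axioms)
    show "subgroup (P <+> Q) (add_monoid R)" by (rule S.a_subgroup)
  next
    fix s x assume "s \<in> P <+> Q" "x \<in> carrier R"
    then obtain p q a r where *: "p \<in> P" "q \<in> Q" "s = p \<oplus> q" "a \<in> R0" "r \<in> R1" "x = a \<oplus> r"
      unfolding grading_sum[symmetric] by (auto simp: mem_set_add)
    note c = cP[OF *(1)] cQ[OF *(2)] A_carr[OF *(4)] odd_carr[OF *(5)]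
    have "x \<otimes> s = (a \<otimes> p \<oplus> r \<otimes> q) \<oplus> (a \<otimes> q \<oplus> r \<otimes> p)"
      using * c by (simp add: l_distr r_distr a_ac)
    moreover have "a \<otimes> p \<oplus> r \<otimes> q \<in> P" "a \<otimes> q \<oplus> r \<otimes> p \<in> Q"
      using * PQ QP submod_add[OF P(1)] submod_add[OF Q(1)] submod_smult[OF P(1)] submod_smult[OF Q(1)] by auto
    ultimately show "x \<otimes> s \<in> P <+> Q" using set_addI by metis
    have "p \<in> R0" "q \<in> R1" using * P Q by auto
    then have sw: "p \<otimes> a = a \<otimes> p" "p \<otimes> r = r \<otimes> p" "q \<otimes> a = a \<otimes> q" "q \<otimes> r = \<ominus> (r \<otimes> q)"
      using * even_even_commute[of p a] even_odd_commute[of p r] even_odd_commute[of a q]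
        odd_odd_anticommute[of q r] by simp_all
    have "s \<otimes> x = (p \<otimes> a \<oplus> q \<otimes> r) \<oplus> (q \<otimes> a \<oplus> p \<otimes> r)"
      unfolding *(3,6) using c by (simp add: l_distr r_distr a_ac)
    then have "s \<otimes> x = (a \<otimes> p \<oplus> \<ominus> (r \<otimes> q)) \<oplus> (a \<otimes> q \<oplus> r \<otimes> p)"
      by (simp only: sw)
    moreover have "a \<otimes> p \<oplus> \<ominus> (r \<otimes> q) \<in> P"
      using * QP submod_add[OF P(1)] submod_neg[OF P(1)] submod_smult[OF P(1)] by auto
    ultimately show "s \<otimes> x \<in> P <+> Q" using \<open>a \<otimes> q \<oplus> r \<otimes> p \<in> Q\<close> set_addI by metis
  qed
  then show ?thesis unfolding superideal_def using sum_even_part[OF P Q] by simp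
qed

text \<open>Reduces a claim about the finite sums in \<open>R1 \<cdot> P\<close> to single products:
  the preimage under left multiplication by the odd \<open>r\<close> is an
  \<open>R0\<close>-submodule.\<close>

lemma odd_prod_vimage:
  assumes X: "submod X" and r: "r \<in> R1" and s: "s \<in> R1 \<cdot> P" and P: "submod P"
    and *: "\<And>t p. t \<in> R1 \<Longrightarrow> p \<in> P \<Longrightarrow> (r \<otimes> t) \<otimes> p \<in> X"
  shows "r \<otimes> s \<in> X"
proof -
  have "R1 \<cdot> P \<subseteq> {t \<in> carrier R. r \<otimes> t \<in> X}"
  proof (rule prod_least)
    show "submod {t \<in> carrier R. r \<otimes> t \<in> X}"
      using X odd_carr[OF r] r odd_even_commute by (intro submod_commuting_vimage) auto
  qed (use * odd_carr r submod_carr[OF P] in \<open>auto simp: m_assoc\<close>)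
  then show ?thesis using s by blast
qed

lemma odd_prod_parity:
  "P \<subseteq> R0 \<Longrightarrow> R1 \<cdot> P \<subseteq> R1" "P \<subseteq> R1 \<Longrightarrow> R1 \<cdot> P \<subseteq> R0"
  by (rule prod_least; use submod_R1 submod_A odd_even_closed odd_odd_closed in blast)+

text \<open>An ideal I of R_0 is the even part of the superideal I + R_1 I, because R_1 R_1 I lies
  in I; likewise a submodule J of R_1 is the odd part of R_1 J + J. Chains of either kind thus lift
  to chains of superideals and are recovered from them.\<close>

lemma noetherian_acc:
  assumes noeth: "noetherian_super_ring R R0 R1"
  shows "acc R0" "acc R1"
proof -
  note noeth' = noeth[unfolded noetherian_super_ring_def, rule_format]
  show "acc R0"
    unfolding acc_def
  proof (intro allI impI)
    fix f :: "nat \<Rightarrow> 'a set" assume f: "\<forall>i. submod (f i) \<and> f i \<subseteq> R0 \<and> f i \<subseteq> f (Suc i)"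
    have sm: "submod (f i)" "f i \<subseteq> R0" "f i \<subseteq> f (Suc i)" "submod (R1 \<cdot> f i)" "R1 \<cdot> f i \<subseteq> R1" for i
      using f submod_prod[OF submod_R1] odd_prod_parity by auto
    have "superideal R R0 R1 (f i <+> (R1 \<cdot> f i))" for i
    proof (rule superideal_sum[OF sm(1,2,4,5)])
      show "r \<otimes> p \<in> R1 \<cdot> f i" if "r \<in> R1" "p \<in> f i" for r p using that by (rule ideal_prod.prod)
      show "r \<otimes> q \<in> f i" if "r \<in> R1" "q \<in> R1 \<cdot> f i" for r q
        using sm(1) that sm(1) by (rule odd_prod_vimage) (use that odd_odd_closed submod_smult[OF sm(1)] in auto)
    qed
    moreover have "f i <+> (R1 \<cdot> f i) \<subseteq> f (Suc i) <+> (R1 \<cdot> f (Suc i))" for i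
      using sm by (intro set_add_subset_mono prod_mono) auto
    ultimately obtain n where n: "\<And>i. i \<ge> n \<Longrightarrow> f i <+> (R1 \<cdot> f i) = f n <+> (R1 \<cdot> f n)"
      using noeth'[of "\<lambda>i. f i <+> (R1 \<cdot> f i)"] by blast
    then have "f i = f n" if "i \<ge> n" for i
      using sum_even_part(1)[OF sm(1,2,4,5)] that by metis
    then show "\<exists>n. \<forall>i\<ge>n. f i = f n" by blast
  qed
  show "acc R1"
    unfolding acc_def
  proof (intro allI impI)
    fix f :: "nat \<Rightarrow> 'a set" assume f: "\<forall>i. submod (f i) \<and> f i \<subseteq> R1 \<and> f i \<subseteq> f (Suc i)"
    have sm: "submod (f i)" "f i \<subseteq> R1" "f i \<subseteq> f (Suc i)" "submod (R1 \<cdot> f i)" "R1 \<cdot> f i \<subseteq> R0" for i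
      using f submod_prod[OF submod_R1] odd_prod_parity by auto
    have "superideal R R0 R1 ((R1 \<cdot> f i) <+> f i)" for i
    proof (rule superideal_sum[OF sm(4,5,1,2)])
      show "r \<otimes> p \<in> R1 \<cdot> f i" if "r \<in> R1" "p \<in> f i" for r p using that by (rule ideal_prod.prod)
      show "r \<otimes> q \<in> f i" if "r \<in> R1" "q \<in> R1 \<cdot> f i" for r q
        using sm(1) that sm(1) by (rule odd_prod_vimage) (use that odd_odd_closed submod_smult[OF sm(1)] in auto)
    qed
    moreover have "(R1 \<cdot> f i) <+> f i \<subseteq> (R1 \<cdot> f (Suc i)) <+> f (Suc i)" for i
      using sm by (intro set_add_subset_mono prod_mono) auto
    ultimately obtain n where n: "\<And>i. i \<ge> n \<Longrightarrow> (R1 \<cdot> f i) <+> f i = (R1 \<cdot> f n) <+> f n"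
      using noeth'[of "\<lambda>i. (R1 \<cdot> f i) <+> f i"] by blast
    then have "f i = f n" if "i \<ge> n" for i
      using sum_even_part(2)[OF sm(4,5,1,2)] that by metis
    then show "\<exists>n. \<forall>i\<ge>n. f i = f n" by blast
  qed
qed

subsection \<open>Powers of the odd part\<close>

text \<open>The module M_l of the overview, with M_0 = R_0. It lies in a single parity, whereas the
  superideal it generates, which occurs in \<open>bifiltration\<close>, is M_l + M_(l+1).\<close>

definition odd_power :: "nat \<Rightarrow> 'a set" where
  "odd_power l = pow_prod R1 l R0"

lemma submod_odd_power: "submod (odd_power l)"
  unfolding odd_power_def by (intro submod_pow_prod submod_R1 submod_A)

lemma odd_power_0: "odd_power 0 = R0" and odd_power_Suc: "odd_power (Suc l) = R1 \<cdot> odd_power l"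
  by (simp_all add: odd_power_def pow_prod_Suc)

lemma odd_power_parity: "odd_power l \<subseteq> (if even l then R0 else R1)"
proof (induction l)
  case (Suc l)
  then show ?case using odd_prod_parity[of "odd_power l"] by (auto simp: odd_power_Suc split: if_splits)
qed (simp add: odd_power_0)

lemma odd_power_Int: "odd_power l \<inter> odd_power (Suc l) = {\<zero>}"
proof -
  have "odd_power l \<inter> odd_power (Suc l) \<subseteq> R0 \<inter> R1"
    using odd_power_parity[of l] odd_power_parity[of "Suc l"] by (auto split: if_splits)
  then show ?thesis using grading_direct submod_zero[OF submod_odd_power] by blast
qed

abbreviation odd_product :: "'a list \<Rightarrow> 'a" where
  "odd_product ys \<equiv> foldr (\<otimes>) ys \<one>"

lemma odd_product_odd_power: "set ys \<subseteq> R1 \<Longrightarrow> odd_product ys \<in> odd_power (length ys)"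
  by (induction ys) (auto simp: odd_power_0 odd_power_Suc intro: ideal_prod.prod)

lemma odd_product_carr: "set ys \<subseteq> R1 \<Longrightarrow> odd_product ys \<in> carrier R"
  using odd_product_odd_power submod_carr[OF submod_odd_power] by blast

text \<open>Anticommutativity moves \<open>w\<close> past the earlier factors, at the cost of a
  sign, until it meets its own copy and squares to zero.\<close>

lemma odd_mult_odd_product_eq_zero: "set ys \<subseteq> R1 \<Longrightarrow> w \<in> set ys \<Longrightarrow> w \<otimes> odd_product ys = \<zero>"
proof (induction ys)
  case (Cons y ys)
  have c: "w \<in> R1" "y \<in> R1" "w \<in> carrier R" "y \<in> carrier R" "odd_product ys \<in> carrier R"
    using Cons.prems odd_carr odd_product_carr[of ys] by auto
  show ?case
  proof (cases "w = y")
    case True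
    then show ?thesis using c odd_square_zero[OF c(2)] by (simp add: m_assoc[symmetric])
  next
    case False
    then have "w \<otimes> odd_product ys = \<zero>" using Cons by auto
    moreover have "w \<otimes> (y \<otimes> odd_product ys) = \<ominus> (y \<otimes> (w \<otimes> odd_product ys))"
      using c odd_odd_anticommute[OF c(1,2)] by (simp add: m_assoc[symmetric] l_minus)
    ultimately show ?thesis using c by simp
  qed
qed simp

lemma odd_product_not_distinct: "set ys \<subseteq> R1 \<Longrightarrow> \<not> distinct ys \<Longrightarrow> odd_product ys = \<zero>"
proof (induction ys)
  case (Cons y ys)
  then show ?case using odd_mult_odd_product_eq_zero[of ys y] odd_carr by (cases "y \<in> set ys") auto
qed simp

text \<open>Even coefficients commute with odd elements and can be pulled out, so expanding each
  factor in \<open>W\<close> leaves products of generators. This is what allows an element of M_l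
  with small annihilator to be found among products of odd elements.\<close>

lemma odd_power_span:
  assumes W: "W \<subseteq> R1" "span W = R1"
  shows "odd_power l = span (odd_product ` {ys. set ys \<subseteq> W \<and> length ys = l})" (is "_ = span (?G l)")
proof
  have Gc: "?G l \<subseteq> carrier R" for l using odd_product_carr W by auto
  show "span (?G l) \<subseteq> odd_power l"
    using odd_product_odd_power W by (intro span_least submod_odd_power) auto
  show "odd_power l \<subseteq> span (?G l)"
  proof (induction l)
    case 0
    have "\<one> \<in> ?G 0" by (intro image_eqI[of _ _ "[]"]) auto
    then have "\<one> \<in> span (?G 0)" by (rule subsetD[OF span_sub])
    then show ?case
      using cyc_least[OF submod_span[OF Gc], of \<one> 0] unfolding odd_power_0 cyc_one by blast
  next
    case (Suc l)
    let ?X = "span (?G (Suc l))"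
    have X: "submod ?X" by (rule submod_span[OF Gc])
    have "R1 \<cdot> odd_power l \<subseteq> ?X"
    proof (rule prod_least[OF X])
      fix r j assume r: "r \<in> R1" and "j \<in> odd_power l"
      then have j: "j \<in> span (?G l)" using Suc by blast
      then have jc: "j \<in> carrier R" using submod_carr[OF submod_span[OF Gc]] by blast
      have "w \<otimes> j \<in> ?X" if w: "w \<in> W" for w
      proof -
        have wR: "w \<in> R1" using w W by blast
        have "span (?G l) \<subseteq> {t \<in> carrier R. w \<otimes> t \<in> ?X}"
        proof (rule span_least)
          show "submod {t \<in> carrier R. w \<otimes> t \<in> ?X}"
            using X odd_carr[OF wR] wR odd_even_commute by (intro submod_commuting_vimage) auto
          show "?G l \<subseteq> {t \<in> carrier R. w \<otimes> t \<in> ?X}"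
          proof
            fix t assume "t \<in> ?G l"
            then obtain ys where ys: "set ys \<subseteq> W" "length ys = l" "t = odd_product ys" by blast
            then have "w \<otimes> t \<in> ?G (Suc l)" using w by (intro image_eqI[of _ _ "w # ys"]) auto
            then show "t \<in> {t \<in> carrier R. w \<otimes> t \<in> ?X}" using ys Gc[of l] span_sub[of "?G (Suc l)"] by blast
          qed
        qed
        then show ?thesis using j by blast
      qed
      then have "span W \<subseteq> {t \<in> carrier R. t \<otimes> j \<in> ?X}"
        using W odd_carr by (intro span_least submod_right_vimage X jc) auto
      then show "r \<otimes> j \<in> ?X" using r W by blast
    qed
    then show ?case by (simp add: odd_power_Suc)
  qed
qed

text \<open>Pigeonhole: a product of more than \<open>card W\<close> generators repeats a factor. It
  bounds the length of odd parameters.\<close>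

lemma odd_power_eq_zero:
  assumes W: "finite W" "W \<subseteq> R1" "span W = R1" and l: "l > card W"
  shows "odd_power l = {\<zero>}"
proof -
  have "odd_product ys = \<zero>" if "set ys \<subseteq> W" "length ys = l" for ys
  proof (rule odd_product_not_distinct)
    show "set ys \<subseteq> R1" using that W by blast
    show "\<not> distinct ys" using that l card_mono[OF W(1) that(1)] by (auto simp: distinct_card)
  qed
  then have "odd_power l \<subseteq> {\<zero>}"
    unfolding odd_power_span[OF W(2,3)] by (intro span_least submod_zero_set) auto
  then show ?thesis using submod_zero[OF submod_odd_power] by blast
qed

lemma R1_prod_R0: "R1 \<cdot> R0 = R1"
proof
  show "R1 \<cdot> R0 \<subseteq> R1" by (rule odd_prod_parity) simp
  show "R1 \<subseteq> R1 \<cdot> R0"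
  proof
    fix r assume "r \<in> R1"
    then have "r \<otimes> \<one> \<in> R1 \<cdot> R0" by (intro ideal_prod.prod) auto
    then show "r \<in> R1 \<cdot> R0" using \<open>r \<in> R1\<close> odd_carr by simp
  qed
qed

text \<open>Since R_1 = R_1 R_0, the whole ring is M_0 + M_1, and each multiplication by R_1 raises
  both indices by one.\<close>

lemma pow_prod_R1_carrier: "pow_prod R1 l (carrier R) = odd_power l <+> odd_power (Suc l)"
proof -
  have "pow_prod R1 l (carrier R) = pow_prod R1 l (R0 <+> (R1 \<cdot> R0))" by (simp add: R1_prod_R0 grading_sum)
  also have "\<dots> = odd_power l <+> pow_prod R1 l (R1 \<cdot> R0)"
    unfolding odd_power_def by (intro pow_prod_set_add submod_R1 submod_A submod_prod)
  finally show ?thesis by (simp add: odd_power_def pow_prod_Suc2)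
qed

lemma R1_sq: "submod (R1 \<cdot> R1)" "R1 \<cdot> R1 \<subseteq> R0"
  by (intro submod_prod submod_R1) (rule odd_prod_parity, simp)

text \<open>A product of two odd elements squares to zero. Hence R_0 and R_0/R_1^2 have the same
  chains of primes.\<close>

lemma R1_sq_prime: "prime_ideal p \<Longrightarrow> R1 \<cdot> R1 \<subseteq> p"
proof (rule prod_least)
  assume p: "prime_ideal p"
  then show sp: "submod p" by (simp add: prime_ideal_def)
  fix a b assume ab: "a \<in> R1" "b \<in> R1"
  note c = odd_carr[OF ab(1)] odd_carr[OF ab(2)]
  have "(a \<otimes> b) \<otimes> (a \<otimes> b) = odd_product [a, b, a, b]" using c by (simp add: m_assoc)
  also have "\<dots> = \<zero>" using ab by (intro odd_product_not_distinct) auto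
  finally have "(a \<otimes> b) \<otimes> (a \<otimes> b) \<in> p" using submod_zero[OF sp] by simp
  then show "a \<otimes> b \<in> p" using p odd_odd_closed[OF ab] by (auto simp: prime_ideal_def)
qed

lemma Kdim_quot_R1_sq: "Kdim (RA Quot (R1 \<cdot> R1)) = Kdim RA"
proof -
  have "prime_chain n (R1 \<cdot> R1) \<longleftrightarrow> prime_chain n {\<zero>}" for n
  proof -
    have "prime_ideal p \<and> R1 \<cdot> R1 \<subseteq> p \<longleftrightarrow> prime_ideal p \<and> {\<zero>} \<subseteq> p" for p
      using R1_sq_prime submod_zero by (auto simp: prime_ideal_def)
    then show ?thesis unfolding prime_chain_def by simp
  qed
  then show ?thesis unfolding Kdim_RA Kdim_quot[OF R1_sq] by simp
qed

section \<open>The components of the bigraded ring\<close>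

lemma bifiltration_eq:
  assumes "R1 \<subseteq> N" "submod (N \<inter> R0)"
  shows "bifiltration R R0 R1 N k l = pow_prod (N \<inter> R0) k (odd_power l) <+> pow_prod (N \<inter> R0) k (odd_power (Suc l))"
proof -
  have "N \<inter> R1 = R1" using assms by blast
  then have "bifiltration R R0 R1 N k l = pow_prod (N \<inter> R0) k (pow_prod R1 l (carrier R))"
    by (simp add: bifiltration_def pow_prod_def)
  then show ?thesis by (simp add: pow_prod_R1_carrier pow_prod_set_add assms submod_odd_power)
qed

text \<open>With M_l = \<open>odd_power l\<close>, the numerator is n^k M_l + n^k M_(l+1). In the
  denominator n^k M_(l+2) is absorbed by n^(k+1) M_l, since R_1^2 lies in n, and n^(k+1) M_(l+1) by
  n^k M_(l+1), leaving n^(k+1) M_l + n^k M_(l+1). The common summand n^k M_(l+1) cancels by the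
  second isomorphism theorem, as M_l and M_(l+1) have opposite parity.\<close>

lemma bgr_component_length:
  fixes N
  defines "n \<equiv> N \<inter> R0"
  assumes N: "R1 \<subseteq> N" and n: "submod n" and J: "R1 \<cdot> R1 \<subseteq> n"
  defines "X \<equiv> bifiltration R R0 R1 N"
  shows "submod (X k l)" "submod (X (Suc k) l <+> X k (Suc l))"
    "X (Suc k) l <+> X k (Suc l) \<subseteq> X k l" "n \<cdot> X k l \<subseteq> X (Suc k) l <+> X k (Suc l)"
    "len (X (Suc k) l <+> X k (Suc l)) (X k l) = len (pow_prod n (Suc k) (odd_power l)) (pow_prod n k (odd_power l))"
proof -
  have nA: "n \<subseteq> R0" by (auto simp: n_def)
  have X: "X k l = pow_prod n k (odd_power l) <+> pow_prod n k (odd_power (Suc l))" for k l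
    using bifiltration_eq[OF N] n unfolding X_def n_def by blast
  have smP: "submod (pow_prod n k (odd_power l))" for k l by (intro submod_pow_prod n submod_odd_power)
  note smX = submod_set_add[OF smP smP]
  show 1: "submod (X k l)" "submod (X (Suc k) l <+> X k (Suc l))"
    by (simp_all add: X smX submod_set_add)
  let ?P = "pow_prod n k (odd_power l)" and ?P' = "pow_prod n (Suc k) (odd_power l)" and ?Q = "pow_prod n k (odd_power (Suc l))"
  let ?Y = "?P' <+> ?Q"
  have dec: "pow_prod n (Suc k) M \<subseteq> pow_prod n k M" if "submod M" for M
    by (rule pow_prod_antimono[OF n nA that]) simp
  have Y: "X (Suc k) l <+> X k (Suc l) = ?Y"
  proof
    have "pow_prod n k (odd_power (Suc (Suc l))) \<subseteq> ?P'"
    proof -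
      have "odd_power (Suc (Suc l)) \<subseteq> n \<cdot> odd_power l"
        unfolding odd_power_Suc[of "Suc l"]
      proof (rule prod_least)
        show "submod (n \<cdot> odd_power l)" by (intro submod_prod n submod_odd_power)
        fix r s assume r: "r \<in> R1" and s: "s \<in> odd_power (Suc l)"
        show "r \<otimes> s \<in> n \<cdot> odd_power l"
        proof (rule odd_prod_vimage[OF _ r])
          show "s \<in> R1 \<cdot> odd_power l" using s by (simp add: odd_power_Suc)
          fix t p assume "t \<in> R1" "p \<in> odd_power l"
          then show "(r \<otimes> t) \<otimes> p \<in> n \<cdot> odd_power l"
            using r J ideal_prod.prod[of r R1 t R1 R] by (intro ideal_prod.prod) auto
        qed (intro submod_prod n submod_odd_power)+
      qed
      then show ?thesis unfolding pow_prod_Suc2 by (rule pow_prod_mono)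
    qed
    moreover have "?P' \<subseteq> ?Y" "?Q \<subseteq> ?Y" using set_add_left[OF smP smP] set_add_right[OF smP smP] by blast+
    ultimately show "X (Suc k) l <+> X k (Suc l) \<subseteq> ?Y"
      unfolding X using dec[OF submod_odd_power, of "Suc l"] smX
      by (intro set_add_least) auto
    show "?Y \<subseteq> X (Suc k) l <+> X k (Suc l)"
      unfolding X by (intro set_add_subset_mono set_add_left smP)
  qed
  have "?Y \<subseteq> X k l" unfolding X using dec[OF submod_odd_power] by (intro set_add_subset_mono) auto
  then show "X (Suc k) l <+> X k (Suc l) \<subseteq> X k l" unfolding Y .
  have "n \<cdot> X k l = ?P' <+> pow_prod n (Suc k) (odd_power (Suc l))"
    unfolding X pow_prod_Suc by (rule prod_set_add[OF n smP smP])
  also have "\<dots> \<subseteq> ?Y" using dec[OF submod_odd_power] by (intro set_add_subset_mono) auto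
  finally show "n \<cdot> X k l \<subseteq> X (Suc k) l <+> X k (Suc l)" unfolding Y .
  have XY: "X k l = ?P <+> ?Y"
  proof
    show "X k l \<subseteq> ?P <+> ?Y" unfolding X by (intro set_add_subset_mono set_add_right smP order_refl)
    show "?P <+> ?Y \<subseteq> X k l"
      using set_add_least[OF 1(1) _ \<open>?Y \<subseteq> X k l\<close>, of ?P] set_add_left[OF smP smP] unfolding X by blast
  qed
  have "?P \<inter> ?Y = ?P'"
  proof
    show "?P \<inter> ?Y \<subseteq> ?P'"
    proof
      fix x assume x: "x \<in> ?P \<inter> ?Y"
      then obtain a b where ab: "a \<in> ?P'" "b \<in> ?Q" "x = a \<oplus> b" by (auto simp: mem_set_add)
      have c: "b \<in> carrier R" using ab submod_carr[OF smP] by blast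
      have "a \<in> ?P" using ab dec[OF submod_odd_power] by blast
      then have "b \<in> ?P" using submod_add_cancel[OF smP, of a k l b] ab x c by simp
      then have "b \<in> odd_power l" "b \<in> odd_power (Suc l)"
        using ab(2) pow_prod_sub[OF n nA submod_odd_power] by blast+
      then have "b = \<zero>" using odd_power_Int[of l] by blast
      then show "x \<in> ?P'" using ab submod_carr[OF smP] by simp
    qed
    show "?P' \<subseteq> ?P \<inter> ?Y" using dec[OF submod_odd_power] set_add_left[OF smP smP] by blast
  qed
  then show "len (X (Suc k) l <+> X k (Suc l)) (X k l) = len ?P' ?P"
    unfolding Y XY using len_diamond[OF smP[of k l] smX[of "Suc k" l k "Suc l"]] by simp
qed

end

text \<open>\<open>Max\<close> is informative only for a finite nonempty set, hence the two
  additional conjuncts.\<close>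

theorem corollary6p11:
  fixes R :: "('a, 'b) ring_scheme" and R0 R1 m N :: "'a set"
    and K :: "'a set set" and g :: "nat \<Rightarrow> rat poly"
  assumes "super_ring R R0 R1"
    and "local_cring (even_ring R R0) m"
    and "noetherian_super_ring R R0 R1"
    and "\<exists>F. subfield F R"
    and "primary_superideal R R0 R1 (m <+>\<^bsub>R\<^esub> R1) N"
    and "special_superideal R R0 R1 N"
    and "coefficient_field (even_ring R R0 Quot (N \<inter> R0)) K"
    and "\<And>l. \<forall>\<^sub>F n in sequentially.
           poly (g l) (of_nat n) = of_nat (\<Sum>k\<le>n. bgr_dim R R0 R1 N K k l)"
  shows "let L = {l. poly_degree (g l) = Ksdim0 R R0} in
           finite L \<and> L \<noteq> {} \<and> Ksdim1 R R0 R1 = enat (Max L)"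
proof -
  interpret super_ring R R0 R1 by (rule assms(1))
  define n where "n = N \<inter> R0"
  have accs: "acc R0" "acc R1" using noetherian_acc[OF assms(3)] by blast+
  have mx: "maximalideal m RA" using assms(2) by (simp add: local_cring_def)
  note m = maximalidealD[OF mx]
  have mR: "(m <+>\<^bsub>R\<^esub> R1) \<inter> R0 = m" by (rule sum_even_part(1)[OF m(1,2) submod_R1 order_refl])
  have N: "R1 \<subseteq> N" "ideal N R" using assms(5,6) by (auto simp: special_superideal_def primary_superideal_def superideal_def)
  have prim: "ideal n RA" "n \<noteq> carrier RA" "radical_of RA n = m"
    using assms(5) unfolding primary_superideal_def primary_ideal_def mR n_def by auto
  have n: "submod n" "n \<subseteq> R0" using prim(1) by (auto simp: ideal_iff)
  have nm: "n \<subseteq> m"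
  proof
    fix a assume a: "a \<in> n"
    then have "a [^]\<^bsub>RA\<^esub> (1::nat) \<in> n" using submod_carr[OF n(1)] by (simp add: pow_RA)
    moreover have "a \<in> carrier RA" using a n(2) by auto
    ultimately show "a \<in> m" unfolding prim(3)[symmetric] radical_of_def by blast
  qed
  have J: "R1 \<cdot>\<^bsub>R\<^esub> R1 \<subseteq> n"
  proof (rule prod_least[OF n(1)])
    fix i j assume "i \<in> R1" "j \<in> R1"
    then show "i \<otimes>\<^bsub>R\<^esub> j \<in> n" unfolding n_def
      using ideal.I_r_closed[OF N(2), of i j] N(1) odd_carr odd_odd_closed by auto
  qed
  have pm: "p \<subseteq> m" if "prime_ideal p" for p
    using local_proper_subset[OF accs(1) assms(2)] that by (auto simp: prime_ideal_def)
  have nfin: "len n R0 \<noteq> \<infinity>"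
    using prime_over_primary[OF mx prim(3)] m(4) by (intro finite_length_primary[OF accs(1) n, of m])
  \<comment> \<open>Finiteness of the dimension is read off from the length of a system of
    parameters of R_0/R_1^2, a ring of the same dimension as R_0.\<close>
  obtain d :: nat where "Kdim (RA Quot (R1 \<cdot>\<^bsub>R\<^esub> R1)) = ereal (real d)"
    using assms(6) unfolding special_superideal_def Let_def system_of_parameters_def by metis
  then have Kd: "Kdim RA = ereal (real d)" by (simp add: Kdim_quot_R1_sq)
  then have dmax: "prime_chain d {\<zero>\<^bsub>R\<^esub>}" "\<And>k. prime_chain k {\<zero>\<^bsub>R\<^esub>} \<Longrightarrow> k \<le> d"
    unfolding Kdim_RA SUP_ereal_nat_eq_iff by auto
  have col: "submod (colon {\<zero>\<^bsub>R\<^esub>} u)" "\<zero>\<^bsub>R\<^esub> \<in> colon {\<zero>\<^bsub>R\<^esub>} u" if "u \<in> carrier R" for u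
    using submod_colon[OF submod_zero_set that] submod_zero by blast+
  \<comment> \<open>A chain above Ann(u) is also a chain above 0, so the dimension of R_0/Ann(u)
    never exceeds \<open>d\<close>, and equality only requires a chain of length
    \<open>d\<close>.\<close>
  have Kann: "Kdim (RA Quot colon {\<zero>\<^bsub>R\<^esub>} u) = ereal (real d) \<longleftrightarrow> prime_chain d (colon {\<zero>\<^bsub>R\<^esub>} u)" if "u \<in> carrier R" for u
    unfolding Kdim_quot[OF col(1)[OF that] colon_sub] SUP_ereal_nat_eq_iff
    using dmax(2) prime_chain_antimono[of _ "colon {\<zero>\<^bsub>R\<^esub>} u" "{\<zero>\<^bsub>R\<^esub>}"] col(2)[OF that] by auto
  obtain W where W: "finite W" "W \<subseteq> R1" "span W = R1"
    using finitely_generated[OF accs(2) submod_R1] by blast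
  define G where "G l = odd_product ` {ys. set ys \<subseteq> W \<and> length ys = l}" for l
  have G: "finite (G l)" "span (G l) = odd_power l" for l
    using finite_lists_length_eq[OF W(1)] odd_power_span[OF W(2,3)] by (auto simp: G_def)
  have Gc: "u \<in> carrier R" if "u \<in> G l" for u l using that odd_product_carr W(2) by (auto simp: G_def)
  have acc_odd_power: "acc (odd_power l)" for l
    using odd_power_parity[of l] acc_subset[OF accs(1)] acc_subset[OF accs(2)] by (auto split: if_splits)
  define H where "H l k = len (pow_prod n k (odd_power l)) (odd_power l)" for l k
  have upper: "\<exists>C. \<forall>k. H l k \<le> enat (C * (if e = 0 then 0 else (k + 1) ^ (e - 1)))"
    if "\<And>u. u \<in> G l \<Longrightarrow> \<not> prime_chain e (colon {\<zero>\<^bsub>R\<^esub>} u)" for l e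
    unfolding H_def by (rule hilbert_module_upper[OF accs(1) n nfin submod_odd_power G that])
  have upper_d: "\<exists>C. \<forall>k. H l k \<le> enat (C * (k + 1) ^ d)" for l
  proof -
    have "\<not> prime_chain (Suc d) (colon {\<zero>\<^bsub>R\<^esub>} u)" if "u \<in> G l" for u
      using dmax(2)[of "Suc d"] prime_chain_antimono[of "Suc d" "colon {\<zero>\<^bsub>R\<^esub>} u" "{\<zero>\<^bsub>R\<^esub>}"] col(2)[OF Gc[OF that]] by auto
    then show ?thesis using upper[of l "Suc d"] by simp
  qed
  \<comment> \<open>The sum of the dimensions for k = 0, ..., j telescopes to the length of M_l
    modulo n^(j+1) M_l, whence \<open>Suc\<close>. Finiteness, needed for \<open>the_enat\<close>,
    comes from \<open>upper_d\<close>.\<close>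
  define h where "h l k = the_enat (H l (Suc k))" for l k
  have h: "enat (h l k) = H l (Suc k)" for l k
  proof -
    obtain C where "H l (Suc k) \<le> enat (C * (Suc k + 1) ^ d)" using upper_d by blast
    then show ?thesis unfolding h_def by (cases "H l (Suc k)") auto
  qed
  have hsum: "(\<Sum>k\<le>j. bgr_dim R R0 R1 N K k l) = h l j" for j l
  proof -
    have sm: "submod (pow_prod n k (odd_power l))" for k by (rule submod_pow_prod[OF n(1) submod_odd_power])
    have step: "H l (Suc k) = len (pow_prod n (Suc k) (odd_power l)) (pow_prod n k (odd_power l)) + H l k" for k
      unfolding H_def using pow_prod_antimono[OF n submod_odd_power, of k "Suc k" l] pow_prod_sub[OF n submod_odd_power]
      by (intro len_add sm submod_odd_power) auto
    have H0: "H l 0 = 0" unfolding H_def by (rule len_eq_0) simp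
    have bgr: "enat (bgr_dim R R0 R1 N K k l) = len (pow_prod n (Suc k) (odd_power l)) (pow_prod n k (odd_power l))" for k
    proof -
      note B = bgr_component_length[OF N(1) n(1)[unfolded n_def] J[unfolded n_def], of k l, folded n_def]
      \<comment> \<open>\<open>dim_quotient_module\<close> asks for a finite length, which the bound
        by \<open>h l k\<close> supplies.\<close>
      have "len (pow_prod n (Suc k) (odd_power l)) (pow_prod n k (odd_power l)) \<le> enat (h l k)" unfolding h step by simp
      then obtain t where t: "len (pow_prod n (Suc k) (odd_power l)) (pow_prod n k (odd_power l)) = enat t"
        by (cases "len (pow_prod n (Suc k) (odd_power l)) (pow_prod n k (odd_power l))") auto
      have "\<exists>k::nat. \<mu> [^]\<^bsub>R\<^esub> k \<in> n" if "\<mu> \<in> m" for \<mu>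
        using that unfolding prim(3)[symmetric] by (auto simp: radical_of_def pow_RA)
      then have "bgr_dim R R0 R1 N K k l = t"
        unfolding bgr_dim_def bgr_component_def n_def[symmetric]
        using dim_quotient_module[OF n B(2,1,3,4) _ m(1,2), of K t]
          coefficient_representative[OF mx prim(3) n nm assms(7)[folded n_def]] B(5) t
          assms(7)[folded n_def] by (auto simp: coefficient_field_def)
      then show ?thesis using t by simp
    qed
    have "enat (\<Sum>k\<le>j. bgr_dim R R0 R1 N K k l) = H l (Suc j)"
    proof (induction j)
      case 0
      then show ?case using bgr[of 0] step[of 0] H0 by simp
    next
      case (Suc j)
      have "enat (\<Sum>k\<le>Suc j. bgr_dim R R0 R1 N K k l) = enat (\<Sum>k\<le>j. bgr_dim R R0 R1 N K k l) + enat (bgr_dim R R0 R1 N K (Suc j) l)"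
        by simp
      then show ?case unfolding Suc bgr step[of "Suc j"] by (simp add: add.commute)
    qed
    then show ?thesis unfolding h[symmetric] by simp
  qed
  \<comment> \<open>The growth lemmas concern real polynomials; the change of field keeps degree and
    vanishing.\<close>
  define q where "q l = map_poly real_of_rat (g l)" for l
  have qdeg: "degree (q l) = degree (g l)" "q l = 0 \<longleftrightarrow> g l = 0" for l
    by (simp_all add: q_def degree_map_poly map_poly_eq_0_iff)
  have qpoly: "\<forall>\<^sub>F j in sequentially. poly (q l) (real j) = real (h l j)" for l
    using assms(8)[of l]
  proof (rule eventually_mono)
    fix j assume "poly (g l) (of_nat j) = of_nat (\<Sum>k\<le>j. bgr_dim R R0 R1 N K k l)"
    then have "real_of_rat (poly (g l) (of_nat j)) = real (h l j)" by (simp only: hsum of_rat_of_nat_eq)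
    moreover have "real_of_rat (poly p x) = poly (map_poly real_of_rat p) (real_of_rat x)" for p x
      by (induction p) (auto simp: map_poly_pCons of_rat_add of_rat_mult)
    ultimately show "poly (q l) (real j) = real (h l j)" by (simp add: q_def)
  qed
  \<comment> \<open>Unlike \<open>odd_parameters\<close> this admits the empty list: its product 1
    has annihilator 0, which makes \<open>0\<close> good.\<close>
  define good where "good l \<longleftrightarrow> (\<exists>ys. set ys \<subseteq> R1 \<and> length ys = l \<and> prime_chain d (colon {\<zero>\<^bsub>R\<^esub>} (odd_product ys)))" for l
  have hbound: "real (h l k) \<le> real C * (real k + 2) ^ e"
    if "\<And>k. H l k \<le> enat (C * (k + 1) ^ e)" for l k C e
  proof -
    have "enat (h l k) \<le> enat (C * (Suc k + 1) ^ e)" unfolding h by (rule that)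
    then have "real (h l k) \<le> real (C * (Suc k + 1) ^ e)" by (simp only: enat_ord_simps of_nat_le_iff)
    then show ?thesis by (simp add: add.commute)
  qed
  have deg_le: "degree (q l) \<le> d" for l
  proof -
    obtain C where "\<And>k. H l k \<le> enat (C * (k + 1) ^ d)" using upper_d by blast
    then show ?thesis using degree_le_of_growth[OF qpoly hbound] by blast
  qed
  have deg_good: "poly_degree (g l) = ereal (real d) \<longleftrightarrow> good l" for l
  proof
    assume "good l"
    then obtain ys where ys: "set ys \<subseteq> R1" "length ys = l" "prime_chain d (colon {\<zero>\<^bsub>R\<^esub>} (odd_product ys))"
      by (auto simp: good_def)
    obtain c where c: "c \<ge> 1" "\<And>j. enat (j choose d) \<le> H l (c * (j + 1))"
      using hilbert_module_lower[OF accs(1) n m(1) nm m(3) pm acc_odd_power submod_odd_power _ ys(3), of l] odd_product_odd_power ys(1,2)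
      unfolding H_def by blast
    have "j choose d \<le> h l (c * (j + 1) - 1)" for j
    proof -
      have "Suc (c * (j + 1) - 1) = c * (j + 1)" using c(1) by (cases c) auto
      then have "enat (j choose d) \<le> enat (h l (c * (j + 1) - 1))" unfolding h using c(2)[of j] by simp
      then show ?thesis by simp
    qed
    then have "q l \<noteq> 0" "d \<le> degree (q l)" using degree_ge_of_growth[OF qpoly c(1)] by blast+
    then show "poly_degree (g l) = ereal (real d)"
      using deg_le[of l] qdeg[of l] by (simp add: poly_degree_def)
  next
    assume pd: "poly_degree (g l) = ereal (real d)"
    then have gl: "g l \<noteq> 0" "degree (g l) = d" by (auto simp: poly_degree_def split: if_splits)
    show "good l"
    proof (rule ccontr)
      assume ng: "\<not> good l"
      \<comment> \<open>The generators in \<open>G l\<close> are themselves products of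
        \<open>l\<close> odd elements, so none of them has a chain of length \<open>d\<close> above
        its annihilator, and the growth exponent drops below \<open>d\<close>.\<close>
      have "\<not> prime_chain d (colon {\<zero>\<^bsub>R\<^esub>} u)" if "u \<in> G l" for u
        using that ng W(2) by (auto simp: G_def good_def)
      then obtain C where C: "\<And>k. H l k \<le> enat (C * (if d = 0 then 0 else (k + 1) ^ (d - 1)))"
        using upper[of l d] by blast
      show False
      proof (cases "d = 0")
        \<comment> \<open>For \<open>d = 0\<close> there is no lower exponent: the bound is 0, and
          the constant polynomial has to vanish.\<close>
        case True
        then have "enat (h l k) \<le> enat 0" for k unfolding h using C[of "Suc k"] by simp
        then have "h l k = 0" for k by simp
        then obtain j where "poly (q l) (real j) = 0"
          using qpoly[of l] by (auto simp: eventually_sequentially)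
        moreover obtain a where "q l = [:a:]" using qdeg[of l] gl True by (metis degree_eq_zeroE)
        ultimately show False using qdeg[of l] gl by simp
      next
        case False
        then have "degree (q l) \<le> d - 1"
          using C by (intro degree_le_of_growth[OF qpoly hbound[of l C]]) auto
        then show False using False qdeg[of l] gl by simp
      qed
    qed
  qed
  let ?L = "{l. good l}"
  have L: "{l. poly_degree (g l) = Ksdim0 R R0} = ?L"
    unfolding Ksdim0_def Kd deg_good ..
  have good_le: "l \<le> card W" if gl: "good l" for l
  proof (rule ccontr)
    assume "\<not> l \<le> card W"
    then have "odd_power l = {\<zero>\<^bsub>R\<^esub>}" using odd_power_eq_zero[OF W] by simp
    moreover obtain ys where ys: "set ys \<subseteq> R1" "length ys = l" "prime_chain d (colon {\<zero>\<^bsub>R\<^esub>} (odd_product ys))"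
      using gl by (auto simp: good_def)
    ultimately have "odd_product ys = \<zero>\<^bsub>R\<^esub>" using odd_product_odd_power[of ys] by auto
    \<comment> \<open>An annihilator containing 1 is all of R_0, and no prime lies above it.\<close>
    then have "\<one>\<^bsub>R\<^esub> \<in> colon {\<zero>\<^bsub>R\<^esub>} (odd_product ys)" by (simp add: colon_def)
    then show False using ys(3) unfolding prime_chain_def prime_ideal_def by blast
  qed
  have fin: "finite ?L" using good_le by (auto intro: finite_subset[of _ "{..card W}"])
  have "colon {\<zero>\<^bsub>R\<^esub>} (odd_product []) = {\<zero>\<^bsub>R\<^esub>}" using A_carr by (auto simp: colon_def)
  then have "good 0" unfolding good_def using dmax(1) by (intro exI[of _ "[]"]) simp
  then have ne: "?L \<noteq> {}" by blast
  have odd: "odd_parameters R R0 R1 ys \<longleftrightarrow> ys \<noteq> [] \<and> set ys \<subseteq> R1 \<and> prime_chain d (colon {\<zero>\<^bsub>R\<^esub>} (odd_product ys))" for ys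
  proof -
    have "even_annihilator R R0 (odd_product ys) = colon {\<zero>\<^bsub>R\<^esub>} (odd_product ys)"
      by (simp add: even_annihilator_def colon_def)
    then show ?thesis unfolding odd_parameters_def Kd using Kann odd_product_carr[of ys] by auto
  qed
  have "Ksdim1 R R0 R1 = enat (Max ?L)"
  proof (rule antisym)
    show "Ksdim1 R R0 R1 \<le> enat (Max ?L)"
      unfolding Ksdim1_def
    proof (rule SUP_least)
      fix ys assume "ys \<in> {ys. odd_parameters R R0 R1 ys}"
      then have "length ys \<in> ?L" by (auto simp: odd good_def)
      then show "enat (length ys) \<le> enat (Max ?L)" using fin by simp
    qed
    show "enat (Max ?L) \<le> Ksdim1 R R0 R1"
    \<comment> \<open>A maximum of 0 leaves nothing to show in \<open>enat\<close>; a positive one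
      is attained by a nonempty list, which then consists of odd parameters.\<close>
    proof (cases "Max ?L = 0")
      case False
      obtain ys where ys: "set ys \<subseteq> R1" "length ys = Max ?L" "prime_chain d (colon {\<zero>\<^bsub>R\<^esub>} (odd_product ys))"
        using Max_in[OF fin ne] by (auto simp: good_def)
      then have "odd_parameters R R0 R1 ys" using False by (auto simp: odd)
      then show ?thesis unfolding Ksdim1_def ys(2)[symmetric] by (intro SUP_upper) simp
    qed (simp add: zero_enat_def[symmetric])
  qed
  then show ?thesis unfolding Let_def L using fin ne by blast
qed

end
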